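(* Let $P(z),q(z)\in\mathbb{C}[z]$, $q\neq 0$, $Q(z)=\int q(z)\,dz$, $\deg P=n$, $\deg Q=m$, and $a,b\in\mathbb{C}$, $a\neq b$. Suppose that $\int_a^b P^i(z)q(z)\,dz=0$ for all integers $i\ge 0$. Then $\gcd(m,n)>1$.
   Context: $Q$ is an antiderivative of $q$. *)

theory Defs
  imports "HOL-Complex_Analysis.Complex_Analysis" "HOL-Computational_Algebra.Polynomial"
begin

end

theory Submission
  imports Defs "HOL-Computational_Algebra.Fundamental_Theorem_Algebra" "HOL-Number_Theory.Cong"
begin

text \<open>
  The moments are the Taylor coefficients at infinity of \<open>H(t) = \<integral>\<^sub>a\<^sup>b q(z) / (P(z) - t) dz\<close>, so \<open>H\<close> vanishes
  for large \<open>t\<close>. If \<open>z\<^sub>i(t)\<close> are the branches of the inverse of \<open>P\<close>, partial fractions turn this into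
  \<open>C(t) + (\<Sum>i. (q / P')(z\<^sub>i) * log ((b - z\<^sub>i) / (a - z\<^sub>i))) = 0\<close> with a polynomial \<open>C\<close>, an identity that can be
  continued analytically. Continuing it around \<open>P(a)\<close> shows that the average of \<open>(q / P')(z\<^sub>i)\<close> over the
  branches with \<open>z\<^sub>i \<rightarrow> a\<close> equals the average over those with \<open>z\<^sub>i \<rightarrow> b\<close> if \<open>P(a) = P(b)\<close>, and is zero
  otherwise. Following the branches along a generic ray to infinity, where \<open>z\<^sub>i\<close> is asymptotic to
  \<open>\<kappa> w\<^sub>i t\<^bsup>1/n\<^esup>\<close> for an \<open>n\<close>-th root of unity \<open>w\<^sub>i\<close>, the leading terms give the same relation between the
  \<open>w\<^sub>i\<^sup>m\<close>. If \<open>m\<close> and \<open>n\<close> are coprime, a Galois automorphism replaces \<open>w\<^sub>i\<^sup>m\<close> by \<open>w\<^sub>i\<close>. But the curves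
  traced by the branches starting at \<open>a\<close> are disjoint from those starting at \<open>b\<close>, so their directions at
  infinity do not interlace and a line separates the two families, which contradicts the relation. If
  \<open>P(a) \<noteq> P(b)\<close>, disjoint rays are used at the two end points, and both sums vanish.
\<close>

section \<open>Linear relations between roots of unity\<close>

text \<open>Two unrelated kinds of information meet here. Analysis yields linear relations between
  the powers \<open>w i ^ m\<close>, which are the leading terms of the residues
  \<open>q / P'\<close> up to a common factor. Planar topology controls the cyclic order of the
  \<open>w i\<close> themselves, and taking \<open>m\<close>-th powers scrambles this order. The
  link is that the weights \<open>1 / card A\<close> and \<open>1 / card B\<close> are rational,
  hence fixed by Galois automorphisms, while \<open>m\<close> is invertible modulo \<open>n\<close>.

  The averages come from ramification, since \<open>P a\<close> may be a critical value. If
  \<open>a\<close> is a root of \<open>P - P a\<close> of multiplicity \<open>card A\<close>, that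
  many branches meet there, and each of their logarithms behaves like \<open>- u / card A\<close> in
  the coordinate \<open>u = log ((t - P a) / v)\<close>. Turning \<open>N\<close> times around
  \<open>P a\<close>, with \<open>N\<close> a common period of all branches, changes nothing but the
  logarithms.

  If \<open>P a\<close> and \<open>P b\<close> differ, no branch tends to \<open>b\<close>, and the
  average over the empty set is 0 by the convention \<open>x / 0 = 0\<close>. One relation thus
  covers both cases, and in both the final contradiction is with an equality of two averages, the
  common value being 0 in the second.\<close>

definition ieval :: "int poly \<Rightarrow> complex \<Rightarrow> complex" where
  "ieval f x = poly (map_poly of_int f) x"

lemma ieval_0 [simp]: "ieval 0 x = 0"
  by (simp add: ieval_def)

lemma ieval_pCons [simp]: "ieval (pCons c f) x = of_int c + x * ieval f x"
  by (simp add: ieval_def map_poly_pCons)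

lemma ieval_add [simp]: "ieval (f + g) x = ieval f x + ieval g x"
  by (induction f g rule: poly_induct2) (auto simp: algebra_simps)

lemma ieval_smult [simp]: "ieval (smult c f) x = of_int c * ieval f x"
  by (induction f) (auto simp: algebra_simps)

lemma ieval_mult [simp]: "ieval (f * g) x = ieval f x * ieval g x"
  by (induction f) (auto simp: algebra_simps)

lemma ieval_diff [simp]: "ieval (f - g) x = ieval f x - ieval g x"
  using ieval_add[of "f - g" g x] by simp

lemma ieval_1 [simp]: "ieval 1 x = 1"
  by (simp add: one_pCons)

lemma ieval_power [simp]: "ieval (f ^ k) x = ieval f x ^ k"
  by (induction k) auto

lemma ieval_monom [simp]: "ieval (monom c k) x = of_int c * x ^ k"
  by (induction k) (auto simp: monom_Suc monom_0)

lemma ieval_pcompose [simp]: "ieval (pcompose f g) x = ieval f (ieval g x)"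
  by (induction f) (auto simp: pcompose_pCons)

lemma ieval_sum [simp]: "ieval (\<Sum>i\<in>I. f i) x = (\<Sum>i\<in>I. ieval (f i) x)"
  by (induction I rule: infinite_finite_induct) auto

section \<open>Congruences modulo a prime and conjugate roots of unity\<close>

lemma prime_dvd_add_power:
  fixes x y :: "'a :: comm_ring_1"
  assumes "prime p"
  shows "of_nat p dvd (x + y) ^ p - x ^ p - y ^ p"
proof -
  have p: "p > 0" using assms prime_gt_0_nat by auto
  have "(x + y) ^ p = (\<Sum>k\<le>p. of_nat (p choose k) * x ^ k * y ^ (p - k))"
    by (simp add: binomial_ring)
  also have "{..p} = insert 0 (insert p {0<..<p})" by auto
  also have "(\<Sum>k\<in>\<dots>. of_nat (p choose k) * x ^ k * y ^ (p - k)) =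
     x ^ p + y ^ p + (\<Sum>k\<in>{0<..<p}. of_nat (p choose k) * x ^ k * y ^ (p - k))"
    using p by simp
  finally have eq: "(x + y) ^ p - x ^ p - y ^ p =
      (\<Sum>k\<in>{0<..<p}. of_nat (p choose k) * x ^ k * y ^ (p - k))" by simp
  have "of_nat p dvd (of_nat (p choose k) :: 'a)" if "k \<in> {0<..<p}" for k
  proof -
    have "p dvd (p choose k)" using that assms by (intro dvd_choose_prime) auto
    then show ?thesis by (metis dvd_def of_nat_mult)
  qed
  then show ?thesis unfolding eq by (intro dvd_sum) (simp add: dvd_mult2)
qed

lemma prime_dvd_power_diff_self:
  fixes c :: int
  assumes "prime p"
  shows "int p dvd c ^ p - c"
proof -
  have p: "p > 0" using assms prime_gt_0_nat by auto
  have nat: "int p dvd int k ^ p - int k" for k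
  proof (induction k)
    case (Suc k)
    have "int p dvd (int k + 1) ^ p - int k ^ p - 1 ^ p"
      using prime_dvd_add_power[OF assms, of "int k" 1] by simp
    from dvd_add[OF this Suc.IH] show ?case by (simp add: algebra_simps)
  qed (use p in \<open>simp add: power_0_left\<close>)
  have "[c = int (nat (c mod int p))] (mod int p)" using p by (simp add: cong_def)
  then have "[c ^ p - c = int (nat (c mod int p)) ^ p - int (nat (c mod int p))] (mod int p)"
    by (intro cong_diff cong_pow)
  then show ?thesis using nat cong_dvd_iff cong_sym
    by (metis cong_0_iff cong_trans)
qed

text \<open>Modulo \<open>p\<close>, taking \<open>p\<close>-th powers is additive and fixes the
  coefficients by Fermat, so only the exponents are multiplied by \<open>p\<close>. The remainder
  \<open>u\<close> is kept explicit because the identity will be evaluated at a complex number,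
  where divisibility by \<open>p\<close> says nothing.\<close>

lemma frobenius_poly:
  fixes h :: "int poly"
  assumes "prime p"
  obtains u where "h ^ p = pcompose h (monom 1 p) + smult (int p) u"
proof -
  have *: "[:int p:] dvd h ^ p - pcompose h (monom 1 p)"
  proof (induction h)
    case 0
    then show ?case using prime_gt_0_nat[OF assms] by (simp add: power_0_left)
  next
    case (pCons c h)
    have 1: "pCons c h = [:c:] + [:0,1:] * h" by simp
    \<comment> \<open>The sum of three differences, each divisible by \<open>p\<close>, telescopes
      to the wanted one.\<close>
    have alg: "(A - B - X * H) + (B - C) + X * (H - K) = A - (C + X * K)" for A B C H K X :: "int poly"
      by (simp add: algebra_simps)
    have "[:int p:] dvd (pCons c h) ^ p - [:c:] ^ p - ([:0,1:] * h) ^ p"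
      using prime_dvd_add_power[OF assms, of "[:c:]" "[:0,1:] * h"] unfolding 1 by (simp add: of_nat_poly)
    moreover have "[:int p:] dvd [:c:] ^ p - [:c:]"
    proof -
      obtain k where "c ^ p - c = int p * k"
        using prime_dvd_power_diff_self[OF assms, of c] by (auto elim: dvdE)
      then have "[:c:] ^ p - [:c:] = [:int p:] * [:k:]" by (simp add: poly_const_pow)
      then show ?thesis by simp
    qed
    moreover have "[:int p:] dvd [:0,1:] ^ p * (h ^ p - pcompose h (monom 1 p))"
      using pCons.IH by simp
    ultimately have "[:int p:] dvd ((pCons c h) ^ p - [:c:] ^ p - ([:0,1:] * h) ^ p) + ([:c:] ^ p - [:c:]) + [:0,1:] ^ p * (h ^ p - pcompose h (monom 1 p))"
      by (intro dvd_add)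
    also have "\<dots> = (pCons c h) ^ p - pcompose (pCons c h) (monom 1 p)"
      unfolding pcompose_pCons power_mult_distrib by (simp only: alg monom_altdef smult_1_left)
    finally show ?case .
  qed
  then obtain u where "h ^ p - pcompose h (monom 1 p) = [:int p:] * u" by (auto elim: dvdE)
  then show ?thesis using that[of u] by (simp add: algebra_simps)
qed

text \<open>Gauss's lemma: an annihilating polynomial of least degree is made primitive, so that it
  divides over the integers and not only over the rationals. Pseudo-division costs a factor
  \<open>c\<close>; comparing contents shows that \<open>c\<close> divides the cofactor, so it
  cancels.\<close>

lemma int_min_poly:
  assumes "f \<noteq> 0" "ieval f x = 0"
  obtains g where "ieval g x = 0" "g \<noteq> 0" "\<And>f. ieval f x = 0 \<Longrightarrow> g dvd f"
    "\<And>f. ieval f x = 0 \<Longrightarrow> degree f < degree g \<Longrightarrow> f = 0"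
proof -
  define d where "d = (LEAST d. \<exists>f. f \<noteq> 0 \<and> ieval f x = 0 \<and> degree f = d)"
  have "\<exists>f. f \<noteq> 0 \<and> ieval f x = 0 \<and> degree f = d"
    unfolding d_def by (rule LeastI) (use assms in blast)
  then obtain g0 where g0: "g0 \<noteq> 0" "ieval g0 x = 0" "degree g0 = d" by auto
  have least: "f = 0" if "ieval f x = 0" "degree f < d" for f
    using that not_less_Least[of "degree f" "\<lambda>d. \<exists>f. f \<noteq> 0 \<and> ieval f x = 0 \<and> degree f = d"]
    unfolding d_def by blast
  define g where "g = primitive_part g0"
  have g: "g \<noteq> 0" "degree g = d" "content g = 1"
    using g0 by (auto simp: g_def)
  have "ieval g0 x = of_int (content g0) * ieval g x"
    unfolding g_def by (metis content_times_primitive_part ieval_smult)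
  then have gx: "ieval g x = 0" using g0 by auto
  have "g dvd f" if f: "ieval f x = 0" for f
  proof -
    obtain c s where c: "c \<noteq> 0" "smult c f = g * s + pseudo_mod f g"
      and deg: "pseudo_mod f g = 0 \<or> degree (pseudo_mod f g) < degree g"
      using pseudo_mod[OF g(1), of f] by auto
    have "pseudo_mod f g = smult c f - g * s" using c by simp
    then have "ieval (pseudo_mod f g) x = 0" using f gx by simp
    then have "pseudo_mod f g = 0" using deg least g by auto
    then have eq: "smult c f = g * s" using c by simp
    have "content (smult c f) = content s" unfolding eq content_mult g(3) by simp
    then have "normalize c * content f = content s" by (simp only: content_smult mult_1)
    then have "c dvd content s" by (metis dvd_mult2 dvd_normalize_iff dvd_refl)
    then have "[:c:] dvd s" by (simp add: const_poly_dvd_iff_dvd_content)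
    then obtain s' where "s = [:c:] * s'" by (auto elim: dvdE)
    then have "smult c f = smult c (g * s')" using eq by simp
    then have "f = g * s'" using c(1) by (metis smult_cancel)
    then show ?thesis by simp
  qed
  then show ?thesis using that[of g] gx g least by auto
qed

text \<open>Modulo \<open>p\<close> the product is constant while \<open>g\<close> keeps its
  positive degree, so the cofactor \<open>s\<close> vanishes modulo \<open>p\<close>, and with it
  the constant. The coefficients of \<open>s\<close> are treated from the top down: each one meets
  the leading coefficient of \<open>g\<close> in a coefficient of the product whose other terms are
  already known to be divisible.\<close>

lemma const_dvd_if_dvd_monic_mult:
  fixes g s :: "int poly"
  assumes "degree g > 0" "\<bar>lead_coeff g\<bar> = 1" "prime p" "g * s = smult p w - [:c:]"
  shows "p dvd c"
proof -
  have "p dvd coeff s i" for i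
  proof (induction "degree s + 1 - i" arbitrary: i rule: less_induct)
    case less
    show ?case
    proof (cases "i > degree s")
      case True then show ?thesis by (simp add: coeff_eq_0)
    next
      case False
      have A: "coeff (g * s) (degree g + i) = p * coeff w (degree g + i)"
        using assms(1) unfolding assms(4) by (cases "degree g + i") auto
      have "coeff (g * s) (degree g + i) =
         (\<Sum>k\<le>degree g + i. coeff g k * coeff s (degree g + i - k))"
        by (simp add: coeff_mult)
      also have "\<dots> = lead_coeff g * coeff s i +
         (\<Sum>k\<in>{..degree g + i} - {degree g}. coeff g k * coeff s (degree g + i - k))"
        by (subst sum.remove[of _ "degree g"]) auto
      finally have B: "lead_coeff g * coeff s i = p * coeff w (degree g + i) -
         (\<Sum>k\<in>{..degree g + i} - {degree g}. coeff g k * coeff s (degree g + i - k))"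
        unfolding A by linarith
      have "p dvd (\<Sum>k\<in>{..degree g + i} - {degree g}. coeff g k * coeff s (degree g + i - k))"
      proof (intro dvd_sum)
        fix k assume k: "k \<in> {..degree g + i} - {degree g}"
        show "p dvd coeff g k * coeff s (degree g + i - k)"
        proof (cases "k > degree g")
          case True then show ?thesis by (simp add: coeff_eq_0)
        next
          case False
          then have "degree s + 1 - (degree g + i - k) < degree s + 1 - i"
            using k \<open>\<not> i > degree s\<close> by auto
          then show ?thesis using less by (intro dvd_mult) blast
        qed
      qed
      then have "p dvd lead_coeff g * coeff s i"
        unfolding B by (intro dvd_diff) auto
      then have "p dvd \<bar>lead_coeff g * coeff s i\<bar>" by simp
      then show ?thesis unfolding abs_mult assms(2) by simp
    qed
  qed
  then have "p dvd coeff (g * s) 0" by (simp add: coeff_mult)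
  then have "p dvd p * coeff w 0 - c" unfolding assms(4) by simp
  then have "p dvd p * coeff w 0 - (p * coeff w 0 - c)" by (rule dvd_diff[OF dvd_triv_left])
  then show ?thesis by simp
qed

text \<open>With the minimal polynomial \<open>g\<close> of \<open>x\<close> and \<open>X\<^sup>n - 1 = g * h\<close>: if \<open>h(x\<^sup>p) = 0\<close>, then \<open>h(x)\<^sup>p\<close> is divisible by
  \<open>p\<close>, and so is the \<open>p\<close>-th power of \<open>n * x\<^bsup>n-1\<^esup> = g'(x) * h(x)\<close>, contradicting that \<open>p\<close> does not divide \<open>n\<close>.\<close>

lemma ieval_root_unity_power_prime:
  assumes "n > 0" "x ^ n = 1" "prime p" "\<not> p dvd n" "ieval f x = 0"
  shows "ieval f (x ^ p) = 0"
proof -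
  have x0: "x \<noteq> 0" using assms(1,2) by (auto simp: power_0_left)
  have mon: "monom 1 n - 1 \<noteq> (0 :: int poly)"
  proof
    assume "monom 1 n - 1 = (0 :: int poly)"
    then have "degree (monom 1 n :: int poly) = degree (1 :: int poly)" by simp
    then show False using assms(1) by (simp add: degree_monom_eq)
  qed
  have rt: "ieval (monom 1 n - 1) x = 0" using assms by simp
  obtain g where g: "ieval g x = 0" "g \<noteq> 0" "\<And>f. ieval f x = 0 \<Longrightarrow> g dvd f"
    using int_min_poly[OF mon rt] by metis
  obtain h where h: "monom 1 n - 1 = g * h" using g(3)[OF rt] by (auto elim: dvdE)
  have degm: "degree (monom 1 n - 1 :: int poly) = n"
    using assms(1) by (subst diff_conv_add_uminus, subst degree_add_eq_left) (auto simp: degree_monom_eq)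
  have "lead_coeff (monom 1 n - 1 :: int poly) = 1"
    unfolding degm using assms(1) by (simp add: coeff_1)
  then have "lead_coeff g * lead_coeff h = 1" unfolding h lead_coeff_mult .
  then have lead: "\<bar>lead_coeff g\<bar> = 1" by (auto simp: zmult_eq_1_iff)
  have deg: "degree g > 0"
  proof (rule ccontr)
    assume "\<not> degree g > 0"
    then obtain c where "g = [:c:]" by (metis degree_eq_zeroE not_gr_zero)
    then show False using g by auto
  qed
  have "ieval g (x ^ p) = 0"
  proof (rule ccontr)
    assume *: "ieval g (x ^ p) \<noteq> 0"
    have "(x ^ p) ^ n = 1" using assms(2) by (simp add: power_mult[symmetric] mult.commute[of p] power_mult)
    then have "ieval (g * h) (x ^ p) = 0" unfolding h[symmetric] by simp
    then have hp: "ieval h (x ^ p) = 0" using * by simp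
    obtain u where u: "h ^ p = pcompose h (monom 1 p) + smult (int p) u"
      using frobenius_poly[OF assms(3)] .
    have hx: "ieval h x ^ p = of_nat p * ieval u x"
      using arg_cong[OF u, of "\<lambda>f. ieval f x"] hp by simp
    have "pderiv (monom 1 n - 1 :: int poly) = monom (int n) (n - 1)"
      by (simp add: pderiv_diff pderiv_monom)
    then have "monom (int n) (n - 1) = g * pderiv h + h * pderiv g"
      unfolding h by (simp add: pderiv_mult)
    from arg_cong[OF this, of "\<lambda>f. ieval f x"] g(1)
    have "of_nat n * x ^ (n - 1) = ieval h x * ieval (pderiv g) x" by simp
    then have "of_nat n * x ^ (n - 1) * x = ieval h x * (ieval (pderiv g) x * x)" by simp
    then have "of_nat n = ieval h x * (ieval (pderiv g) x * x)"
      using assms(1,2) by (simp add: mult.assoc flip: power_Suc2)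
    then have "of_nat n ^ p = of_nat p * (ieval u x * (ieval (pderiv g) x * x) ^ p)"
      by (simp add: power_mult_distrib hx)
    \<comment> \<open>Divisibility by \<open>p\<close> is invisible among complex numbers, so the
      equation is turned back into an integer polynomial vanishing at \<open>x\<close>, hence
      divisible by \<open>g\<close>.\<close>
    then have "ieval (smult (int p) (u * (pderiv g * [:0,1:]) ^ p) - [:int n ^ p:]) x = 0"
      by (simp add: mult.commute[of x])
    then obtain s where "smult (int p) (u * (pderiv g * [:0,1:]) ^ p) - [:int n ^ p:] = g * s"
      using g(3) by (blast elim: dvdE)
    then have "g * s = smult (int p) (u * (pderiv g * [:0,1:]) ^ p) - [:int n ^ p:]" by (rule sym)
    then have "int p dvd int n ^ p"
      using const_dvd_if_dvd_monic_mult[OF deg lead, of "int p"] assms(3) prime_nat_int_transfer by blast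
    then show False using assms(3,4) by (metis int_dvd_int_iff of_nat_power prime_dvd_power)
  qed
  moreover obtain s where "f = g * s" using g(3)[OF assms(5)] by (auto elim: dvdE)
  ultimately show ?thesis by simp
qed

text \<open>No prime factor of \<open>k\<close> divides \<open>n\<close>, so the prime case can be
  applied once for each factor. The point \<open>x\<close> varies in the induction because each step
  starts from the root of unity reached before.\<close>

lemma ieval_root_unity_power:
  assumes "n > 0" "x ^ n = 1" "coprime k n" "ieval f x = 0"
  shows "ieval f (x ^ k) = 0"
  using assms(2-4)
proof (induction k arbitrary: x rule: less_induct)
  case (less k)
  consider "k = 0" | "k = 1" | "k > 1" by linarith
  then show ?case
  proof cases
    case 1
    then have "n = 1" using less.prems by simp
    then show ?thesis using less.prems 1 by simp
  next
    case 2
    then show ?thesis using less.prems by simp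
  next
    case 3
    then obtain p where p: "prime p" "p dvd k" using prime_factor_nat[of k] by auto
    then obtain l where l: "k = p * l" by (auto elim: dvdE)
    have "l > 0" using l 3 by (cases l) auto
    then have "l < k" using l prime_gt_1_nat[OF p(1)] by simp
    have c: "coprime p n" "coprime l n" using less.prems l by auto
    then have "\<not> p dvd n" using p(1) using coprime_common_divisor[of p n p] by auto
    then have "ieval f (x ^ p) = 0"
      using ieval_root_unity_power_prime assms(1) less.prems p(1) by blast
    moreover have "(x ^ p) ^ n = 1" using less.prems by (simp add: power_mult[symmetric] mult.commute[of p] power_mult)
    ultimately have "ieval f ((x ^ p) ^ l) = 0" using less.IH[OF \<open>l < k\<close>] c by blast
    then show ?thesis by (simp add: l power_mult)
  qed
qed

text \<open>This is the Galois action, expressed through integer polynomials. All \<open>w i\<close>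
  are powers of one primitive root \<open>z\<close>, so the relation says that an integer polynomial
  vanishes at \<open>z ^ m\<close>; raising to the inverse \<open>k\<close> of \<open>m\<close>
  modulo \<open>n\<close> leads back to \<open>z\<close>.\<close>

lemma roots_unity_relation_transfer:
  fixes c :: "'i \<Rightarrow> int" and w :: "'i \<Rightarrow> complex"
  assumes "n > 0" "coprime m n" "finite I" "\<And>i. i \<in> I \<Longrightarrow> w i ^ n = 1"
    and "(\<Sum>i\<in>I. of_int (c i) * w i ^ m) = 0"
  shows "(\<Sum>i\<in>I. of_int (c i) * w i) = 0"
proof -
  define z where "z = cis (2 * pi / n)"
  have zn: "z ^ n = 1" using assms(1) by (simp add: z_def Complex.DeMoivre)
  have "\<exists>e. w i = z ^ e" if "i \<in> I" for i
  proof -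
    have "w i \<in> (\<lambda>k. cis (2 * pi * real k / real n)) ` {..<n}"
      using Complex.bij_betw_roots_unity[OF assms(1)] assms(4)[OF that] by (auto simp: bij_betw_def)
    then show ?thesis by (auto simp: z_def Complex.DeMoivre mult_ac)
  qed
  then obtain e where e: "\<And>i. i \<in> I \<Longrightarrow> w i = z ^ e i" by metis
  define f :: "int poly" where "f = (\<Sum>i\<in>I. monom (c i) (e i))"
  have fz: "ieval f y = (\<Sum>i\<in>I. of_int (c i) * y ^ e i)" for y
    by (simp add: f_def)
  have "ieval f (z ^ m) = (\<Sum>i\<in>I. of_int (c i) * w i ^ m)" unfolding fz
    by (intro sum.cong) (simp_all add: e mult.commute flip: power_mult)
  then have "ieval f (z ^ m) = 0" using assms(5) by simp
  moreover obtain k where k: "[m * k = 1] (mod n)" using cong_solve_coprime_nat[OF assms(2)] by auto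
  moreover have "coprime k n"
    using k coprime_iff_invertible_nat[of k n] by (auto simp: mult.commute)
  moreover have "(z ^ m) ^ n = 1" using zn by (simp add: power_mult[symmetric] mult.commute[of m] power_mult)
  ultimately have "ieval f ((z ^ m) ^ k) = 0" using ieval_root_unity_power assms(1) by blast
  moreover have "z ^ (m * k) = z"
  proof -
    have z: "z ^ j = z ^ (j mod n)" for j
    proof -
      have "z ^ j = z ^ (n * (j div n) + j mod n)" by simp
      also have "\<dots> = z ^ (j mod n)" unfolding power_add power_mult zn by simp
      finally show ?thesis .
    qed
    have "z ^ (m * k) = z ^ 1" using k z[of "m * k"] z[of 1] by (simp add: cong_def)
    then show ?thesis by simp
  qed
  ultimately have "ieval f z = 0" by (simp add: power_mult)
  then show ?thesis using e unfolding fz by simp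
qed

section \<open>Curves with interlaced directions at infinity\<close>

lemma winding_number_0_connected_unbounded:
  assumes "path \<gamma>" "pathfinish \<gamma> = pathstart \<gamma>" "connected S" "z \<in> S" "\<not> bounded S"
    and "S \<inter> path_image \<gamma> = {}"
  shows "winding_number \<gamma> z = 0"
proof -
  obtain B where B: "\<And>w. B \<le> norm w \<Longrightarrow> winding_number \<gamma> w = 0"
    using winding_number_zero_at_infinity[OF assms(1,2)] by blast
  obtain w where "w \<in> S" "B \<le> norm w" using assms(5) unfolding bounded_iff by (meson linear)
  then show ?thesis
    using B winding_number_eq[OF assms(1,2) assms(4) _ assms(3,6)] by metis
qed

lemma exp_in_sector:
  assumes "sgn z = cis \<phi>" "z \<noteq> 0"
  shows "exp (Complex (ln (norm z)) \<phi>) = z"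
proof -
  have "exp (Complex (ln (norm z)) \<phi>) = of_real (norm z) * sgn z"
    using assms by (simp add: exp_eq_polar)
  then show ?thesis by (simp add: sgn_eq)
qed

text \<open>The logarithm is pinned near the given real \<open>\<alpha>\<close>, not merely modulo
  \<open>2 * pi\<close>, so that comparing directions becomes comparing imaginary parts. Dividing by
  \<open>cis \<alpha>\<close> first keeps \<open>Ln\<close> away from its cut.\<close>

lemma eventually_sgn_near_cis:
  fixes f :: "real \<Rightarrow> complex"
  assumes "((\<lambda>s. sgn (f s)) \<longlongrightarrow> cis \<alpha>) at_top" "\<delta> > 0"
  shows "\<forall>\<^sub>F s in at_top. \<exists>l. exp l = f s \<and> \<bar>Im l - \<alpha>\<bar> < \<delta>"
proof -
  have "((\<lambda>s. sgn (f s) / cis \<alpha>) \<longlongrightarrow> cis \<alpha> / cis \<alpha>) at_top"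
    by (intro tendsto_intros assms) auto
  then have lim: "((\<lambda>s. sgn (f s) / cis \<alpha>) \<longlongrightarrow> 1) at_top" by simp
  have "((\<lambda>s. Im (Ln (sgn (f s) / cis \<alpha>))) \<longlongrightarrow> Im (Ln 1)) at_top"
    by (intro tendsto_Im tendsto_Ln lim) auto
  then have "\<forall>\<^sub>F s in at_top. \<bar>Im (Ln (sgn (f s) / cis \<alpha>))\<bar> < \<delta>"
    using assms(2) unfolding tendsto_iff by (simp add: dist_norm)
  moreover have "\<forall>\<^sub>F s in at_top. sgn (f s) \<noteq> 0"
    using assms(1) tendsto_imp_eventually_ne by (metis cis_neq_zero)
  ultimately show ?thesis
  proof eventually_elim
    case (elim s)
    define \<theta> where "\<theta> = Im (Ln (sgn (f s) / cis \<alpha>))"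
    have nz: "f s \<noteq> 0" using elim by auto
    have "norm (sgn (f s) / cis \<alpha>) = 1" using nz by (simp add: norm_divide norm_sgn)
    then have "Re (Ln (sgn (f s) / cis \<alpha>)) = 0" using nz by (subst Re_Ln) auto
    then have "Ln (sgn (f s) / cis \<alpha>) = \<i> * \<theta>" by (simp add: complex_eq_iff \<theta>_def)
    then have "sgn (f s) / cis \<alpha> = exp (\<i> * \<theta>)" using nz by (metis cis_neq_zero divide_eq_0_iff exp_Ln sgn_zero_iff)
    then have "sgn (f s) = cis (\<alpha> + \<theta>)" by (simp add: field_simps cis_conv_exp exp_add ring_distribs)
    then have "exp (Complex (ln (norm (f s))) (\<alpha> + \<theta>)) = f s" using exp_in_sector nz by blast
    then show ?case using elim(1) by (intro exI[of _ "Complex (ln (norm (f s))) (\<alpha> + \<theta>)"]) (simp add: \<theta>_def)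
  qed
qed

lemma exp_eq_imp_Im:
  assumes "exp x = exp (y :: complex)"
  obtains k :: int where "Im x = Im y + 2 * pi * k"
  using assms unfolding exp_eq by (auto simp: mult_ac)

lemma exp_Im_gap:
  assumes "exp x = exp (y :: complex)" "Im x < Im y" "Im y < Im x + 2 * pi"
  shows False
proof -
  obtain k :: int where k: "Im x = Im y + 2 * pi * k" using exp_eq_imp_Im[OF assms(1)] .
  have "2 * pi * k < 2 * pi * 0" "2 * pi * (-1) < 2 * pi * k" using assms(2,3) k by auto
  then have "real_of_int k < 0" "real_of_int k > -1"
    using mult_less_cancel_left_pos[of "2 * pi" "real_of_int k" 0]
      mult_less_cancel_left_pos[of "2 * pi" "-1" "real_of_int k"] by auto
  then have "k < 0" "k > -1" by (simp, metis of_int_less_iff of_int_minus of_int_1)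
  then show False by linarith
qed

text \<open>Close the curve formed by \<open>f1\<close> and \<open>f2\<close> by a large arc in each of the two possible ways. One of
  the two loops avoids \<open>g1\<close>, the other avoids \<open>g2\<close>, so both have winding number zero around \<open>g1 0\<close>; but they
  differ by a full circle.\<close>

lemma no_interlaced_curves:
  fixes f1 f2 g1 g2 :: "real \<Rightarrow> complex"
  assumes cont: "continuous_on {0..} f1" "continuous_on {0..} f2" "continuous_on {0..} g1" "continuous_on {0..} g2"
    and start: "f1 0 = f2 0" "g1 0 = g2 0"
    and inf: "filterlim f1 at_infinity at_top" "filterlim f2 at_infinity at_top"
      "filterlim g1 at_infinity at_top" "filterlim g2 at_infinity at_top"
    and dir: "((\<lambda>s. sgn (f1 s)) \<longlongrightarrow> cis \<alpha>1) at_top" "((\<lambda>s. sgn (f2 s)) \<longlongrightarrow> cis \<alpha>2) at_top"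
      "((\<lambda>s. sgn (g1 s)) \<longlongrightarrow> cis \<beta>1) at_top" "((\<lambda>s. sgn (g2 s)) \<longlongrightarrow> cis \<beta>2) at_top"
    and ord: "\<beta>1 < \<alpha>1" "\<alpha>1 < \<beta>2" "\<beta>2 < \<alpha>2" "\<alpha>2 < \<beta>1 + 2 * pi"
    and disj: "(f1 ` {0..} \<union> f2 ` {0..}) \<inter> (g1 ` {0..} \<union> g2 ` {0..}) = {}"
  shows False
proof -
  \<comment> \<open>Half the smallest gap, so that the four sectors of half-width
    \<open>\<delta>\<close> are disjoint.\<close>
  define \<delta> where "\<delta> = Min {\<alpha>1 - \<beta>1, \<beta>2 - \<alpha>1, \<alpha>2 - \<beta>2, \<beta>1 + 2 * pi - \<alpha>2} / 2"
  have \<delta>: "\<delta> > 0" "\<beta>1 + 2 * \<delta> \<le> \<alpha>1" "\<alpha>1 + 2 * \<delta> \<le> \<beta>2" "\<beta>2 + 2 * \<delta> \<le> \<alpha>2" "\<alpha>2 + 2 * \<delta> \<le> \<beta>1 + 2 * pi"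
    using ord by (auto simp: \<delta>_def)
  have "\<forall>\<^sub>F s in at_top. s > 0 \<and> (\<exists>l. exp l = f1 s \<and> \<bar>Im l - \<alpha>1\<bar> < \<delta>) \<and> (\<exists>l. exp l = f2 s \<and> \<bar>Im l - \<alpha>2\<bar> < \<delta>)
      \<and> (\<exists>l. exp l = g1 s \<and> \<bar>Im l - \<beta>1\<bar> < \<delta>) \<and> (\<exists>l. exp l = g2 s \<and> \<bar>Im l - \<beta>2\<bar> < \<delta>)"
    using dir \<delta>(1) by (intro eventually_conj eventually_sgn_near_cis eventually_gt_at_top)
  then obtain S where S: "\<And>s. s \<ge> S \<Longrightarrow> s > 0 \<and> (\<exists>l. exp l = f1 s \<and> \<bar>Im l - \<alpha>1\<bar> < \<delta>) \<and> (\<exists>l. exp l = f2 s \<and> \<bar>Im l - \<alpha>2\<bar> < \<delta>)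
      \<and> (\<exists>l. exp l = g1 s \<and> \<bar>Im l - \<beta>1\<bar> < \<delta>) \<and> (\<exists>l. exp l = g2 s \<and> \<bar>Im l - \<beta>2\<bar> < \<delta>)"
    unfolding eventually_at_top_linorder by blast
  have S0: "S > 0" using S by blast
  \<comment> \<open>Up to time \<open>S\<close> the curves \<open>g1\<close> and \<open>g2\<close>
    may be anywhere. Since \<open>\<rho>\<close> bounds these pieces, arcs outside the disc of
    radius \<open>\<rho>\<close> can only meet the parts already confined to their sectors.\<close>
  have "compact (g1 ` {0..S} \<union> g2 ` {0..S})"
    by (intro compact_Un compact_continuous_image continuous_on_subset[OF cont(3)] continuous_on_subset[OF cont(4)]) auto
  then obtain \<rho> where \<rho>: "\<rho> > 0" "\<And>w. w \<in> g1 ` {0..S} \<union> g2 ` {0..S} \<Longrightarrow> norm w \<le> \<rho>"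
    using compact_imp_bounded bounded_pos by metis
  have "\<forall>\<^sub>F s in at_top. norm (f s) > \<rho>" if "filterlim f at_infinity at_top" for f :: "real \<Rightarrow> complex"
    using filterlim_at_infinity_imp_norm_at_top[OF that] by (simp add: filterlim_at_top_dense)
  then have "\<forall>\<^sub>F s in at_top. s \<ge> S \<and> norm (f1 s) > \<rho> \<and> norm (f2 s) > \<rho>"
    using inf by (intro eventually_conj eventually_ge_at_top)
  then obtain T where T: "T \<ge> S" "norm (f1 T) > \<rho>" "norm (f2 T) > \<rho>"
    unfolding eventually_at_top_linorder by blast
  obtain l1 where l1: "exp l1 = f1 T" "\<bar>Im l1 - \<alpha>1\<bar> < \<delta>" using S[OF T(1)] by blast
  obtain l2 where l2: "exp l2 = f2 T" "\<bar>Im l2 - \<alpha>2\<bar> < \<delta>" using S[OF T(1)] by blast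
  have re: "Re l1 > ln \<rho>" "Re l2 > ln \<rho>"
    using T(2,3) \<rho>(1) unfolding l1(1)[symmetric] l2(1)[symmetric] norm_exp_eq_Re
    by (metis exp_ln exp_less_cancel_iff)+
  \<comment> \<open>The same point one turn further: the second arc continues the first in the
    logarithmic plane, and together they close up to a full circle.\<close>
  define l1' where "l1' = l1 + 2 * of_real pi * \<i>"
  have l1': "exp l1' = f1 T" "Re l1' = Re l1" "Im l1' = Im l1 + 2 * pi"
    using l1 by (auto simp: l1'_def exp_add)
  define arc1 where "arc1 = exp \<circ> linepath l1 l2"
  define arc2 where "arc2 = exp \<circ> linepath l2 l1'"
  define c where "c = (f1 \<circ> linepath T 0) +++ (f2 \<circ> linepath 0 T)"
  have T0: "T > 0" using T(1) S0 by simp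
  have seg: "closed_segment 0 T \<subseteq> {0..}" "closed_segment T 0 \<subseteq> {0..}"
    using T0 by (auto simp: closed_segment_eq_real_ivl)
  have pf: "path (f1 \<circ> linepath T 0)" "path (f2 \<circ> linepath 0 T)"
    by (intro path_continuous_image continuous_on_subset[OF cont(1)] continuous_on_subset[OF cont(2)]; simp add: seg)+
  have parc: "path arc1" "path arc2" unfolding arc1_def arc2_def
    by (intro path_continuous_image continuous_intros; simp)+
  have ends: "pathstart arc1 = f1 T" "pathfinish arc1 = f2 T" "pathstart arc2 = f2 T" "pathfinish arc2 = f1 T"
    by (simp_all add: arc1_def arc2_def pathstart_compose pathfinish_compose l1 l2 l1')
  have pc: "path c" "pathstart c = f1 T" "pathfinish c = f2 T"
    unfolding c_def using pf start by (simp_all add: pathstart_compose pathfinish_compose)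
  have imc: "path_image c \<subseteq> f1 ` {0..} \<union> f2 ` {0..}"
  proof -
    have "path_image c \<subseteq> path_image (f1 \<circ> linepath T 0) \<union> path_image (f2 \<circ> linepath 0 T)"
      unfolding c_def by (rule path_image_join_subset)
    also have "\<dots> \<subseteq> f1 ` {0..} \<union> f2 ` {0..}"
      unfolding path_image_compose path_image_linepath using seg by blast
    finally show ?thesis .
  qed
  have arc1D: "\<exists>x. w = exp x \<and> Re x > ln \<rho> \<and> Im x > \<alpha>1 - \<delta> \<and> Im x < \<alpha>2 + \<delta>" if "w \<in> path_image arc1" for w
  proof -
    have "convex {x. Re x > ln \<rho> \<and> Im x > \<alpha>1 - \<delta> \<and> Im x < \<alpha>2 + \<delta>}"
      unfolding Collect_conj_eq
      by (intro convex_Int convex_halfspace_Re_gt convex_halfspace_Im_gt convex_halfspace_Im_lt)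
    then have "closed_segment l1 l2 \<subseteq> {x. Re x > ln \<rho> \<and> Im x > \<alpha>1 - \<delta> \<and> Im x < \<alpha>2 + \<delta>}"
      using re l1(2) l2(2) ord \<delta>(1) by (intro closed_segment_subset) auto
    then show ?thesis using that unfolding arc1_def path_image_compose path_image_linepath by blast
  qed
  have arc2D: "\<exists>x. w = exp x \<and> Re x > ln \<rho> \<and> Im x > \<alpha>2 - \<delta> \<and> Im x < \<alpha>1 + 2 * pi + \<delta>" if "w \<in> path_image arc2" for w
  proof -
    have "convex {x. Re x > ln \<rho> \<and> Im x > \<alpha>2 - \<delta> \<and> Im x < \<alpha>1 + 2 * pi + \<delta>}"
      unfolding Collect_conj_eq
      by (intro convex_Int convex_halfspace_Re_gt convex_halfspace_Im_gt convex_halfspace_Im_lt)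
    then have "closed_segment l2 l1' \<subseteq> {x. Re x > ln \<rho> \<and> Im x > \<alpha>2 - \<delta> \<and> Im x < \<alpha>1 + 2 * pi + \<delta>}"
      using re l1(2) l1' l2(2) ord \<delta>(1) by (intro closed_segment_subset) auto
    then show ?thesis using that unfolding arc2_def path_image_compose path_image_linepath by blast
  qed
  have large: "s > S" if "s \<ge> 0" "g1 s = exp x \<or> g2 s = exp x" "Re x > ln \<rho>" for s x
  proof (rule ccontr)
    assume "\<not> s > S"
    then have "exp x \<in> g1 ` {0..S} \<union> g2 ` {0..S}" using that(1,2)
      by (metis UnI1 UnI2 atLeastAtMost_iff imageI linorder_not_less)
    then have "norm (exp x) \<le> \<rho>" by (rule \<rho>(2))
    then show False using that(3) \<rho>(1) by (metis exp_ln exp_less_cancel_iff norm_exp_eq_Re not_less)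
  qed
  \<comment> \<open>In the logarithmic plane the first arc passes the direction
    \<open>\<beta>2\<close> but stays strictly between \<open>\<beta>1\<close> and
    \<open>\<beta>1 + 2 * pi\<close>. The second passes \<open>\<beta>1 + 2 * pi\<close> but stays
    strictly between \<open>\<beta>2\<close> and \<open>\<beta>2 + 2 * pi\<close>.\<close>
  have d1: "g1 ` {0..} \<inter> path_image arc1 = {}"
  proof safe
    fix s :: real assume s: "s \<ge> 0" "g1 s \<in> path_image arc1"
    then obtain x where x: "g1 s = exp x" "Re x > ln \<rho>" "Im x > \<alpha>1 - \<delta>" "Im x < \<alpha>2 + \<delta>" using arc1D by blast
    then have "s \<ge> S" using large s(1) by (meson less_imp_le)
    then obtain y where y: "exp y = g1 s" "\<bar>Im y - \<beta>1\<bar> < \<delta>" using S by blast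
    have "Im y < Im x" "Im x < Im y + 2 * pi"
      using x(3,4) y(2) \<delta> unfolding abs_less_iff by linarith+
    then show "g1 s \<in> {}" using exp_Im_gap[of y x] x(1) y(1) by auto
  qed
  have d2: "g2 ` {0..} \<inter> path_image arc2 = {}"
  proof safe
    fix s :: real assume s: "s \<ge> 0" "g2 s \<in> path_image arc2"
    then obtain x where x: "g2 s = exp x" "Re x > ln \<rho>" "Im x > \<alpha>2 - \<delta>" "Im x < \<alpha>1 + 2 * pi + \<delta>" using arc2D by blast
    then have "s \<ge> S" using large s(1) by (meson less_imp_le)
    then obtain y where y: "exp y = g2 s" "\<bar>Im y - \<beta>2\<bar> < \<delta>" using S by blast
    have "Im y < Im x" "Im x < Im y + 2 * pi"
      using x(3,4) y(2) \<delta> unfolding abs_less_iff by linarith+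
    then show "g2 s \<in> {}" using exp_Im_gap[of y x] x(1) y(1) by auto
  qed
  define b where "b = g1 0"
  have bg: "b \<in> g1 ` {0..}" "b \<in> g2 ` {0..}" using start(2) by (force simp: b_def)+
  have unb: "\<not> bounded (g ` {0..})" if "filterlim g at_infinity at_top" for g :: "real \<Rightarrow> complex"
  proof
    assume "bounded (g ` {0..})"
    then obtain B where B: "\<And>s. s \<ge> 0 \<Longrightarrow> norm (g s) \<le> B" by (auto simp: bounded_iff)
    have "\<forall>\<^sub>F s in at_top. s \<ge> 0 \<and> norm (g s) > B"
      using filterlim_at_infinity_imp_norm_at_top[OF that]
      by (intro eventually_conj eventually_ge_at_top) (auto simp: filterlim_at_top_dense)
    then obtain s where "s \<ge> 0" "norm (g s) > B" unfolding eventually_at_top_linorder by blast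
    then show False using B[of s] by simp
  qed
  have conn: "connected (g1 ` {0..})" "connected (g2 ` {0..})"
    using cont by (auto intro: connected_continuous_image)
  have nb: "b \<notin> path_image c" using bg imc disj by blast
  have na: "b \<notin> path_image arc1" "b \<notin> path_image arc2" using bg d1 d2 by blast+
  have "winding_number (c +++ reversepath arc1) b = 0"
  proof (rule winding_number_0_connected_unbounded)
    show "g1 ` {0..} \<inter> path_image (c +++ reversepath arc1) = {}"
      using d1 imc disj path_image_join_subset[of c "reversepath arc1"] by auto blast+
  qed (use pc parc ends bg conn unb inf in auto)
  then have w1: "winding_number c b - winding_number arc1 b = 0"
    using pc parc ends nb na by (simp add: winding_number_join winding_number_reversepath)
  have "winding_number (c +++ arc2) b = 0"
  proof (rule winding_number_0_connected_unbounded)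
    show "g2 ` {0..} \<inter> path_image (c +++ arc2) = {}"
      using d2 imc disj path_image_join_subset[of c "arc2"] by auto blast+
  qed (use pc parc ends bg conn unb inf in auto)
  then have w2: "winding_number c b + winding_number arc2 b = 0"
    using pc parc ends nb na by (simp add: winding_number_join)
  have w3: "winding_number (arc1 +++ arc2) b = 0"
    using w1 w2 pc parc ends nb na by (simp add: winding_number_join)
  \<comment> \<open>Both \<open>b\<close> and the origin lie in the disc of radius
    \<open>\<rho>\<close>, which the arcs miss. Around the origin, the winding number of
    \<open>exp\<close> of a path is the increment of the path divided by
    \<open>2 * pi * i\<close>.\<close>
  have "winding_number (arc1 +++ arc2) b = winding_number (arc1 +++ arc2) 0"
  proof (rule winding_number_eq[where S = "cball 0 \<rho>"])
    have "norm w > \<rho>" if w: "w \<in> path_image arc1 \<union> path_image arc2" for w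
    proof -
      have "\<exists>x. w = exp x \<and> Re x > ln \<rho>" using arc1D arc2D w by blast
      then show ?thesis using \<rho>(1) by (metis exp_ln exp_less_cancel_iff norm_exp_eq_Re)
    qed
    then show "cball 0 \<rho> \<inter> path_image (arc1 +++ arc2) = {}"
      using path_image_join_subset[of arc1 arc2] by fastforce
    show "b \<in> cball 0 \<rho>" using \<rho>(2) S0 by (auto simp: b_def)
  qed (use parc ends \<rho>(1) in auto)
  moreover have "winding_number (arc1 +++ arc2) 0 = 1"
  proof -
    have "arc1 +++ arc2 = exp \<circ> (linepath l1 l2 +++ linepath l2 l1')"
      unfolding arc1_def arc2_def by (simp add: path_compose_join)
    then show ?thesis by (simp only:) (subst winding_number_compose_exp, simp_all add: l1'_def)
  qed
  ultimately show False using w3 by simp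
qed

section \<open>Averages of points on the unit circle\<close>

lemma cos_less_of_outside:
  assumes "0 \<le> h" "h < \<bar>x\<bar>" "\<bar>x\<bar> < 2 * pi - h"
  shows "cos x < cos h"
proof -
  have hpi: "h < pi" using assms by linarith
  consider "\<bar>x\<bar> \<le> pi" | "\<bar>x\<bar> > pi" by linarith
  then show ?thesis
  proof cases
    case 1
    then have "cos \<bar>x\<bar> < cos h" using assms by (intro cos_monotone_0_pi) auto
    then show ?thesis by simp
  next
    case 2
    then have "cos (2 * pi - \<bar>x\<bar>) < cos h" using assms by (intro cos_monotone_0_pi) auto
    then show ?thesis by (simp add: cos_diff)
  qed
qed

text \<open>Otherwise \<open>B\<close> lies on one side of the chord between the extreme points of \<open>A\<close>, as seen from a point of \<open>B\<close>.\<close>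

lemma circle_sums_interlace:
  fixes u :: "'i \<Rightarrow> complex" and w :: "'j \<Rightarrow> complex"
  assumes fin: "finite A" "A \<noteq> {}" "finite B" "B \<noteq> {}"
    and unit: "\<And>i. i \<in> A \<Longrightarrow> norm (u i) = 1" "\<And>j. j \<in> B \<Longrightarrow> norm (w j) = 1"
    and disj: "u ` A \<inter> w ` B = {}"
    and eq: "(\<Sum>i\<in>A. u i) / card A = (\<Sum>j\<in>B. w j) / card B"
  obtains i1 i2 j1 j2 \<alpha>1 \<alpha>2 \<beta>1 \<beta>2 where "i1 \<in> A" "i2 \<in> A" "j1 \<in> B" "j2 \<in> B"
    "u i1 = cis \<alpha>1" "u i2 = cis \<alpha>2" "w j1 = cis \<beta>1" "w j2 = cis \<beta>2"
    "\<beta>1 < \<alpha>1" "\<alpha>1 < \<beta>2" "\<beta>2 < \<alpha>2" "\<alpha>2 < \<beta>1 + 2 * pi"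
proof -
  obtain j0 where j0: "j0 \<in> B" using fin by auto
  define \<beta>0 where "\<beta>0 = Arg (w j0)"
  \<comment> \<open>Angles are measured from \<open>w j0\<close>, a point of the second family:
    \<open>j0\<close> gets angle 0, and the circle is cut outside the range from \<open>lo\<close>
    to \<open>hi\<close>.\<close>
  define ang where "ang = (\<lambda>z. Arg2pi (z / w j0))"
  have w0: "w j0 = cis \<beta>0" using unit(2)[OF j0] by (metis \<beta>0_def cis_Arg norm_zero sgn_eq zero_neq_one div_by_1 of_real_1)
  have ang: "0 \<le> ang z" "ang z < 2 * pi" "z = cis (\<beta>0 + ang z)" if "norm z = 1" for z
  proof -
    show "0 \<le> ang z" "ang z < 2 * pi" by (auto simp: ang_def Arg2pi_ge_0 Arg2pi_lt_2pi)
    have "z / w j0 = exp (\<i> * ang z)"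
      using Arg2pi_eq[of "z / w j0"] that unit(2)[OF j0] by (simp add: ang_def norm_divide)
    then show "z = cis (\<beta>0 + ang z)" using w0
      by (simp add: cis_conv_exp exp_add ring_distribs field_simps)
  qed
  define lo where "lo = Min ((\<lambda>i. ang (u i)) ` A)"
  define hi where "hi = Max ((\<lambda>i. ang (u i)) ` A)"
  obtain i1 where i1: "i1 \<in> A" "ang (u i1) = lo"
    using Min_in[of "(\<lambda>i. ang (u i)) ` A"] fin unfolding lo_def by fastforce
  obtain i2 where i2: "i2 \<in> A" "ang (u i2) = hi"
    using Max_in[of "(\<lambda>i. ang (u i)) ` A"] fin unfolding hi_def by fastforce
  have lohi: "lo \<le> ang (u i)" "ang (u i) \<le> hi" if "i \<in> A" for i
    using that fin by (auto simp: lo_def hi_def)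
  have hi2: "hi < 2 * pi" using ang(2) i2 unit by metis
  have lo0: "0 < lo"
  proof -
    have "lo \<noteq> 0"
    proof
      assume "lo = 0"
      then have "u i1 = w j0" using ang(3)[of "u i1"] i1 unit w0 by simp
      then show False using disj i1 j0 by blast
    qed
    then show ?thesis using ang(1) i1 unit by (metis less_eq_real_def)
  qed
  \<comment> \<open>A point of \<open>B\<close> between the extreme angles of \<open>A\<close>
    interlaces together with \<open>j0\<close>; otherwise all of \<open>B\<close> lies beyond the
    chord.\<close>
  show ?thesis
  proof (cases "\<exists>j\<in>B. lo \<le> ang (w j) \<and> ang (w j) \<le> hi")
    case True
    then obtain j where j: "j \<in> B" "lo \<le> ang (w j)" "ang (w j) \<le> hi" by blast
    have "ang (w j) \<noteq> ang (u i)" if "i \<in> A" for i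
      using ang(3)[of "w j"] ang(3)[of "u i"] unit j(1) that disj by force
    then have "lo < ang (w j)" "ang (w j) < hi" using j i1 i2 by (force simp: less_le)+
    then show ?thesis
      using that[OF i1(1) i2(1) j0 j(1), of "\<beta>0 + lo" "\<beta>0 + hi" \<beta>0 "\<beta>0 + ang (w j)"]
        ang(3) unit i1 i2 j(1) w0 lo0 hi2 by (metis add.commute add_less_cancel_left less_add_same_cancel1)
  next
    case False
    \<comment> \<open>\<open>\<mu>\<close> is the middle direction of the arc spanned by
      \<open>A\<close>, and \<open>h\<close> is its half-width. The real-linear functional
      \<open>l\<close> equals \<open>cos h\<close> on the chord, is at least that on
      \<open>A\<close> and smaller on \<open>B\<close>, so it separates the averages.\<close>
    define \<mu> where "\<mu> = \<beta>0 + (lo + hi) / 2"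
    define h where "h = (hi - lo) / 2"
    define l where "l = (\<lambda>z. Re (z * cis (- \<mu>)))"
    have l: "l z = cos (ang z - (lo + hi) / 2)" if "norm z = 1" for z
    proof -
      have "z * cis (- \<mu>) = cis (ang z - (lo + hi) / 2)"
        by (subst ang(3)[OF that]) (simp add: \<mu>_def cis_mult)
      then show ?thesis unfolding l_def by (simp only: cis.sel)
    qed
    have ldiv: "l (z / of_nat k) = l z / of_nat k" for z k
      by (simp add: l_def add_divide_distrib)
    have h: "0 \<le> h" "h < pi" using lohi[OF i1(1)] hi2 lo0 by (auto simp: h_def)
    have A: "l (u i) \<ge> cos h" if "i \<in> A" for i
    proof -
      have "\<bar>ang (u i) - (lo + hi) / 2\<bar> \<le> h" using lohi[OF that] by (simp add: h_def abs_le_iff field_simps)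
      then have "cos \<bar>ang (u i) - (lo + hi) / 2\<bar> \<ge> cos h" using h by (intro cos_monotone_0_pi_le) auto
      then show ?thesis using l unit that by simp
    qed
    have B: "l (w j) < cos h" if "j \<in> B" for j
    proof -
      have "0 \<le> ang (w j)" "ang (w j) < 2 * pi" using ang unit that by auto
      moreover have "ang (w j) < lo \<or> ang (w j) > hi" using False that by fastforce
      ultimately have "h < \<bar>ang (w j) - (lo + hi) / 2\<bar>" "\<bar>ang (w j) - (lo + hi) / 2\<bar> < 2 * pi - h"
        using lo0 hi2 by (auto simp: h_def abs_real_def field_simps)
      then have "cos (ang (w j) - (lo + hi) / 2) < cos h" using h by (intro cos_less_of_outside) auto
      then show ?thesis using l unit that by simp
    qed
    have "(\<Sum>i\<in>A. l (u i)) \<ge> of_nat (card A) * cos h"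
      using A by (intro sum_bounded_below) auto
    moreover have "(\<Sum>j\<in>B. l (w j)) < of_nat (card B) * cos h"
      using B fin by (metis sum_bounded_above_strict card_gt_0_iff)
    moreover have "l ((\<Sum>i\<in>A. u i) / card A) = (\<Sum>i\<in>A. l (u i)) / card A"
      by (simp only: ldiv) (simp add: l_def sum_distrib_right sum.distrib)
    moreover have "l ((\<Sum>j\<in>B. w j) / card B) = (\<Sum>j\<in>B. l (w j)) / card B"
      by (simp only: ldiv) (simp add: l_def sum_distrib_right sum.distrib)
    moreover have "card A > 0" "card B > 0" using fin by (auto simp: card_gt_0_iff)
    moreover have "cos h \<le> x / c" if "of_nat c * cos h \<le> x" "c > 0" for x and c :: nat
      using that by (simp add: pos_le_divide_eq mult.commute)
    moreover have "x / c < cos h" if "x < of_nat c * cos h" "c > 0" for x and c :: nat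
      using that by (simp add: pos_divide_less_eq mult.commute)
    ultimately have "cos h \<le> l ((\<Sum>i\<in>A. u i) / card A)" "l ((\<Sum>j\<in>B. w j) / card B) < cos h"
      by simp_all
    then show ?thesis using eq by simp
  qed
qed

section \<open>Branches of the inverse of a polynomial\<close>

lemma card_poly_fiber:
  fixes P :: "complex poly"
  assumes "degree P > 0" "\<And>z. poly P z = t \<Longrightarrow> poly (pderiv P) z \<noteq> 0"
  shows "finite {z. poly P z = t}" "card {z. poly P z = t} = degree P"
proof -
  define p where "p = P - [:t:]"
  have deg: "degree p = degree P"
    using assms(1) unfolding p_def by (simp add: degree_add_eq_left flip: add_uminus_conv_diff)
  then have p0: "p \<noteq> 0" using assms(1) by auto
  have eq: "{z. poly P z = t} = {z. poly p z = 0}" by (simp add: p_def)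
  show fin: "finite {z. poly P z = t}" unfolding eq using p0 by (rule poly_roots_finite)
  have "rsquarefree p"
    unfolding rsquarefree_roots using assms(2) by (auto simp: p_def pderiv_diff)
  from complex_poly_decompose_rsquarefree[OF this]
  have "degree p = degree (smult (lead_coeff p) (\<Prod>z|poly p z = 0. [:-z, 1:]))" by simp
  also have "\<dots> = degree (\<Prod>z|poly p z = 0. [:-z, 1:])" using p0 by simp
  also have "\<dots> = card {z. poly p z = 0}" by (subst degree_prod_eq_sum_degree) auto
  finally show "card {z. poly P z = t} = degree P" using deg eq by simp
qed

lemma poly_eq_prod_roots:
  fixes P :: "complex poly"
  assumes "degree P = n" "n > 0" "inj_on z {..<n}" "\<And>i. i < n \<Longrightarrow> poly P (z i) = t"
  shows "poly P x - t = lead_coeff P * (\<Prod>i<n. x - z i)"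
proof -
  define p where "p = P - [:t:]"
  define r where "r = p - smult (lead_coeff P) (\<Prod>i<n. [:- z i, 1:])"
  have deg: "degree p = n" "coeff p n = lead_coeff P"
    using assms(1,2) unfolding p_def by (auto simp: degree_add_eq_left coeff_eq_0 coeff_pCons split: nat.split simp flip: add_uminus_conv_diff)
  have dprod: "degree (\<Prod>i<n. [:- z i, 1:]) = n" by (subst degree_prod_eq_sum_degree) auto
  have "lead_coeff (\<Prod>i<n. [:- z i, 1:]) = 1" by (simp add: lead_coeff_prod)
  then have "coeff r n = 0" using deg dprod by (simp add: r_def)
  moreover have "degree r \<le> n" unfolding r_def using deg dprod by (intro degree_diff_le) (auto intro: order_trans[OF degree_smult_le])
  ultimately have rdeg: "degree r < n \<or> r = 0" by (metis le_neq_implies_less leading_coeff_0_iff)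
  have "r = 0"
  proof (rule ccontr)
    assume r: "r \<noteq> 0"
    have "z ` {..<n} \<subseteq> {x. poly r x = 0}"
      using assms(4) by (auto simp: r_def p_def poly_prod prod_zero_iff)
    then have "card (z ` {..<n}) \<le> card {x. poly r x = 0}"
      using r by (intro card_mono poly_roots_finite)
    also have "\<dots> \<le> degree r" using r by (rule card_poly_roots_bound)
    finally show False using rdeg r assms(3) by (simp add: card_image)
  qed
  then have "poly p x = poly (smult (lead_coeff P) (\<Prod>i<n. [:- z i, 1:])) x" by (simp add: r_def)
  then show ?thesis by (simp add: p_def poly_prod)
qed

section \<open>The covering defined by a polynomial over its regular values\<close>

definition regular_values :: "complex poly \<Rightarrow> complex set" where
  "regular_values P = - poly P ` {z. poly (pderiv P) z = 0}"

lemma regular_valuesD: "t \<in> regular_values P \<Longrightarrow> poly P z = t \<Longrightarrow> poly (pderiv P) z \<noteq> 0"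
  by (auto simp: regular_values_def)

lemma holomorphic_on_poly: "poly P holomorphic_on A"
  unfolding holomorphic_on_def field_differentiable_def
  using poly_DERIV has_field_derivative_at_within by blast

lemma poly_locally_injective:
  assumes "poly (pderiv P) z \<noteq> (0 :: complex)"
  obtains r where "r > 0" "inj_on (poly P) (ball z r)"
proof -
  have "deriv (poly P) z \<noteq> 0" using assms DERIV_imp_deriv[OF poly_DERIV] by metis
  then show ?thesis
    using has_complex_derivative_locally_injective[of "poly P" UNIV z] that holomorphic_on_poly by auto
qed

lemma open_image_poly_ball:
  assumes "inj_on (poly P) (ball z r)"
  shows "open (poly P ` ball (z :: complex) r)"
  using assms by (intro open_mapping_thm3 holomorphic_on_poly) auto

lemma finite_separated:
  fixes R :: "'a :: metric_space set"
  assumes "finite R"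
  obtains \<epsilon> where "\<epsilon> > 0" "\<And>a b. a \<in> R \<Longrightarrow> b \<in> R \<Longrightarrow> a \<noteq> b \<Longrightarrow> ball a \<epsilon> \<inter> ball b \<epsilon> = {}"
proof -
  define E where "E = (\<lambda>(a, b). dist a b / 2) ` {(a, b) \<in> R \<times> R. a \<noteq> b} \<union> {1 :: real}"
  have E: "finite E" "E \<noteq> {}" unfolding E_def using assms
    by (auto intro!: finite_imageI finite_subset[OF _ finite_cartesian_product[OF assms assms]])
  show ?thesis
  proof (rule that)
    show "Min E > 0" using E by (subst Min_gr_iff) (auto simp: E_def)
    fix a b assume ab: "a \<in> R" "b \<in> R" "a \<noteq> b"
    have "Min E \<le> dist a b / 2" using E ab by (intro Min_le) (auto simp: E_def)
    then show "ball a (Min E) \<inter> ball b (Min E) = {}" by (intro disjoint_ballI) auto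
  qed
qed

text \<open>\<open>P\<close> is injective on a small ball around each point of the fibre. Over the
  intersection \<open>T\<close> of the images, these balls already supply as many preimages as the
  degree, and a regular fibre has no more, so no sheet is missed.\<close>

lemma covering_space_poly:
  assumes n: "degree P > 0"
  shows "covering_space (poly P -` regular_values P) (poly P) (regular_values P)"
proof (rule covering_spaceI)
  show "continuous_on (poly P -` regular_values P) (poly P)" by (intro continuous_intros)
  have "\<exists>z. poly P z = t" for t
  proof -
    have "degree (P - [:t:]) = degree P"
      using n by (simp add: degree_add_eq_left flip: add_uminus_conv_diff)
    then have "\<not> constant (poly (P - [:t:]))" using n by (simp add: constant_degree)
    then show ?thesis using fundamental_theorem_of_algebra by fastforce
  qed
  then show "poly P ` (poly P -` regular_values P) = regular_values P" by (auto simp: image_iff) metis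
next
  fix x assume x: "x \<in> regular_values P"
  define Z where "Z = {z. poly P z = x}"
  have dnz: "poly (pderiv P) z \<noteq> 0" if "poly P z = x" for z
    using x that by (auto simp: regular_values_def)
  have Z: "finite Z" "card Z = degree P" using card_poly_fiber[OF n dnz] by (auto simp: Z_def)
  have "\<forall>z\<in>Z. \<exists>r>0. inj_on (poly P) (ball z r)"
    using poly_locally_injective dnz unfolding Z_def by blast
  then obtain R where R: "\<And>z. z \<in> Z \<Longrightarrow> R z > 0 \<and> inj_on (poly P) (ball z (R z))" by metis
  obtain \<epsilon> where \<epsilon>: "\<epsilon> > 0" "\<And>a b. a \<in> Z \<Longrightarrow> b \<in> Z \<Longrightarrow> a \<noteq> b \<Longrightarrow> ball a \<epsilon> \<inter> ball b \<epsilon> = {}"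
    using finite_separated[OF Z(1)] by blast
  define r where "r = Min (insert \<epsilon> (R ` Z))"
  have "r > 0" using Z(1) R \<epsilon>(1) by (simp add: r_def)
  have "r \<le> \<epsilon>" using Z(1) by (simp add: r_def)
  have rR: "r \<le> R z" if "z \<in> Z" for z using Z(1) that by (simp add: r_def Min_le_iff)
  have inj: "inj_on (poly P) (ball z r)" if "z \<in> Z" for z
    using R[OF that] rR[OF that] by (meson inj_on_subset subset_ball)
  have disj: "ball a r \<inter> ball b r = {}" if "a \<in> Z" "b \<in> Z" "a \<noteq> b" for a b
    using \<epsilon>(2)[OF that] subset_ball[OF \<open>r \<le> \<epsilon>\<close>] by blast
  define T where "T = regular_values P \<inter> (\<Inter>z\<in>Z. poly P ` ball z r)"
  define V where "V = (\<lambda>z. ball z r \<inter> poly P -` T)"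
  have oT: "openin (top_of_set (regular_values P)) T"
    unfolding T_def using Z(1) inj by (intro openin_open_Int open_INT ballI open_image_poly_ball)
  have xT: "x \<in> T" using x \<open>r > 0\<close> by (auto simp: T_def Z_def)
  have un: "\<Union> (V ` Z) = poly P -` regular_values P \<inter> poly P -` T"
  proof (intro equalityI subsetI)
    fix w assume "w \<in> \<Union> (V ` Z)"
    then show "w \<in> poly P -` regular_values P \<inter> poly P -` T" by (auto simp: V_def T_def)
  next
    fix w assume w: "w \<in> poly P -` regular_values P \<inter> poly P -` T"
    define t where "t = poly P w"
    have "\<forall>z\<in>Z. \<exists>y\<in>ball z r. poly P y = t" using w unfolding T_def t_def by fastforce
    then obtain y where y: "\<And>z. z \<in> Z \<Longrightarrow> y z \<in> ball z r \<and> poly P (y z) = t" by metis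
    have "inj_on y Z" using disj y by (intro inj_onI) (metis IntI empty_iff)
    then have "card (y ` Z) = degree P" using Z by (simp add: card_image)
    moreover have fib: "finite {z. poly P z = t}" "card {z. poly P z = t} = degree P"
      using w card_poly_fiber[OF n regular_valuesD, of t] by (auto simp: t_def)
    moreover have "y ` Z \<subseteq> {z. poly P z = t}" using y by auto
    ultimately have "y ` Z = {z. poly P z = t}" by (intro card_subset_eq) auto
    then obtain z where "z \<in> Z" "w = y z" by (auto simp: t_def)
    then show "w \<in> \<Union> (V ` Z)" using y w by (auto simp: V_def)
  qed
  have op: "openin (top_of_set (poly P -` regular_values P)) u" if u: "u \<in> V ` Z" for u
  proof -
    obtain z where z: "u = V z" using u by blast
    have "openin (top_of_set (poly P -` regular_values P)) (poly P -` regular_values P \<inter> poly P -` T)"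
      by (rule continuous_openin_preimage[OF _ _ oT]) (auto intro!: continuous_intros)
    then have "openin (top_of_set (poly P -` regular_values P)) ((poly P -` regular_values P \<inter> poly P -` T) \<inter> ball z r)"
      by (rule openin_Int_open[OF _ open_ball])
    also have "(poly P -` regular_values P \<inter> poly P -` T) \<inter> ball z r = u"
      unfolding z V_def by (auto simp: T_def)
    finally show ?thesis .
  qed
  have pw: "pairwise disjnt (V ` Z)"
  proof (rule pairwiseI)
    fix A B assume AB: "A \<in> V ` Z" "B \<in> V ` Z" "A \<noteq> B"
    then obtain a b where "a \<in> Z" "b \<in> Z" "A = V a" "B = V b" by blast
    then show "disjnt A B" using disj[of a b] AB(3) by (auto simp: disjnt_def V_def)
  qed
  have homeo: "\<exists>q. homeomorphism u T (poly P) q" if u: "u \<in> V ` Z" for u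
  proof -
    obtain z where z: "z \<in> Z" "u = V z" using u by blast
    obtain g where g: "g holomorphic_on poly P ` ball z r" "\<And>w. w \<in> ball z r \<Longrightarrow> g (poly P w) = w"
      using holomorphic_has_inverse[OF holomorphic_on_poly open_ball inj[OF z(1)]] by metis
    have sub: "T \<subseteq> poly P ` ball z r" using z(1) by (auto simp: T_def)
    have "homeomorphism u T (poly P) g"
    proof (rule homeomorphismI)
      show "continuous_on u (poly P)" by (intro continuous_intros)
      show "continuous_on T g"
        using g(1) sub holomorphic_on_imp_continuous_on continuous_on_subset by blast
      show "poly P ` u \<subseteq> T" by (auto simp: z V_def)
      show "g ` T \<subseteq> u" using sub g(2) by (fastforce simp: z V_def)
      show "\<And>w. w \<in> u \<Longrightarrow> g (poly P w) = w" using g(2) by (auto simp: z V_def)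
      show "\<And>t. t \<in> T \<Longrightarrow> poly P (g t) = t" using g(2) sub by fastforce
    qed
    then show ?thesis by blast
  qed
  show "\<exists>T. x \<in> T \<and> openin (top_of_set (regular_values P)) T \<and>
          (\<exists>v. \<Union> v = poly P -` regular_values P \<inter> poly P -` T \<and>
            (\<forall>u\<in>v. openin (top_of_set (poly P -` regular_values P)) u) \<and>
            pairwise disjnt v \<and> (\<forall>u\<in>v. \<exists>q. homeomorphism u T (poly P) q))"
    using xT oT un op pw homeo by (intro exI[of _ T] exI[of _ "V ` Z"] conjI) blast+
qed

lemma root_branch_unique:
  assumes "degree P > 0" "connected T" "continuous_on T g1" "continuous_on T g2"
    and "\<And>u. u \<in> T \<Longrightarrow> poly P (g1 u) = f u" "\<And>u. u \<in> T \<Longrightarrow> poly P (g2 u) = f u"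
    and "f ` T \<subseteq> regular_values P" "a \<in> T" "g1 a = g2 a" "u \<in> T"
  shows "g1 u = g2 u"
proof (rule covering_space_lift_unique[OF covering_space_poly[OF assms(1)], where ?g1.0 = g1 and ?g2.0 = g2 and f = "poly P \<circ> g1" and T = T and a = a])
  show "continuous_on T (poly P \<circ> g1)"
    by (intro continuous_on_compose assms continuous_intros)
qed (use assms in auto)

text \<open>Near each point, continuity of \<open>g\<close> forces it to be the composition of
  \<open>f\<close> with a holomorphic local inverse of \<open>P\<close>.\<close>

lemma holomorphic_on_root_branch:
  assumes "open W" "continuous_on W g" "f holomorphic_on W" "\<And>u. u \<in> W \<Longrightarrow> poly P (g u) = f u"
    and "f ` W \<subseteq> regular_values P"
  shows "g holomorphic_on W"
proof -
  have "g field_differentiable (at u)" if u: "u \<in> W" for u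
  proof -
    have "poly (pderiv P) (g u) \<noteq> 0"
      using assms(4)[OF u] assms(5) u by (force simp: regular_values_def)
    then obtain r where r: "r > 0" "inj_on (poly P) (ball (g u) r)" using poly_locally_injective by blast
    obtain h where h: "h holomorphic_on poly P ` ball (g u) r" "\<And>w. w \<in> ball (g u) r \<Longrightarrow> h (poly P w) = w"
      using holomorphic_has_inverse[OF holomorphic_on_poly open_ball r(2)] by metis
    define N where "N = W \<inter> g -` ball (g u) r"
    have oN: "open N" unfolding N_def
      using assms(1,2) by (metis continuous_on_open_vimage open_ball Int_commute)
    have uN: "u \<in> N" using u r by (simp add: N_def)
    have eq: "h (f w) = g w" if "w \<in> N" for w
      using that h(2)[of "g w"] assms(4)[of w] by (simp add: N_def)
    have "(h \<circ> f) holomorphic_on N"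
    proof (rule holomorphic_on_compose_gen[OF _ h(1)])
      show "f holomorphic_on N" using assms(3) by (rule holomorphic_on_subset) (auto simp: N_def)
      show "f ` N \<subseteq> poly P ` ball (g u) r"
        using assms(4) by (force simp: N_def image_iff)
    qed
    then have "g holomorphic_on N" using eq by (simp add: holomorphic_transform)
    then show ?thesis using oN uN holomorphic_on_imp_differentiable_at by blast
  qed
  then show ?thesis by (auto simp: holomorphic_on_def field_differentiable_at_within)
qed

text \<open>Lift \<open>f\<close> through the covering once from each point of a single fibre;
  unique lifting keeps the lifts distinct everywhere.\<close>

lemma root_branches_exist:
  fixes P :: "complex poly"
  assumes "degree P = n" "n > 0" "open W" "simply_connected W" "W \<noteq> {}" "f holomorphic_on W"
    and "f ` W \<subseteq> regular_values P"
  obtains z where "\<And>i. i < n \<Longrightarrow> z i holomorphic_on W" "\<And>i u. i < n \<Longrightarrow> u \<in> W \<Longrightarrow> poly P (z i u) = f u"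
    "\<And>u. u \<in> W \<Longrightarrow> inj_on (\<lambda>i. z i u) {..<n}"
proof -
  obtain u0 where u0: "u0 \<in> W" using assms(5) by blast
  have n: "degree P > 0" using assms(1,2) by simp
  have reg: "f u \<in> regular_values P" if "u \<in> W" for u using assms(7) that by blast
  have fib: "finite {z. poly P z = f u0}" "card {z. poly P z = f u0} = n"
    using card_poly_fiber[OF n regular_valuesD[OF reg[OF u0]]] assms(1) by auto
  obtain r where r: "bij_betw r {..<n} {z. poly P z = f u0}"
    using ex_bij_betw_nat_finite[OF fib(1)] fib(2) by (auto simp: atLeast0LessThan)
  have rf: "poly P (r i) = f u0" if "i < n" for i using r that by (auto simp: bij_betw_def)
  have "\<exists>g. continuous_on W g \<and> g u0 = r i \<and> (\<forall>u\<in>W. poly P (g u) = f u)" if i: "i < n" for i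
  proof (rule covering_space_lift_strong[OF covering_space_poly[OF n] _ u0 assms(4), of "r i" f])
    show "r i \<in> poly P -` regular_values P" using rf[OF i] reg[OF u0] by simp
    show "locally path_connected W" using assms(3) by (rule open_imp_locally_path_connected)
    show "continuous_on W f" using assms(6) by (rule holomorphic_on_imp_continuous_on)
    show "f \<in> W \<rightarrow> regular_values P" using reg by blast
    show "f u0 = poly P (r i)" using rf[OF i] by simp
  qed blast
  then obtain z where z: "\<And>i. i < n \<Longrightarrow> continuous_on W (z i) \<and> z i u0 = r i \<and> (\<forall>u\<in>W. poly P (z i u) = f u)"
    by metis
  show ?thesis
  proof (rule that[of z])
    show "z i holomorphic_on W" if "i < n" for i
      using z[OF that] by (intro holomorphic_on_root_branch[OF assms(3) _ assms(6) _ assms(7)]) auto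
    show "poly P (z i u) = f u" if "i < n" "u \<in> W" for i u using z that by blast
    show "inj_on (\<lambda>i. z i u) {..<n}" if u: "u \<in> W" for u
    proof (rule inj_onI)
      fix i j assume ij: "i \<in> {..<n}" "j \<in> {..<n}" "z i u = z j u"
      have "z i u0 = z j u0"
        by (rule root_branch_unique[OF n simply_connected_imp_connected[OF assms(4)], of "z i" "z j" f u])
           (use z ij assms(7) u u0 in auto)
      then show "i = j" using z ij r by (auto simp: bij_betw_def inj_on_def)
    qed
  qed
qed

section \<open>Limits of branches and increments of logarithms\<close>

text \<open>If all roots are at distance at least \<open>\<epsilon>\<close>, the factorisation
  bounds the modulus of the value below by that of the leading coefficient times
  \<open>\<epsilon> ^ size A\<close>, where \<open>A\<close> is the multiset of roots.\<close>

lemma poly_small_near_root: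
  fixes F :: "complex poly"
  assumes "F \<noteq> 0" "\<epsilon> > 0"
  obtains \<delta> where "\<delta> > 0" "\<And>z. norm (poly F z) < \<delta> \<Longrightarrow> \<exists>r. poly F r = 0 \<and> dist z r < \<epsilon>"
proof -
  obtain A where A: "F = smult (lead_coeff F) (\<Prod>x\<in>#A. [:-x, 1:])"
    using alg_closed_imp_factorization[OF assms(1)] by blast
  have F: "poly F z = lead_coeff F * (\<Prod>x\<in>#A. z - x)" for z
    by (subst A) (simp add: poly_prod_mset image_mset.compositionality o_def)
  have root: "poly F x = 0" if "x \<in># A" for x
    unfolding F using that by (auto simp: prod_mset_zero_iff)
  have *: "norm (\<Prod>x\<in>#B. z - x) \<ge> \<epsilon> ^ size B" if "\<And>x. x \<in># B \<Longrightarrow> dist z x \<ge> \<epsilon>" for z and B :: "complex multiset"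
    using that
  proof (induction B)
    case (add x B)
    then have "\<epsilon> * \<epsilon> ^ size B \<le> norm (z - x) * norm (\<Prod>x\<in>#B. z - x)"
      using assms(2) by (intro mult_mono) (auto simp: dist_norm)
    then show ?case by (simp add: norm_mult)
  qed auto
  show ?thesis
  proof (rule that)
    show "norm (lead_coeff F) * \<epsilon> ^ size A > 0" using assms by auto
    fix z assume z: "norm (poly F z) < norm (lead_coeff F) * \<epsilon> ^ size A"
    show "\<exists>r. poly F r = 0 \<and> dist z r < \<epsilon>"
    proof (rule ccontr)
      assume "\<not> ?thesis"
      then have "\<epsilon> ^ size A \<le> norm (\<Prod>x\<in>#A. z - x)" using root by (intro *) force
      then have "norm (lead_coeff F) * \<epsilon> ^ size A \<le> norm (poly F z)"
        unfolding F norm_mult by (intro mult_left_mono) auto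
      then show False using z by simp
    qed
  qed
qed

lemma connected_subset_ball_of_Union:
  fixes S :: "'a :: metric_space set"
  assumes "connected S" "S \<subseteq> (\<Union>r\<in>R. ball r \<epsilon>)" "S \<noteq> {}"
    and disj: "\<And>a b. a \<in> R \<Longrightarrow> b \<in> R \<Longrightarrow> a \<noteq> b \<Longrightarrow> ball a \<epsilon> \<inter> ball b \<epsilon> = {}"
  obtains r where "r \<in> R" "S \<subseteq> ball r \<epsilon>"
proof -
  obtain x where x: "x \<in> S" using assms(3) by blast
  then obtain r where r: "r \<in> R" "x \<in> ball r \<epsilon>" using assms(2) by blast
  define U where "U = (\<Union>s\<in>R - {r}. ball s \<epsilon>)"
  have "open U" by (auto simp: U_def)
  moreover have "ball r \<epsilon> \<inter> U \<inter> S = {}" using disj r(1) by (fastforce simp: U_def)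
  moreover have "S \<subseteq> ball r \<epsilon> \<union> U" using assms(2) by (auto simp: U_def)
  ultimately have "ball r \<epsilon> \<inter> S = {} \<or> U \<inter> S = {}"
    using assms(1) unfolding connected_def by (metis open_ball)
  then have "S \<subseteq> ball r \<epsilon>" using x r \<open>S \<subseteq> ball r \<epsilon> \<union> U\<close> by blast
  then show ?thesis using that r by blast
qed

text \<open>Eventually \<open>f\<close> stays in a union of small disjoint balls around the roots,
  and connectedness confines it to one of them. Hypothesis \<open>conn\<close> provides arbitrarily
  late connected tails on which \<open>f\<close> is continuous; it fits both left half-planes and
  real half-lines.\<close>

lemma tendsto_root_of_poly_tendsto_0:
  fixes F :: "complex poly" and f :: "'a :: topological_space \<Rightarrow> complex"
  assumes "F \<noteq> 0" "G \<noteq> bot" and lim: "((\<lambda>x. poly F (f x)) \<longlongrightarrow> 0) G"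
    and conn: "\<And>P. eventually P G \<Longrightarrow>
      \<exists>S. connected S \<and> continuous_on S f \<and> (\<forall>x\<in>S. P x) \<and> eventually (\<lambda>x. x \<in> S) G"
  obtains r where "poly F r = 0" "(f \<longlongrightarrow> r) G"
proof -
  define R where "R = {r. poly F r = 0}"
  have "finite R" unfolding R_def using assms(1) by (rule poly_roots_finite)
  then obtain e0 where e0: "e0 > 0" "\<And>a b. a \<in> R \<Longrightarrow> b \<in> R \<Longrightarrow> a \<noteq> b \<Longrightarrow> ball a e0 \<inter> ball b e0 = {}"
    using finite_separated by blast
  have ev: "\<exists>r\<in>R. \<forall>\<^sub>F x in G. f x \<in> ball r e" if e: "e > 0" "e \<le> e0" for e
  proof -
    obtain \<delta> where \<delta>: "\<delta> > 0" "\<And>z. norm (poly F z) < \<delta> \<Longrightarrow> \<exists>r. poly F r = 0 \<and> dist z r < e"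
      using poly_small_near_root[OF assms(1) e(1)] by metis
    have "\<forall>\<^sub>F x in G. norm (poly F (f x)) < \<delta>" using lim \<delta>(1) by (simp add: tendsto_iff)
    then obtain S where S: "connected S" "continuous_on S f" "\<And>x. x \<in> S \<Longrightarrow> norm (poly F (f x)) < \<delta>"
      "\<forall>\<^sub>F x in G. x \<in> S" using conn by meson
    have "S \<noteq> {}" using S(4) assms(2) by (auto simp: trivial_limit_def)
    have "f ` S \<subseteq> (\<Union>r\<in>R. ball r e)" using \<delta>(2) S(3) by (fastforce simp: R_def dist_commute)
    moreover have "ball a e \<inter> ball b e = {}" if "a \<in> R" "b \<in> R" "a \<noteq> b" for a b
      using e0(2)[OF that] e(2) subset_ball by blast
    ultimately obtain r where "r \<in> R" "f ` S \<subseteq> ball r e"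
      using connected_subset_ball_of_Union[OF connected_continuous_image[OF S(2,1)]] \<open>S \<noteq> {}\<close> by (metis image_is_empty)
    moreover have "\<forall>\<^sub>F x in G. f x \<in> ball r e"
      using S(4) by eventually_elim (use calculation in blast)
    ultimately show ?thesis by blast
  qed
  obtain r where r: "r \<in> R" "\<forall>\<^sub>F x in G. f x \<in> ball r e0" using ev[OF e0(1)] by auto
  have "\<forall>\<^sub>F x in G. dist (f x) r < e" if "e > 0" for e
  proof -
    define e' where "e' = min e e0"
    have e': "e' > 0" "e' \<le> e0" "e' \<le> e" using that e0(1) by (auto simp: e'_def)
    obtain s where s: "s \<in> R" "\<forall>\<^sub>F x in G. f x \<in> ball s e'" using ev[OF e'(1,2)] by auto
    have "\<exists>x. f x \<in> ball r e0 \<and> f x \<in> ball s e'"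
      using eventually_happens'[OF assms(2) eventually_conj[OF r(2) s(2)]] by blast
    then have "s = r" using e0(2)[OF r(1) s(1)] subset_ball[OF e'(2)] by blast
    show ?thesis using s(2) unfolding \<open>s = r\<close>
      by eventually_elim (use e' in \<open>auto simp: dist_commute\<close>)
  qed
  then show ?thesis using that[of r] r(1) by (auto simp: R_def tendsto_iff)
qed

section \<open>Logarithms on left half-planes\<close>

lemma continuous_logs_unique:
  fixes f g :: "'a :: topological_space \<Rightarrow> complex"
  assumes "connected S" "continuous_on S f" "continuous_on S g"
    and "\<And>x. x \<in> S \<Longrightarrow> exp (f x) = exp (g x)" "a \<in> S" "f a = g a" "x \<in> S"
  shows "f x = g x"
proof (rule covering_space_lift_unique[OF covering_space_exp_punctured_plane, where ?g1.0 = f and ?g2.0 = g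
      and f = "exp \<circ> f" and T = S and a = a])
  show "continuous_on S (exp \<circ> f)" by (intro continuous_on_compose assms continuous_intros)
qed (use assms in auto)

text \<open>In the coordinate \<open>t0 + v * exp u\<close> this is approach to \<open>t0\<close>
  from all sides. The imaginary part is left free, so that statements about the limit survive going
  around \<open>t0\<close>.\<close>

abbreviation far_left :: "complex filter" where
  "far_left \<equiv> filtercomap Re at_bot"

lemma eventually_far_left: "eventually P far_left \<longleftrightarrow> (\<exists>k. \<forall>u. Re u < k \<longrightarrow> P u)"
  by (simp add: eventually_filtercomap_at_bot_dense)

lemma far_left_neq_bot: "far_left \<noteq> bot"
proof
  assume "far_left = bot"
  then have "eventually (\<lambda>_. False) far_left" by simp
  then obtain k where "\<forall>u. \<not> Re u < k" unfolding eventually_far_left by auto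
  then show False by (metis Re_complex_of_real lt_ex)
qed

lemma connected_left_half_plane: "connected {u. Re u < k}"
  by (intro convex_connected convex_halfspace_Re_lt)

lemma exp_tendsto_0_far_left: "(exp \<longlongrightarrow> 0) far_left"
proof (rule tendsto_norm_zero_cancel)
  have "filterlim Re at_bot far_left" by (rule filterlim_filtercomap)
  then have "((\<lambda>u. exp (Re u)) \<longlongrightarrow> 0) far_left" by (rule filterlim_compose[OF exp_at_bot])
  then show "((\<lambda>u. norm (exp u :: complex)) \<longlongrightarrow> 0) far_left" by simp
qed

text \<open>The limit says that \<open>L u\<close> behaves like \<open>- (j / d) * u\<close>. Far to
  the left, \<open>exp (d * L u + j * u) / g\<close> is close to 1 and has a principal logarithm,
  which inherits its period; \<open>d * L u + j * u\<close> differs from that logarithm by a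
  constant and so is periodic as well.\<close>

lemma log_increment:
  fixes L :: "complex \<Rightarrow> complex" and j :: int and N d :: nat
  assumes cont: "continuous_on {u. Re u < k} L"
    and per: "\<And>u. Re u < k \<Longrightarrow> exp (L (u + 2 * pi * \<i> * N)) = exp (L u)"
    and lim: "((\<lambda>u :: complex. exp (d * L u + j * u)) \<longlongrightarrow> g) far_left" "g \<noteq> 0"
  shows "\<forall>\<^sub>F u :: complex in far_left. d * (L (u + 2 * pi * \<i> * N) - L u) = - (j * (2 * pi * \<i> * N))"
proof -
  define D where "D = 2 * pi * \<i> * N"
  define E where "E = (\<lambda>u :: complex. exp (d * L u + j * u))"
  have Dj: "exp (j * D) = 1"
    by (simp add: D_def exp_eq_1 exI[of _ "j * int N"])
  have EE: "E (u + D) = E u" if "Re u < k" for u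
  proof -
    have "E (u + D) = exp (L (u + D)) ^ d * (exp (j * u) * exp (j * D))"
      by (simp add: E_def exp_add ring_distribs exp_of_nat_mult)
    also have "\<dots> = E u" using per[OF that] Dj
      by (simp add: E_def D_def exp_add exp_of_nat_mult)
    finally show ?thesis .
  qed
  have "((\<lambda>u. E u / g) \<longlongrightarrow> g / g) far_left" unfolding E_def using lim by (intro tendsto_intros)
  then have "\<forall>\<^sub>F u in far_left. dist (E u / g) 1 < 1" using lim(2) by (simp add: tendsto_iff)
  then obtain k' where k': "\<And>u. Re u < k' \<Longrightarrow> dist (E u / g) 1 < 1"
    unfolding eventually_far_left by blast
  define m where "m = min k k'"
  have nonpos: "E u / g \<notin> \<real>\<^sub>\<le>\<^sub>0" if "Re u < m" for u
  proof
    assume "E u / g \<in> \<real>\<^sub>\<le>\<^sub>0"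
    then obtain x where x: "E u / g = of_real x" "x \<le> 0" by (auto elim: nonpos_Reals_cases)
    have "dist (E u / g) 1 = norm (of_real (x - 1) :: complex)" unfolding x(1) by (simp add: dist_norm)
    also have "\<dots> \<ge> 1" unfolding norm_of_real using x(2) by simp
    finally show False using k'[of u] that by (simp add: m_def)
  qed
  have contE: "continuous_on {u. Re u < m} (\<lambda>u :: complex. d * L u + j * u)"
    by (intro continuous_intros continuous_on_subset[OF cont]) (auto simp: m_def)
  define M where "M = (\<lambda>u. Ln (E u / g))"
  have contM: "continuous_on {u. Re u < m} M" unfolding M_def E_def
    using nonpos lim(2) unfolding E_def by (intro continuous_intros contE continuous_on_Ln') auto
  define u0 where "u0 = complex_of_real (m - 1)"
  have eq: "d * L u + j * u = M u + (d * L u0 + j * u0 - M u0)" if "Re u < m" for u :: complex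
  proof (rule continuous_logs_unique[OF connected_left_half_plane, of m "\<lambda>u :: complex. d * L u + j * u" "\<lambda>u. M u + (d * L u0 + j * u0 - M u0)" u0 u])
    have expM: "exp (M u) = E u / g" for u using lim(2) by (simp add: M_def E_def)
    show "exp (d * L u + j * u) = exp (M u + (d * L u0 + j * u0 - M u0))" for u :: complex
      using lim(2) unfolding exp_add exp_diff expM by (simp add: E_def exp_add exp_diff)
  qed (use that contM contE in \<open>auto intro!: continuous_intros simp: u0_def\<close>)
  have "d * (L (u + D) - L u) = - (j * D)" if u: "Re u < m" for u :: complex
  proof -
    have "M (u + D) = M u" using EE[of u] u by (simp add: M_def m_def)
    moreover have "Re (u + D) < m" using u by (simp add: D_def)
    ultimately have "d * L (u + D) + j * (u + D) = d * L u + j * u" using eq u by simp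
    then show ?thesis by (simp add: algebra_simps)
  qed
  then show ?thesis unfolding eventually_far_left D_def by blast
qed

text \<open>Substituting \<open>t = t\<^sub>0 + v * exp u\<close> turns a punctured neighbourhood of \<open>t\<^sub>0\<close> into the
  left half-plane, with a loop around \<open>t\<^sub>0\<close> becoming the shift by \<open>2 \<pi> \<i>\<close>, and a neighbourhood of the ray
  from \<open>t\<^sub>0\<close> in direction \<open>v\<close> into a horizontal strip.\<close>

definition ray_domain :: "real \<Rightarrow> real \<Rightarrow> complex set" where
  "ray_domain K \<delta> = {u. Re u < - K} \<union> {u. \<bar>Im u\<bar> < \<delta>}"

lemma open_ray_domain: "open (ray_domain K \<delta>)"
  unfolding ray_domain_def by (intro open_Un open_Collect_less continuous_intros)

lemma left_in_ray_domain: "Re u < - K \<Longrightarrow> u \<in> ray_domain K \<delta>"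
  by (simp add: ray_domain_def)

lemma of_real_in_ray_domain: "\<delta> > 0 \<Longrightarrow> of_real x \<in> ray_domain K \<delta>"
  by (simp add: ray_domain_def)

lemma simply_connected_ray_domain:
  assumes "\<delta> > 0"
  shows "simply_connected (ray_domain K \<delta>)"
proof (rule starlike_imp_simply_connected)
  define c where "c = complex_of_real (- K - 1)"
  have c: "c \<in> {u. Re u < - K}" "c \<in> {u. \<bar>Im u\<bar> < \<delta>}" using assms by (auto simp: c_def)
  have "convex {u :: complex. \<bar>Im u\<bar> < \<delta>}"
    unfolding abs_less_iff Collect_conj_eq using convex_halfspace_Im_lt convex_halfspace_Im_gt[of "-\<delta>"]
    by (intro convex_Int) (auto simp: minus_less_iff)
  then have "closed_segment c u \<subseteq> ray_domain K \<delta>" if "u \<in> ray_domain K \<delta>" for u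
    using that c convex_halfspace_Re_lt[of "-K"] unfolding ray_domain_def
    by (meson Un_iff closed_segment_subset le_supI1 le_supI2)
  then show "starlike (ray_domain K \<delta>)" unfolding starlike_def using c by (auto simp: ray_domain_def)
qed

lemmas connected_ray_domain = simply_connected_imp_connected[OF simply_connected_ray_domain]

section \<open>The Cauchy transform\<close>

text \<open>Lagrange interpolation at the \<open>n\<close> roots: the cofactor \<open>R i\<close> of
  \<open>x - \<zeta> i\<close> in \<open>P - t\<close> takes at \<open>\<zeta> i\<close> the value
  of the derivative of \<open>P\<close>, and \<open>q\<close>, having degree below \<open>n\<close>,
  equals its interpolant.\<close>

lemma poly_div_prod_partial_fractions:
  fixes P q :: "complex poly"
  assumes "degree P = n" "n > 0" "inj_on \<zeta> {..<n}" "\<And>i. i < n \<Longrightarrow> poly P (\<zeta> i) = t"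
    and "degree q < n" "poly P x \<noteq> t"
  shows "poly q x / (poly P x - t) =
    (\<Sum>i<n. poly q (\<zeta> i) / poly (pderiv P) (\<zeta> i) * (1 / (x - \<zeta> i)))"
proof -
  define R where "R = (\<lambda>i. smult (lead_coeff P) (\<Prod>j\<in>{..<n} - {i}. [:- \<zeta> j, 1:]))"
  have prod: "poly P x - t = lead_coeff P * (\<Prod>i<n. x - \<zeta> i)" for x
    by (rule poly_eq_prod_roots[OF assms(1-4)])
  have R: "P - [:t:] = [:- \<zeta> i, 1:] * R i" if i: "i < n" for i
  proof -
    have "poly (P - [:t:]) y = poly ([:- \<zeta> i, 1:] * R i) y" for y
      using prod[of y] i by (simp add: R_def poly_prod prod.remove[of "{..<n}" i] algebra_simps)
    then show ?thesis by (simp flip: poly_eq_poly_eq_iff add: fun_eq_iff)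
  qed
  have dP: "poly (pderiv P) (\<zeta> i) = poly (R i) (\<zeta> i)" if i: "i < n" for i
  proof -
    have "pderiv P = pderiv (P - [:t:])" by (simp add: pderiv_diff)
    also have "poly \<dots> (\<zeta> i) = poly (R i) (\<zeta> i)" unfolding R[OF i] pderiv_mult by (simp add: pderiv_pCons)
    finally show ?thesis .
  qed
  have lc: "lead_coeff P \<noteq> 0" using assms(1,2) by auto
  have R0: "poly (R i) (\<zeta> j) = 0 \<longleftrightarrow> j \<noteq> i" if "i < n" "j < n" for i j
    using that assms(3) lc by (auto simp: R_def poly_prod inj_on_def)
  define S where "S = (\<Sum>i<n. smult (poly q (\<zeta> i) / poly (R i) (\<zeta> i)) (R i))"
  have "degree S < n"
  proof -
    have "degree (R i) \<le> n - 1" if "i < n" for i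
      unfolding R_def using that by (intro order_trans[OF degree_smult_le])
        (subst degree_prod_eq_sum_degree; simp)
    then have "degree S \<le> n - 1"
      unfolding S_def by (intro degree_sum_le) (auto intro: order_trans[OF degree_smult_le])
    then show ?thesis using assms(2) by linarith
  qed
  have "poly S (\<zeta> j) = poly q (\<zeta> j)" if j: "j < n" for j
  proof -
    have "poly S (\<zeta> j) = (\<Sum>i<n. poly q (\<zeta> i) / poly (R i) (\<zeta> i) * poly (R i) (\<zeta> j))"
      by (simp add: S_def poly_sum)
    also have "\<dots> = poly q (\<zeta> j) / poly (R j) (\<zeta> j) * poly (R j) (\<zeta> j)"
      using j R0[OF _ j] by (subst sum.remove[of _ j]) (auto intro!: sum.neutral)
    finally show ?thesis using R0[OF j j] by simp
  qed
  have "q = S"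
  proof (rule ccontr)
    assume "q \<noteq> S"
    then have nz: "q - S \<noteq> 0" by simp
    have "\<zeta> ` {..<n} \<subseteq> {y. poly (q - S) y = 0}"
      using \<open>\<And>j. j < n \<Longrightarrow> poly S (\<zeta> j) = poly q (\<zeta> j)\<close> by auto
    then have "card (\<zeta> ` {..<n}) \<le> card {y. poly (q - S) y = 0}"
      using nz by (intro card_mono poly_roots_finite)
    also have "\<dots> \<le> degree (q - S)" using nz by (rule card_poly_roots_bound)
    also have "\<dots> < n" using \<open>degree S < n\<close> assms(5) by (rule degree_diff_less[rotated])
    finally show False using assms(3) by (simp add: card_image)
  qed
  have x: "x \<noteq> \<zeta> i" if "i < n" for i using assms(4)[OF that] assms(6) by auto
  have "poly q x = (\<Sum>i<n. poly q (\<zeta> i) / poly (R i) (\<zeta> i) * poly (R i) x)"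
    by (subst \<open>q = S\<close>, subst S_def) (simp add: poly_sum)
  also have "\<dots> / (poly P x - t) = (\<Sum>i<n. poly q (\<zeta> i) / poly (R i) (\<zeta> i) * (poly (R i) x / (poly P x - t)))"
    by (simp add: sum_divide_distrib)
  also have "\<dots> = (\<Sum>i<n. poly q (\<zeta> i) / poly (pderiv P) (\<zeta> i) * (1 / (x - \<zeta> i)))"
  proof (intro sum.cong refl)
    fix i assume i: "i \<in> {..<n}"
    have e: "poly P x - t = (x - \<zeta> i) * poly (R i) x"
      using arg_cong[OF R[of i], of "\<lambda>p. poly p x"] i by (simp add: left_diff_distrib)
    then have "poly (R i) x \<noteq> 0" using assms(6) by auto
    then show "poly q (\<zeta> i) / poly (R i) (\<zeta> i) * (poly (R i) x / (poly P x - t)) =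
        poly q (\<zeta> i) / poly (pderiv P) (\<zeta> i) * (1 / (x - \<zeta> i))"
      unfolding e using dP i by simp
  qed
  finally show ?thesis .
qed

text \<open>From \<open>q = q1 * P + q0\<close> follows
  \<open>q / (P - t) = q1 + t * q1 / (P - t) + q0 / (P - t)\<close>, which lowers the degree until
  partial fractions apply; the integrals of the quotients collect in \<open>C\<close>. The
  polynomial \<open>C\<close> is chosen before \<open>t\<close> and \<open>\<zeta>\<close>, so that
  the identity can be continued analytically in \<open>t\<close>.\<close>

lemma contour_integral_poly_div_linepath:
  fixes P q :: "complex poly"
  assumes n: "degree P = n" "n > 0"
  shows "\<exists>C. \<forall>t \<zeta>. inj_on \<zeta> {..<n} \<longrightarrow> (\<forall>i<n. poly P (\<zeta> i) = t) \<longrightarrow> t \<notin> poly P ` closed_segment a b \<longrightarrow>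
    contour_integral (linepath a b) (\<lambda>x. poly q x / (poly P x - t)) = poly C t +
      (\<Sum>i<n. poly q (\<zeta> i) / poly (pderiv P) (\<zeta> i) * contour_integral (linepath a b) (\<lambda>x. 1 / (x - \<zeta> i)))"
proof (induction "degree q" arbitrary: q rule: less_induct)
  case less
  show ?case
  proof (cases "degree q < n")
    case True
    have "contour_integral (linepath a b) (\<lambda>x. poly q x / (poly P x - t)) = poly 0 t +
      (\<Sum>i<n. poly q (\<zeta> i) / poly (pderiv P) (\<zeta> i) * contour_integral (linepath a b) (\<lambda>x. 1 / (x - \<zeta> i)))"
      if \<zeta>: "inj_on \<zeta> {..<n}" "\<forall>i<n. poly P (\<zeta> i) = t" "t \<notin> poly P ` closed_segment a b" for t \<zeta>
    proof -
      have nin: "\<zeta> i \<notin> closed_segment a b" if "i < n" for i using \<zeta> that by blast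
      have "contour_integral (linepath a b) (\<lambda>x. poly q x / (poly P x - t)) =
         contour_integral (linepath a b) (\<lambda>x. \<Sum>i<n. poly q (\<zeta> i) / poly (pderiv P) (\<zeta> i) * (1 / (x - \<zeta> i)))"
        using \<zeta> by (intro contour_integral_cong refl poly_div_prod_partial_fractions[OF n _ _ True]) auto
      also have "\<dots> = (\<Sum>i<n. contour_integral (linepath a b) (\<lambda>x. poly q (\<zeta> i) / poly (pderiv P) (\<zeta> i) * (1 / (x - \<zeta> i))))"
        using nin by (intro contour_integral_sum contour_integrable_continuous_linepath continuous_intros) auto
      also have "\<dots> = (\<Sum>i<n. poly q (\<zeta> i) / poly (pderiv P) (\<zeta> i) * contour_integral (linepath a b) (\<lambda>x. 1 / (x - \<zeta> i)))"
        using nin by (intro sum.cong refl contour_integral_lmul contour_integrable_continuous_linepath continuous_intros) auto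
      finally show ?thesis by simp
    qed
    then show ?thesis by (intro exI[of _ 0]) blast
  next
    case False
    define q1 where "q1 = q div P"
    define q0 where "q0 = q mod P"
    have q: "q = q1 * P + q0" by (simp add: q1_def q0_def)
    have P0: "P \<noteq> 0" using n by auto
    have d0: "degree q0 < n" using degree_mod_less[of P q] P0 n unfolding q0_def by auto
    have "degree q1 < degree q"
      using False n P0 degree_div_less[of P q] unfolding q1_def
      by (cases "q = 0") (auto simp: degree_div_less)
    then obtain C1 where C1: "\<And>t \<zeta>. inj_on \<zeta> {..<n} \<Longrightarrow> \<forall>i<n. poly P (\<zeta> i) = t \<Longrightarrow> t \<notin> poly P ` closed_segment a b \<Longrightarrow>
      contour_integral (linepath a b) (\<lambda>x. poly q1 x / (poly P x - t)) = poly C1 t +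
      (\<Sum>i<n. poly q1 (\<zeta> i) / poly (pderiv P) (\<zeta> i) * contour_integral (linepath a b) (\<lambda>x. 1 / (x - \<zeta> i)))"
      using less by blast
    have "degree q0 < degree q" using d0 False by simp
    then obtain C0 where C0: "\<And>t \<zeta>. inj_on \<zeta> {..<n} \<Longrightarrow> \<forall>i<n. poly P (\<zeta> i) = t \<Longrightarrow> t \<notin> poly P ` closed_segment a b \<Longrightarrow>
      contour_integral (linepath a b) (\<lambda>x. poly q0 x / (poly P x - t)) = poly C0 t +
      (\<Sum>i<n. poly q0 (\<zeta> i) / poly (pderiv P) (\<zeta> i) * contour_integral (linepath a b) (\<lambda>x. 1 / (x - \<zeta> i)))"
      using less by blast
    define c where "c = contour_integral (linepath a b) (poly q1)"
    have "contour_integral (linepath a b) (\<lambda>x. poly q x / (poly P x - t)) = poly ([:c:] + C0 + [:0,1:] * C1) t +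
      (\<Sum>i<n. poly q (\<zeta> i) / poly (pderiv P) (\<zeta> i) * contour_integral (linepath a b) (\<lambda>x. 1 / (x - \<zeta> i)))"
      if \<zeta>: "inj_on \<zeta> {..<n}" "\<forall>i<n. poly P (\<zeta> i) = t" "t \<notin> poly P ` closed_segment a b" for t \<zeta>
    proof -
      have ne: "poly P x - t \<noteq> 0" if "x \<in> closed_segment a b" for x using \<zeta>(3) that by auto
      let ?I = "contour_integral (linepath a b)"
      have int: "poly q1 contour_integrable_on linepath a b"
        "(\<lambda>x. poly q1 x / (poly P x - t)) contour_integrable_on linepath a b"
        "(\<lambda>x. poly q0 x / (poly P x - t)) contour_integrable_on linepath a b"
        using ne by (intro contour_integrable_continuous_linepath continuous_intros; simp)+
      have "?I (\<lambda>x. poly q x / (poly P x - t)) =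
        ?I (\<lambda>x. poly q1 x + (t * (poly q1 x / (poly P x - t)) + poly q0 x / (poly P x - t)))"
      proof (intro contour_integral_cong refl)
        fix x assume "x \<in> path_image (linepath a b)"
        then have "poly P x - t \<noteq> 0" using ne by simp
        moreover have "(A * (d + t) + B) / d = A + (t * (A / d) + B / d)" if "d \<noteq> 0" for A B d :: complex
          using that by (simp add: field_simps)
        ultimately show "poly q x / (poly P x - t) = poly q1 x + (t * (poly q1 x / (poly P x - t)) + poly q0 x / (poly P x - t))"
          unfolding q by (metis diff_add_cancel poly_add poly_mult)
      qed
      also have "\<dots> = c + (t * ?I (\<lambda>x. poly q1 x / (poly P x - t)) + ?I (\<lambda>x. poly q0 x / (poly P x - t)))"
        unfolding c_def contour_integral_lmul[OF int(2), symmetric]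
          contour_integral_add[OF contour_integrable_lmul[OF int(2)] int(3), symmetric]
        by (rule contour_integral_add[OF int(1) contour_integrable_add[OF contour_integrable_lmul[OF int(2)] int(3)]])
      also have "\<dots> = poly ([:c:] + C0 + [:0,1:] * C1) t +
         (\<Sum>i<n. t * (poly q1 (\<zeta> i) / poly (pderiv P) (\<zeta> i) * ?I (\<lambda>x. 1 / (x - \<zeta> i))) +
            poly q0 (\<zeta> i) / poly (pderiv P) (\<zeta> i) * ?I (\<lambda>x. 1 / (x - \<zeta> i)))"
        unfolding C1[OF \<zeta>] C0[OF \<zeta>] sum.distrib by (simp add: sum_distrib_left algebra_simps)
      also have "(\<Sum>i<n. t * (poly q1 (\<zeta> i) / poly (pderiv P) (\<zeta> i) * ?I (\<lambda>x. 1 / (x - \<zeta> i))) +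
            poly q0 (\<zeta> i) / poly (pderiv P) (\<zeta> i) * ?I (\<lambda>x. 1 / (x - \<zeta> i))) =
         (\<Sum>i<n. poly q (\<zeta> i) / poly (pderiv P) (\<zeta> i) * ?I (\<lambda>x. 1 / (x - \<zeta> i)))"
        using \<zeta>(2) by (intro sum.cong refl) (simp add: q add_divide_distrib algebra_simps)
      finally show ?thesis .
    qed
    then show ?thesis by blast
  qed
qed

text \<open>Expand \<open>1 / (P - t)\<close> as a geometric series in \<open>P / t\<close>. Beyond
  the bound \<open>M\<close> it converges uniformly on the segment, and each term integrates to a
  multiple of a moment.\<close>

lemma cauchy_transform_eq_0:
  fixes P q :: "complex poly"
  assumes mom: "\<And>i::nat. contour_integral (linepath a b) (\<lambda>z. poly P z ^ i * poly q z) = 0"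
    and bound: "\<And>z. z \<in> closed_segment a b \<Longrightarrow> norm (poly P z) \<le> M" "norm t > M"
  shows "contour_integral (linepath a b) (\<lambda>x. poly q x / (poly P x - t)) = 0"
proof -
  have M0: "M \<ge> 0" using bound(1)[of a] norm_ge_zero order_trans by (metis ends_in_segment(1))
  then have t0: "t \<noteq> 0" using bound(2) by auto
  define f where "f = (\<lambda>k x. \<Sum>i<k. - (1 / t ^ Suc i) * (poly P x ^ i * poly q x))"
  have f: "f k x = poly q x / (poly P x - t) - (poly P x / t) ^ k * (poly q x / (poly P x - t))"
    if "x \<in> closed_segment a b" for k x
  proof -
    have ne: "poly P x / t \<noteq> 1" "poly P x \<noteq> t" using bound(1)[OF that] bound(2) t0 by auto
    have "f k x = - (poly q x / t) * (\<Sum>i<k. (poly P x / t) ^ i)"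
      by (simp add: f_def sum_distrib_left power_divide field_simps)
    also have "(\<Sum>i<k. (poly P x / t) ^ i) = ((poly P x / t) ^ k - 1) / (poly P x / t - 1)"
      using geometric_sum[OF ne(1)] .
    also have "poly P x / t - 1 = (poly P x - t) / t" using t0 by (simp add: field_simps)
    finally have "f k x = - (poly q x / t) * (((poly P x / t) ^ k - 1) / ((poly P x - t) / t))" .
    moreover have "- (Q / t) * ((X - 1) / (d / t)) = Q / d - X * (Q / d)" if "d \<noteq> 0" for Q X d :: complex
      using that t0 by (simp add: field_simps)
    ultimately show ?thesis using ne(2) by simp
  qed
  have int: "f k contour_integrable_on linepath a b" for k
    unfolding f_def by (intro contour_integrable_continuous_linepath continuous_intros)
  have zero: "contour_integral (linepath a b) (f k) = 0" for k
  proof -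
    have "contour_integral (linepath a b) (f k) =
       (\<Sum>i<k. contour_integral (linepath a b) (\<lambda>x. - (1 / t ^ Suc i) * (poly P x ^ i * poly q x)))"
      unfolding f_def by (intro contour_integral_sum contour_integrable_continuous_linepath continuous_intros) auto
    also have "\<dots> = 0"
      by (intro sum.neutral ballI, subst contour_integral_lmul)
         (auto intro!: contour_integrable_continuous_linepath continuous_intros simp: mom)
    finally show ?thesis .
  qed
  define g where "g = (\<lambda>x. poly q x / (poly P x - t))"
  have contg: "continuous_on (closed_segment a b) g" unfolding g_def
    using bound by (intro continuous_intros) force
  then have "bounded (g ` closed_segment a b)"
    by (intro compact_imp_bounded compact_continuous_image) auto
  then obtain B where B: "B > 0" "\<And>x. x \<in> closed_segment a b \<Longrightarrow> norm (g x) \<le> B"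
    unfolding bounded_pos by blast
  define \<rho> where "\<rho> = M / norm t"
  have \<rho>: "0 \<le> \<rho>" "\<rho> < 1" using M0 bound(2) by (auto simp: \<rho>_def divide_less_eq)
  have "uniform_limit (closed_segment a b) f g sequentially"
  proof (rule uniform_limitI)
    fix e :: real assume e: "e > 0"
    have "(\<lambda>k. \<rho> ^ k * B) \<longlonglongrightarrow> 0 * B" using \<rho> by (intro tendsto_intros LIMSEQ_power_zero) auto
    then have "\<forall>\<^sub>F k in sequentially. \<rho> ^ k * B < e" using e by (simp add: order_tendstoD(2))
    then show "\<forall>\<^sub>F k in sequentially. \<forall>x\<in>closed_segment a b. dist (f k x) (g x) < e"
    proof eventually_elim
      case (elim k)
      show ?case
      proof
        fix x assume x: "x \<in> closed_segment a b"
        have "dist (f k x) (g x) = norm (poly P x / t) ^ k * norm (g x)"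
          unfolding f[OF x] g_def[symmetric] dist_norm
          by (simp add: g_def norm_mult norm_power norm_divide)
        also have "\<dots> \<le> \<rho> ^ k * B"
          using bound(1)[OF x] B(2)[OF x] \<rho> B(1)
          by (intro mult_mono power_mono) (auto simp: norm_divide \<rho>_def divide_right_mono)
        finally show "dist (f k x) (g x) < e" using elim by simp
      qed
    qed
  qed
  then have ul: "uniform_limit (path_image (linepath a b)) f g sequentially" by simp
  have "(\<lambda>k. contour_integral (linepath a b) (f k)) \<longlonglongrightarrow> contour_integral (linepath a b) g"
    by (rule contour_integral_uniform_limit(2)[OF _ ul, where B = "norm (b - a)"]) (use int in auto)
  then have "contour_integral (linepath a b) g = 0" unfolding zero by (simp add: LIMSEQ_const_iff)
  then show ?thesis by (simp add: g_def)
qed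

section \<open>Continuation along a ray\<close>

text \<open>All inverse branches of \<open>P\<close> in a logarithmic coordinate based at
  \<open>t0\<close>. Since \<open>exp\<close> never vanishes, \<open>t0\<close> itself may be a
  critical value; only the other points reached have to be regular.\<close>

locale ray_branches =
  fixes P :: "complex poly" and n :: nat and t0 v :: complex and K \<delta> :: real
    and z :: "nat \<Rightarrow> complex \<Rightarrow> complex"
  assumes deg: "degree P = n" and n_pos: "n > 0" and v_nz: "v \<noteq> 0" and \<delta>_pos: "\<delta> > 0"
    and hol: "\<And>i. i < n \<Longrightarrow> z i holomorphic_on ray_domain K \<delta>"
    and root: "\<And>i u. i < n \<Longrightarrow> u \<in> ray_domain K \<delta> \<Longrightarrow> poly P (z i u) = t0 + v * exp u"
    and inj: "\<And>u. u \<in> ray_domain K \<delta> \<Longrightarrow> inj_on (\<lambda>i. z i u) {..<n}"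
    and reg: "\<And>u. u \<in> ray_domain K \<delta> \<Longrightarrow> t0 + v * exp u \<in> regular_values P"
begin

abbreviation "W \<equiv> ray_domain K \<delta>"

lemma deg_pos: "degree P > 0"
  using deg n_pos by simp

lemma lead_nz: "lead_coeff P \<noteq> 0"
  using deg_pos by auto

lemma cont: "i < n \<Longrightarrow> continuous_on W (z i)"
  using hol by (blast intro: holomorphic_on_imp_continuous_on)

lemma pderiv_nz: "i < n \<Longrightarrow> u \<in> W \<Longrightarrow> poly (pderiv P) (z i u) \<noteq> 0"
  using regular_valuesD[OF reg root] by blast

lemma factor: "u \<in> W \<Longrightarrow> poly P x - (t0 + v * exp u) = lead_coeff P * (\<Prod>i<n. x - z i u)"
  by (rule poly_eq_prod_roots[OF deg n_pos inj root]) auto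

lemma left_subset_W: "{u. Re u < - K} \<subseteq> W"
  by (auto simp: left_in_ray_domain)

lemma cont_left: "i < n \<Longrightarrow> k \<le> - K \<Longrightarrow> continuous_on {u. Re u < k} (z i)"
  by (rule continuous_on_subset[OF cont]) (auto simp: left_in_ray_domain)

lemma eventually_in_W: "\<forall>\<^sub>F u in far_left. u \<in> W"
  unfolding eventually_far_left using left_in_ray_domain by blast

text \<open>Small values of \<open>P - t0\<close> force each branch towards a root. The
  factorisation passes to the limit as well, so a root of multiplicity \<open>k\<close> attracts
  exactly \<open>k\<close> branches.\<close>

lemma left_limits:
  obtains r where "\<And>i. i < n \<Longrightarrow> (z i \<longlongrightarrow> r i) far_left"
    "\<And>x. poly P x - t0 = lead_coeff P * (\<Prod>i<n. x - r i)"
proof -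
  define F where "F = P - [:t0:]"
  have F: "F \<noteq> 0"
    using deg_pos unfolding F_def by auto
  have small: "((\<lambda>u. v * exp u) \<longlongrightarrow> 0) far_left"
    using tendsto_mult[OF tendsto_const exp_tendsto_0_far_left, of v] by simp
  have "\<exists>r. (z i \<longlongrightarrow> r) far_left" if i: "i < n" for i
  proof (rule tendsto_root_of_poly_tendsto_0[OF F far_left_neq_bot])
    have "\<forall>\<^sub>F u in far_left. v * exp u = poly F (z i u)"
      using eventually_in_W by eventually_elim (simp add: F_def root i)
    then show "((\<lambda>u. poly F (z i u)) \<longlongrightarrow> 0) far_left" by (rule Lim_transform_eventually[OF small])
    fix Q assume "eventually Q far_left"
    then obtain k where k: "\<And>u. Re u < k \<Longrightarrow> Q u" unfolding eventually_far_left by blast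
    show "\<exists>S. connected S \<and> continuous_on S (z i) \<and> (\<forall>x\<in>S. Q x) \<and> (\<forall>\<^sub>F x in far_left. x \<in> S)"
    proof (intro exI conjI)
      show "connected {u. Re u < min k (- K)}" by (rule connected_left_half_plane)
      show "continuous_on {u. Re u < min k (- K)} (z i)" using i by (rule cont_left) auto
      show "\<forall>x\<in>{u. Re u < min k (- K)}. Q x" using k by auto
      show "\<forall>\<^sub>F x in far_left. x \<in> {u. Re u < min k (- K)}" unfolding eventually_far_left by blast
    qed
  qed blast
  then obtain r where r: "\<And>i. i < n \<Longrightarrow> (z i \<longlongrightarrow> r i) far_left" by metis
  have "poly P x - t0 = lead_coeff P * (\<Prod>i<n. x - r i)" for x
  proof (rule tendsto_unique[OF far_left_neq_bot])
    have "((\<lambda>u. poly P x - (t0 + v * exp u)) \<longlongrightarrow> poly P x - (t0 + 0)) far_left"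
      by (intro tendsto_intros small)
    then show "((\<lambda>u. poly P x - (t0 + v * exp u)) \<longlongrightarrow> poly P x - t0) far_left" by simp
    have "((\<lambda>u. lead_coeff P * (\<Prod>i<n. x - z i u)) \<longlongrightarrow> lead_coeff P * (\<Prod>i<n. x - r i)) far_left"
      by (intro tendsto_intros r) auto
    moreover have "\<forall>\<^sub>F u in far_left. lead_coeff P * (\<Prod>i<n. x - z i u) = poly P x - (t0 + v * exp u)"
      using eventually_in_W by eventually_elim (simp add: factor)
    ultimately show "((\<lambda>u. poly P x - (t0 + v * exp u)) \<longlongrightarrow> lead_coeff P * (\<Prod>i<n. x - r i)) far_left"
      by (rule Lim_transform_eventually)
  qed
  then show ?thesis using that r by blast
qed

section \<open>Monodromy of the branches around \<open>t0\<close>\<close>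

lemma exp_shift: "exp (u + 2 * pi * \<i> * of_nat k) = exp u" for u :: complex
  using exp_eq[of "u + 2 * pi * \<i> * of_nat k" u] by (auto intro!: exI[of _ "int k"] simp: mult_ac)

text \<open>Pigeonhole: the continuations by \<open>0\<close> to \<open>n\<close> turns take values
  in a fibre of \<open>n\<close> points, so two of them agree at one point and then, by unique
  lifting, everywhere. Shifting back turns the difference of the two numbers of turns into a
  period.\<close>

lemma period_single:
  assumes i: "i < n"
  obtains p where "p > 0" "\<And>u. Re u < - K \<Longrightarrow> z i (u + 2 * pi * \<i> * of_nat p) = z i u"
proof -
  define u1 where "u1 = complex_of_real (- K - 1)"
  have u1: "Re u1 < - K" by (simp add: u1_def)
  define sh where "sh = (\<lambda>(k::nat) u. z i (u + 2 * pi * \<i> * of_nat k))"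
  have root_sh: "poly P (sh k u) = t0 + v * exp u" if "Re u < - K" for k u
  proof -
    have "poly P (sh k u) = t0 + v * exp (u + 2 * pi * \<i> * of_nat k)"
      unfolding sh_def by (rule root[OF i]) (use that in \<open>auto intro: left_in_ray_domain\<close>)
    then show ?thesis by (simp only: exp_shift)
  qed
  have fib: "finite {w. poly P w = t0 + v * exp u1}" "card {w. poly P w = t0 + v * exp u1} = n"
    using card_poly_fiber[OF deg_pos regular_valuesD[OF reg[OF left_in_ray_domain[OF u1]]]] deg by auto
  have "\<not> inj_on (\<lambda>k. sh k u1) {..n}"
  proof
    assume "inj_on (\<lambda>k. sh k u1) {..n}"
    then have "card {..n} \<le> card {w. poly P w = t0 + v * exp u1}"
      by (rule card_inj_on_le) (use root_sh[OF u1] fib in auto)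
    then show False using fib by simp
  qed
  then obtain k1 k2 where "k1 \<noteq> k2" "sh k1 u1 = sh k2 u1" unfolding inj_on_def by blast
  then obtain k l where kl: "k < l" "sh k u1 = sh l u1" by (metis linorder_neqE_nat)
  have cont_sh: "continuous_on {u. Re u < - K} (sh k)" for k
    unfolding sh_def using cont_left[OF i order_refl]
    by (rule continuous_on_compose2) (auto intro!: continuous_intros)
  have eq: "sh k u = sh l u" if "Re u < - K" for u
  proof (rule root_branch_unique[OF deg_pos connected_left_half_plane cont_sh cont_sh])
    show "(\<lambda>u. t0 + v * exp u) ` {u. Re u < - K} \<subseteq> regular_values P"
      using reg left_in_ray_domain by blast
  qed (use root_sh u1 kl that in auto)
  show ?thesis
  proof (rule that)
    show "l - k > 0" using kl by simp
    fix u assume u: "Re u < - K"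
    have "sh k (u - 2 * pi * \<i> * of_nat k) = sh l (u - 2 * pi * \<i> * of_nat k)"
      using u by (intro eq) simp
    then show "z i (u + 2 * pi * \<i> * of_nat (l - k)) = z i u"
      using kl(1) by (simp add: sh_def of_nat_diff algebra_simps)
  qed
qed

lemma period_mult:
  assumes "\<And>u. Re u < - K \<Longrightarrow> f (u + 2 * pi * \<i> * of_nat p) = f u" "Re u < - K"
  shows "f (u + 2 * pi * \<i> * of_nat (p * k)) = f u"
proof (induction k)
  case (Suc k)
  have "f (u + 2 * pi * \<i> * of_nat (p * Suc k)) = f ((u + 2 * pi * \<i> * of_nat (p * k)) + 2 * pi * \<i> * of_nat p)"
    by (simp add: algebra_simps)
  also have "\<dots> = f (u + 2 * pi * \<i> * of_nat (p * k))" using assms(2) by (intro assms(1)) simp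
  finally show ?case using Suc by simp
qed simp

lemma common_period:
  obtains N where "N > 0" "\<And>i u. i < n \<Longrightarrow> Re u < - K \<Longrightarrow> z i (u + 2 * pi * \<i> * of_nat N) = z i u"
proof -
  have "\<forall>i\<in>{..<n}. \<exists>p>0. \<forall>u. Re u < - K \<longrightarrow> z i (u + 2 * pi * \<i> * of_nat p) = z i u"
    using period_single by (metis lessThan_iff)
  then obtain p where p: "\<And>i. i < n \<Longrightarrow> p i > 0"
    "\<And>i u. i < n \<Longrightarrow> Re u < - K \<Longrightarrow> z i (u + 2 * pi * \<i> * of_nat (p i)) = z i u"
    by (metis lessThan_iff)
  show ?thesis
  proof (rule that)
    show "(\<Prod>i<n. p i) > 0" using p(1) by (intro prod_pos) auto
    fix i u assume i: "i < n" and u: "Re u < - K"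
    have "p i dvd (\<Prod>i<n. p i)" using i by (intro dvd_prodI) auto
    then obtain k where k: "(\<Prod>i<n. p i) = p i * k" by (auto elim: dvdE)
    show "z i (u + 2 * pi * \<i> * of_nat (\<Prod>i<n. p i)) = z i u"
      unfolding k by (rule period_mult) (use p(2) i u in auto)
  qed
qed

text \<open>The relation holds for the particular logarithms that equal the contour integrals when
  \<open>t\<close> is large. On a small ball around \<open>u0\<close> these are
  \<open>2 * pi * i\<close> times the winding number of the segment about the branch. Each is
  matched with a logarithm on all of \<open>W\<close>, and the identity theorem extends the
  relation.\<close>

lemma log_relation:
  fixes q :: "complex poly" and a b :: complex
  assumes a: "poly P a = t0" and b: "\<And>u. u \<in> W \<Longrightarrow> poly P b \<noteq> t0 + v * exp u"
    and mom: "\<And>i::nat. contour_integral (linepath a b) (\<lambda>z. poly P z ^ i * poly q z) = 0"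
  obtains L C where "\<And>i. i < n \<Longrightarrow> L i holomorphic_on W"
    "\<And>i u. i < n \<Longrightarrow> u \<in> W \<Longrightarrow> exp (L i u) = (b - z i u) / (a - z i u)"
    "\<And>u. u \<in> W \<Longrightarrow> poly C (t0 + v * exp u) +
       (\<Sum>i<n. poly q (z i u) / poly (pderiv P) (z i u) * L i u) = 0"
proof -
  have za: "z i u \<noteq> a" if "i < n" "u \<in> W" for i u using root[OF that] a v_nz by auto
  have zb: "z i u \<noteq> b" if "i < n" "u \<in> W" for i u using root[OF that] b[OF that(2)] by auto
  have "compact (poly P ` closed_segment a b)"
    by (intro compact_continuous_image continuous_intros) auto
  then obtain M where M: "M > 0" "\<And>x. x \<in> closed_segment a b \<Longrightarrow> norm (poly P x) \<le> M"
    using compact_imp_bounded bounded_pos by (metis imageI)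
  define T where "T = {u. norm (t0 + v * exp u) > M}"
  have "open T" unfolding T_def by (intro open_Collect_less continuous_intros)
  \<comment> \<open>Chosen so that \<open>v * exp u0\<close> has modulus
    \<open>M + norm t0 + 1\<close>, which puts \<open>t0 + v * exp u0\<close> beyond the bound
    \<open>M\<close>.\<close>
  define x0 where "x0 = ln ((M + norm t0 + 1) / norm v)"
  define u0 where "u0 = complex_of_real x0"
  have u0W: "u0 \<in> W" unfolding u0_def by (rule of_real_in_ray_domain[OF \<delta>_pos])
  have "(M + norm t0 + 1) / norm v > 0" using M(1) v_nz by (intro divide_pos_pos add_nonneg_pos) auto
  then have "norm (v * exp u0) = M + norm t0 + 1"
    using v_nz by (simp add: u0_def x0_def norm_mult)
  moreover have "norm (v * exp u0) \<le> norm (t0 + v * exp u0) + norm t0"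
    by (metis add_diff_cancel_left' norm_triangle_ineq4)
  ultimately have "u0 \<in> T" by (simp add: T_def)
  then have "open (T \<inter> W)" "u0 \<in> T \<inter> W" using \<open>open T\<close> open_ray_domain u0W by auto
  then obtain e where e: "e > 0" "ball u0 e \<subseteq> T \<inter> W" using openE by blast
  have notin: "z i u \<notin> closed_segment a b" if "i < n" "u \<in> ball u0 e" for i u
    using M(2)[of "z i u"] root[OF that(1)] that(2) e(2) by (force simp: T_def)
  define lg where "lg = (\<lambda>i u. 2 * pi * \<i> * winding_number (linepath a b) (z i u))"
  have exp_lg: "exp (lg i u) = (b - z i u) / (a - z i u)" if "i < n" "u \<in> ball u0 e" for i u
  proof -
    have "b - z i u = exp (lg i u) * (a - z i u)"
      using winding_number_exp_2pi[of "linepath a b" "z i u"] notin[OF that] by (simp add: lg_def)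
    moreover have "u \<in> W" using that(2) e(2) by blast
    then have "a - z i u \<noteq> 0" using za[OF that(1), of u] by auto
    ultimately show ?thesis by simp
  qed
  have cont_lg: "continuous_on (ball u0 e) (lg i)" if "i < n" for i
  proof -
    have "continuous_on (- path_image (linepath a b)) (winding_number (linepath a b))"
      by (intro continuous_on_winding_number) auto
    then have "continuous_on (ball u0 e) (\<lambda>u. winding_number (linepath a b) (z i u))"
    proof (rule continuous_on_compose2)
      show "continuous_on (ball u0 e) (z i)"
        by (rule continuous_on_subset[OF cont[OF that]]) (use e(2) in blast)
      show "z i ` ball u0 e \<subseteq> - path_image (linepath a b)"
        using notin[OF that] by auto
    qed
    then show ?thesis unfolding lg_def by (rule continuous_on_mult_left)
  qed
  have log: "\<forall>f. f holomorphic_on W \<and> (\<forall>u\<in>W. f u \<noteq> 0) \<longrightarrow> (\<exists>g. g holomorphic_on W \<and> (\<forall>u\<in>W. f u = exp (g u)))"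
    using simply_connected_ray_domain[OF \<delta>_pos, of K]
    unfolding simply_connected_eq_holomorphic_log[OF open_ray_domain] by (rule conjunct2)
  have "\<exists>L. L holomorphic_on W \<and> (\<forall>u\<in>W. exp (L u) = (b - z i u) / (a - z i u)) \<and> (\<forall>u\<in>ball u0 e. L u = lg i u)"
    if i: "i < n" for i
  proof -
    have "(\<lambda>u. (b - z i u) / (a - z i u)) holomorphic_on W"
      using za[OF i] by (intro holomorphic_intros hol i) auto
    moreover have "\<forall>u\<in>W. (b - z i u) / (a - z i u) \<noteq> 0" using za[OF i] zb[OF i] by auto
    ultimately obtain L0 where L0: "L0 holomorphic_on W" "\<And>u. u \<in> W \<Longrightarrow> (b - z i u) / (a - z i u) = exp (L0 u)"
      using log[rule_format, of "\<lambda>u. (b - z i u) / (a - z i u)"] by blast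
    \<comment> \<open>The logarithm obtained from simple connectedness differs at \<open>u0\<close>
      from the winding number one by an element of the kernel of \<open>exp\<close>; adding this
      constant adjusts it.\<close>
    define L where "L = (\<lambda>u. L0 u + (lg i u0 - L0 u0))"
    have "exp (lg i u0 - L0 u0) = 1"
      using exp_lg[OF i, of u0] L0(2)[OF u0W] e(1) by (simp add: exp_diff)
    then have expL: "exp (L u) = (b - z i u) / (a - z i u)" if "u \<in> W" for u
      using L0(2)[OF that] by (simp add: L_def exp_add)
    have holL: "L holomorphic_on W" unfolding L_def by (intro holomorphic_intros L0)
    have "L u = lg i u" if "u \<in> ball u0 e" for u
    proof (rule continuous_logs_unique[OF connected_ball, of u0 e L "lg i" u0 u])
      show "continuous_on (ball u0 e) L"
        using holL e(2) by (blast intro: holomorphic_on_imp_continuous_on continuous_on_subset)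
      show "continuous_on (ball u0 e) (lg i)" by (rule cont_lg[OF i])
    qed (use that e expL exp_lg[OF i] in \<open>auto simp: L_def subset_iff\<close>)
    then show ?thesis using holL expL by blast
  qed
  then obtain L where L: "\<And>i. i < n \<Longrightarrow> L i holomorphic_on W"
    "\<And>i u. i < n \<Longrightarrow> u \<in> W \<Longrightarrow> exp (L i u) = (b - z i u) / (a - z i u)"
    "\<And>i u. i < n \<Longrightarrow> u \<in> ball u0 e \<Longrightarrow> L i u = lg i u" by metis
  obtain C where C: "\<And>t \<zeta>. inj_on \<zeta> {..<n} \<Longrightarrow> \<forall>i<n. poly P (\<zeta> i) = t \<Longrightarrow> t \<notin> poly P ` closed_segment a b \<Longrightarrow>
    contour_integral (linepath a b) (\<lambda>x. poly q x / (poly P x - t)) = poly C t +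
      (\<Sum>i<n. poly q (\<zeta> i) / poly (pderiv P) (\<zeta> i) * contour_integral (linepath a b) (\<lambda>x. 1 / (x - \<zeta> i)))"
    using contour_integral_poly_div_linepath[OF deg n_pos, where q = q and a = a and b = b] by blast
  define \<Phi> where "\<Phi> = (\<lambda>u. poly C (t0 + v * exp u) + (\<Sum>i<n. poly q (z i u) / poly (pderiv P) (z i u) * L i u))"
  have "\<Phi> holomorphic_on W" unfolding \<Phi>_def
    using pderiv_nz by (intro holomorphic_intros hol L) auto
  moreover have "\<Phi> u = 0" if u: "u \<in> ball u0 e" for u
  proof -
    have uW: "u \<in> W" "norm (t0 + v * exp u) > M" using u e(2) by (auto simp: T_def)
    have "\<Phi> u = poly C (t0 + v * exp u) + (\<Sum>i<n. poly q (z i u) / poly (pderiv P) (z i u) *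
        contour_integral (linepath a b) (\<lambda>x. 1 / (x - z i u)))"
      unfolding \<Phi>_def using notin u L(3)
      by (intro arg_cong2[of _ _ _ _ "(+)"] sum.cong refl arg_cong2[of _ _ _ _ "(*)"])
         (auto simp: lg_def winding_number_valid_path)
    also have "\<dots> = contour_integral (linepath a b) (\<lambda>x. poly q x / (poly P x - (t0 + v * exp u)))"
      using M(2) uW by (intro C[symmetric] inj allI impI root) force+
    also have "\<dots> = 0" by (rule cauchy_transform_eq_0[OF mom M(2) uW(2)])
    finally show ?thesis .
  qed
  ultimately have "\<Phi> u = 0" if "u \<in> W" for u
    using analytic_continuation_open[of "ball u0 e" W \<Phi> "\<lambda>_. 0" u] e that
      open_ray_domain connected_ray_domain[OF \<delta>_pos] by auto
  then show ?thesis using that L unfolding \<Phi>_def by blast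
qed

end

context ray_branches
begin

text \<open>By periodicity of the branches, continuing the relation with the logarithms around \<open>t\<^sub>0\<close>
  changes only the logarithms, and only those whose branch tends to \<open>a\<close> or to \<open>b\<close>.\<close>

lemma residue_relation:
  fixes q :: "complex poly" and a b :: complex and r :: "nat \<Rightarrow> complex"
  assumes a: "poly P a = t0" and b: "\<And>u. u \<in> W \<Longrightarrow> poly P b \<noteq> t0 + v * exp u" and ab: "a \<noteq> b"
    and mom: "\<And>i::nat. contour_integral (linepath a b) (\<lambda>z. poly P z ^ i * poly q z) = 0"
    and r: "\<And>i. i < n \<Longrightarrow> (z i \<longlongrightarrow> r i) far_left"
      "\<And>x. poly P x - t0 = lead_coeff P * (\<Prod>i<n. x - r i)"
    and A_def: "A = {i. i < n \<and> r i = a}" and B_def: "B = {i. i < n \<and> r i = b}" and u: "u \<in> W"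
  shows "(\<Sum>i\<in>A. poly q (z i u) / poly (pderiv P) (z i u)) / card A =
         (\<Sum>i\<in>B. poly q (z i u) / poly (pderiv P) (z i u)) / card B"
proof -
  obtain L C where L: "\<And>i. i < n \<Longrightarrow> L i holomorphic_on W"
    "\<And>i u. i < n \<Longrightarrow> u \<in> W \<Longrightarrow> exp (L i u) = (b - z i u) / (a - z i u)"
    "\<And>u. u \<in> W \<Longrightarrow> poly C (t0 + v * exp u) +
       (\<Sum>i<n. poly q (z i u) / poly (pderiv P) (z i u) * L i u) = 0"
    using log_relation[OF a b mom] by blast
  obtain N where N: "N > 0" "\<And>i u. i < n \<Longrightarrow> Re u < - K \<Longrightarrow> z i (u + 2 * pi * \<i> * of_nat N) = z i u"
    using common_period by blast
  have za: "z i u \<noteq> a" if "i < n" "u \<in> W" for i u using root[OF that] a v_nz by auto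
  have zb: "z i u \<noteq> b" if "i < n" "u \<in> W" for i u using root[OF that] b[OF that(2)] by auto
  \<comment> \<open>Where \<open>card A\<close> branches meet at \<open>a\<close>,
    \<open>exp u\<close> is comparable to \<open>(z i u - a) ^ card A\<close>, so \<open>L i\<close>
    behaves like \<open>- u / card A\<close>. Branches tending to \<open>b\<close> give
    \<open>u / card B\<close>, and for the remaining ones the exponential of \<open>L i\<close> has
    a nonzero limit. The default 1 keeps \<open>d\<close> positive.\<close>
  define d where "d = (\<lambda>i. if i \<in> A then card A else if i \<in> B then card B else 1)"
  define j :: "nat \<Rightarrow> int" where "j = (\<lambda>i. if i \<in> A then 1 else if i \<in> B then -1 else 0)"
  have fin: "finite A" "finite B" and AB: "A \<inter> B = {}" "A \<subseteq> {..<n}" "B \<subseteq> {..<n}"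
    using ab by (auto simp: A_def B_def)
  have d_pos: "d i > 0" for i using fin by (auto simp: d_def card_gt_0_iff)
  have split: "(\<Prod>i<n. x - r i) = (x - c) ^ card S * (\<Prod>i\<in>{..<n} - S. x - r i)"
    if "S = {i. i < n \<and> r i = c}" for x c S
  proof -
    have "(\<Prod>i<n. x - r i) = (\<Prod>i\<in>{..<n} - S. x - r i) * (\<Prod>i\<in>S. x - r i)"
      by (rule prod.subset_diff) (auto simp: that)
    also have "(\<Prod>i\<in>S. x - r i) = (\<Prod>i\<in>S. x - c)" by (rule prod.cong) (auto simp: that)
    finally show ?thesis by simp
  qed
  have exp_u: "v * exp u = lead_coeff P * ((z i u - c) ^ card S * (\<Prod>k\<in>{..<n} - S. z i u - r k))"
    if "S = {i. i < n \<and> r i = c}" "i < n" "u \<in> W" for S c i u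
    using root[OF that(2,3)] r(2)[of "z i u"] split[OF that(1), of "z i u"] by simp
  have lim_lead: "((\<lambda>u. lead_coeff P * (\<Prod>k\<in>{..<n} - S. z i u - r k)) \<longlongrightarrow>
      lead_coeff P * (\<Prod>k\<in>{..<n} - S. c - r k)) far_left"
    "lead_coeff P * (\<Prod>k\<in>{..<n} - S. c - r k) \<noteq> 0"
    if "S = {i. i < n \<and> r i = c}" "i \<in> S" for S c i
  proof -
    show "((\<lambda>u. lead_coeff P * (\<Prod>k\<in>{..<n} - S. z i u - r k)) \<longlongrightarrow>
      lead_coeff P * (\<Prod>k\<in>{..<n} - S. c - r k)) far_left"
      using r(1)[of i] that by (intro tendsto_intros) auto
    show "lead_coeff P * (\<Prod>k\<in>{..<n} - S. c - r k) \<noteq> 0"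
      using lead_nz that by auto
  qed
  have "\<exists>g. g \<noteq> 0 \<and> ((\<lambda>u. exp (of_nat (d i) * L i u + of_int (j i) * u)) \<longlongrightarrow> g) far_left" if i: "i < n" for i
  proof -
    have ri: "(z i \<longlongrightarrow> r i) far_left" using r(1) i .
    consider "i \<in> A" | "i \<in> B" "i \<notin> A" | "i \<notin> A" "i \<notin> B" by blast
    then show ?thesis
    proof cases
      case 1
      \<comment> \<open>The vanishing factor of \<open>exp u\<close> cancels the pole of the
        \<open>card A\<close>-th power of the quotient, up to sign.\<close>
      let ?g = "(-1) ^ card A * (b - a) ^ card A * (lead_coeff P * (\<Prod>k\<in>{..<n} - A. a - r k)) / v"
      let ?f = "\<lambda>u. (-1) ^ card A * (b - z i u) ^ card A * (lead_coeff P * (\<Prod>k\<in>{..<n} - A. z i u - r k)) / v"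
      have "r i = a" using 1 by (simp add: A_def)
      then have "(?f \<longlongrightarrow> ?g) far_left"
        using lim_lead(1)[OF A_def 1] ri v_nz by (intro tendsto_intros) auto
      moreover have "\<forall>\<^sub>F u in far_left. ?f u = exp (of_nat (d i) * L i u + of_int (j i) * u)"
        using eventually_in_W
      proof eventually_elim
        case (elim u)
        have neg: "(z i u - a) ^ card A = (-1) ^ card A * (a - z i u) ^ card A"
          by (simp flip: power_mult_distrib)
        have "exp u = lead_coeff P * ((z i u - a) ^ card A * (\<Prod>k\<in>{..<n} - A. z i u - r k)) / v"
          using exp_u[OF A_def i elim] v_nz by (simp add: field_simps)
        then have "exp (of_nat (d i) * L i u + of_int (j i) * u) =
          ((b - z i u) / (a - z i u)) ^ card A * (lead_coeff P * ((z i u - a) ^ card A * (\<Prod>k\<in>{..<n} - A. z i u - r k)) / v)"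
          using 1 L(2)[OF i elim] by (simp add: d_def j_def exp_add exp_of_nat_mult)
        also have "\<dots> = ?f u"
          unfolding neg using za[OF i elim] by (simp add: power_divide)
        finally show ?case by simp
      qed
      ultimately have "((\<lambda>u. exp (of_nat (d i) * L i u + of_int (j i) * u)) \<longlongrightarrow> ?g) far_left"
        by (rule Lim_transform_eventually)
      moreover have "?g \<noteq> 0" using lim_lead(2)[OF A_def 1] ab v_nz by simp
      ultimately show ?thesis by blast
    next
      case 2
      let ?g = "(-1) ^ card B * v / ((a - b) ^ card B * (lead_coeff P * (\<Prod>k\<in>{..<n} - B. b - r k)))"
      let ?f = "\<lambda>u. (-1) ^ card B * v / ((a - z i u) ^ card B * (lead_coeff P * (\<Prod>k\<in>{..<n} - B. z i u - r k)))"
      have "r i = b" using 2 by (simp add: B_def)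
      then have "(?f \<longlongrightarrow> ?g) far_left"
        using lim_lead[OF B_def 2(1)] ri v_nz ab by (intro tendsto_intros) auto
      moreover have "\<forall>\<^sub>F u in far_left. ?f u = exp (of_nat (d i) * L i u + of_int (j i) * u)"
        using eventually_in_W
      proof eventually_elim
        case (elim u)
        have neg: "(z i u - b) ^ card B = (-1) ^ card B * (b - z i u) ^ card B"
          by (simp flip: power_mult_distrib)
        define X where "X = lead_coeff P * (\<Prod>k\<in>{..<n} - B. z i u - r k)"
        have e: "v * exp u = (-1) ^ card B * (b - z i u) ^ card B * X"
          using exp_u[OF B_def i elim] unfolding neg X_def by simp
        then have X0: "X \<noteq> 0" using v_nz by auto
        have "exp (- u) = v / ((-1) ^ card B * (b - z i u) ^ card B * X)"
          unfolding e[symmetric] using v_nz by (simp add: exp_minus field_simps)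
        moreover have "exp (of_nat (d i) * L i u + of_int (j i) * u) = exp (L i u) ^ card B * exp (- u)"
          using 2 by (simp add: d_def j_def exp_add exp_of_nat_mult exp_diff exp_minus divide_inverse)
        ultimately have "exp (of_nat (d i) * L i u + of_int (j i) * u) =
          ((b - z i u) / (a - z i u)) ^ card B * (v / ((-1) ^ card B * (b - z i u) ^ card B * X))"
          by (simp only: L(2)[OF i elim])
        also have "\<dots> = (-1) ^ card B * v / ((a - z i u) ^ card B * X)"
        proof -
          have alg: "(x / y) * (v / (s * x * X)) = s * v / (y * X)"
            if "x \<noteq> 0" "y \<noteq> 0" "s * s = 1" for s x y :: complex
          proof -
            have "s \<noteq> 0" using that(3) by auto
            then have "1 / s = s" using that(3) by (simp add: field_simps)
            moreover have "(x / y) * (v / (s * x * X)) = (1 / s) * v / (y * X)" using that X0 \<open>s \<noteq> 0\<close> by (simp add: field_simps)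
            ultimately show ?thesis by simp
          qed
          show ?thesis unfolding power_divide
            by (rule alg) (use za[OF i elim] zb[OF i elim] in \<open>auto simp flip: power_mult_distrib\<close>)
        qed
        finally show ?case by (simp add: X_def)
      qed
      ultimately have "((\<lambda>u. exp (of_nat (d i) * L i u + of_int (j i) * u)) \<longlongrightarrow> ?g) far_left"
        by (rule Lim_transform_eventually)
      moreover have "?g \<noteq> 0" using lim_lead(2)[OF B_def 2(1)] ab v_nz by simp
      ultimately show ?thesis by blast
    next
      case 3
      then have ne: "r i \<noteq> a" "r i \<noteq> b" using i by (auto simp: A_def B_def)
      have "((\<lambda>u. (b - z i u) / (a - z i u)) \<longlongrightarrow> (b - r i) / (a - r i)) far_left"
        using ri ne by (intro tendsto_intros) auto
      moreover have "\<forall>\<^sub>F u in far_left. (b - z i u) / (a - z i u) = exp (of_nat (d i) * L i u + of_int (j i) * u)"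
        using eventually_in_W by eventually_elim (use 3 L(2)[OF i] in \<open>simp add: d_def j_def\<close>)
      ultimately have "((\<lambda>u. exp (of_nat (d i) * L i u + of_int (j i) * u)) \<longlongrightarrow> (b - r i) / (a - r i)) far_left"
        by (rule Lim_transform_eventually)
      then show ?thesis using ne by (intro exI[of _ "(b - r i) / (a - r i)"]) auto
    qed
  qed
  then obtain g where g: "\<And>i. i < n \<Longrightarrow> g i \<noteq> 0"
    "\<And>i. i < n \<Longrightarrow> ((\<lambda>u. exp (of_nat (d i) * L i u + of_int (j i) * u)) \<longlongrightarrow> g i) far_left" by metis
  define D where "D = 2 * pi * \<i> * of_nat N"
  have D0: "D \<noteq> 0" using N(1) by (simp add: D_def)
  define R where "R = (\<lambda>i u. poly q (z i u) / poly (pderiv P) (z i u))"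
  have "\<forall>\<^sub>F u in far_left. of_nat (d i) * (L i (u + D) - L i u) = - (of_int (j i) * D)" if i: "i < n" for i
    unfolding D_def
  proof (rule log_increment[OF _ _ g(2)[OF i] g(1)[OF i]])
    show "continuous_on {u. Re u < - K} (L i)"
      using L(1)[OF i] left_subset_W by (blast intro: holomorphic_on_imp_continuous_on continuous_on_subset)
    show "exp (L i (u + 2 * pi * \<i> * of_nat N)) = exp (L i u)" if "Re u < - K" for u
      using L(2)[OF i] N(2)[OF i that] that by (simp add: left_in_ray_domain)
  qed
  then have "\<forall>\<^sub>F u in far_left. \<forall>i\<in>{..<n}. of_nat (d i) * (L i (u + D) - L i u) = - (of_int (j i) * D)"
    by (intro eventually_ball_finite) auto
  then obtain k where k: "\<And>i u. i < n \<Longrightarrow> Re u < k \<Longrightarrow> of_nat (d i) * (L i (u + D) - L i u) = - (of_int (j i) * D)"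
    unfolding eventually_far_left by blast
  \<comment> \<open>Times \<open>- D\<close>, this is the relation at \<open>u + D\<close> minus the
    relation at \<open>u\<close>. It therefore vanishes far to the left, and on all of
    \<open>W\<close> by the identity theorem.\<close>
  define \<Psi> where "\<Psi> = (\<lambda>u. \<Sum>i<n. R i u * (of_int (j i) / of_nat (d i)))"
  have "\<Psi> u = 0" if u: "Re u < min k (- K)" for u
  proof -
    have uW: "u \<in> W" "u + D \<in> W" using u by (auto intro!: left_in_ray_domain simp: D_def)
    have e: "exp (u + D) = exp u" unfolding D_def by (rule exp_shift)
    have Rp: "R i (u + D) = R i u" if "i < n" for i using N(2)[OF that] u by (simp add: R_def D_def)
    have L1: "poly C (t0 + v * exp u) + (\<Sum>i<n. R i u * L i u) = 0" using L(3)[OF uW(1)] by (simp add: R_def)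
    have L2: "poly C (t0 + v * exp u) + (\<Sum>i<n. R i u * L i (u + D)) = 0"
    proof -
      have "(\<Sum>i<n. R i (u + D) * L i (u + D)) = (\<Sum>i<n. R i u * L i (u + D))"
        by (intro sum.cong) (simp_all add: Rp)
      moreover have "poly C (t0 + v * exp u) + (\<Sum>i<n. R i (u + D) * L i (u + D)) = 0"
        using L(3)[OF uW(2)] unfolding e by (simp add: R_def)
      ultimately show ?thesis by simp
    qed
    have "(\<Sum>i<n. R i u * (L i (u + D) - L i u)) = 0"
      using L1 L2 unfolding right_diff_distrib sum_subtractf by (metis add_left_cancel diff_self)
    moreover have "L i (u + D) - L i u = - D * (of_int (j i) / of_nat (d i))" if "i < n" for i
      using k[OF that, of u] u d_pos[of i] by (simp add: field_simps)
    ultimately have "(\<Sum>i<n. R i u * (- D * (of_int (j i) / of_nat (d i)))) = 0" by simp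
    then have "- D * \<Psi> u = 0" unfolding \<Psi>_def sum_distrib_left by (simp add: mult_ac)
    then show ?thesis using D0 by simp
  qed
  moreover have "\<Psi> holomorphic_on W"
    unfolding \<Psi>_def R_def using pderiv_nz by (intro holomorphic_intros hol) auto
  moreover have "{u. Re u < min k (- K)} \<noteq> {}"
  proof -
    have "complex_of_real (min k (- K) - 1) \<in> {u. Re u < min k (- K)}" by (auto simp: min_def)
    then show ?thesis by blast
  qed
  moreover have "{u. Re u < min k (- K)} \<subseteq> W" using left_subset_W by auto
  ultimately have "\<Psi> u = (\<lambda>_. 0) u"
    by (intro analytic_continuation_open[of "{u. Re u < min k (- K)}" W \<Psi> "\<lambda>_. 0" u]
        open_halfspace_Re_lt open_ray_domain connected_ray_domain[OF \<delta>_pos] u) auto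
  moreover have "\<Psi> u = (\<Sum>i\<in>A. R i u) / card A - (\<Sum>i\<in>B. R i u) / card B"
  proof -
    have "\<Psi> u = (\<Sum>i\<in>A \<union> B. R i u * (of_int (j i) / of_nat (d i)))"
      unfolding \<Psi>_def using AB by (intro sum.mono_neutral_right) (auto simp: j_def)
    also have "\<dots> = (\<Sum>i\<in>A. R i u * (of_int (j i) / of_nat (d i))) + (\<Sum>i\<in>B. R i u * (of_int (j i) / of_nat (d i)))"
      by (rule sum.union_disjoint[OF fin AB(1)])
    also have "(\<Sum>i\<in>A. R i u * (of_int (j i) / of_nat (d i))) = (\<Sum>i\<in>A. R i u) / card A"
      unfolding sum_divide_distrib by (intro sum.cong) (auto simp: j_def d_def)
    also have "(\<Sum>i\<in>B. R i u * (of_int (j i) / of_nat (d i))) = (\<Sum>i\<in>B. - (R i u / card B))"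
      using AB by (intro sum.cong) (auto simp: j_def d_def)
    finally show ?thesis by (simp add: sum_negf sum_divide_distrib)
  qed
  ultimately show ?thesis by (simp add: R_def)
qed

end

section \<open>Directions of the branches at infinity\<close>

context ray_branches
begin

lemma branch_at_top: "filterlim (\<lambda>x. z i (of_real x)) at_infinity at_top" if i: "i < n"
proof -
  have "filterlim (\<lambda>x. poly P (z i (of_real x))) at_infinity at_top"
  proof -
    have "filterlim (\<lambda>x. norm v * exp x) at_top at_top"
      using v_nz by (intro filterlim_tendsto_pos_mult_at_top[OF tendsto_const] exp_at_top) auto
    then have "filterlim (\<lambda>x. norm (v * exp (of_real x :: complex))) at_top at_top"
      by (simp add: norm_mult)
    then have "filterlim (\<lambda>x. v * exp (of_real x :: complex)) at_infinity at_top"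
      by (rule filterlim_norm_at_top_imp_at_infinity)
    then have "filterlim (\<lambda>x. t0 + v * exp (of_real x :: complex)) at_infinity at_top"
      by (rule tendsto_add_filterlim_at_infinity[OF tendsto_const])
    then show ?thesis using i by (simp add: root of_real_in_ray_domain[OF \<delta>_pos])
  qed
  show ?thesis unfolding filterlim_at_infinity[OF order_refl]
  proof (intro allI impI)
    fix r :: real assume "r > 0"
    have "compact (poly P ` cball 0 r)" by (intro compact_continuous_image continuous_intros) auto
    then obtain M where M: "M > 0" "\<And>w. w \<in> cball 0 r \<Longrightarrow> norm (poly P w) \<le> M"
      using compact_imp_bounded bounded_pos by (metis imageI)
    have "\<forall>\<^sub>F x in at_top. M + 1 \<le> norm (poly P (z i (of_real x)))"
      using \<open>filterlim (\<lambda>x. poly P (z i (of_real x))) at_infinity at_top\<close> M(1)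
      unfolding filterlim_at_infinity[OF order_refl] by (metis add_pos_pos zero_less_one)
    then show "\<forall>\<^sub>F x in at_top. r \<le> norm (z i (of_real x))"
    proof eventually_elim
      case (elim x)
      then show ?case using M(2)[of "z i (of_real x)"] by (cases "norm (z i (of_real x)) \<le> r") auto
    qed
  qed
qed

lemma monom_ratio_lim:
  fixes p :: "complex poly"
  assumes "filterlim f at_infinity F"
  shows "((\<lambda>x. poly p (f x) / f x ^ degree p) \<longlongrightarrow> lead_coeff p) F"
  using filterlim_compose[OF poly_divide_tendsto_aux assms] .

text \<open>Comparing leading terms, the \<open>n\<close>-th power of the quotient tends to 1, and
  connectedness of the half-line makes each branch settle on one root of unity.\<close>

lemma direction_limits:
  assumes \<kappa>: "lead_coeff P * \<kappa> ^ n = v"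
  obtains w where "\<And>i. i < n \<Longrightarrow> w i ^ n = 1" "inj_on w {..<n}"
    "\<And>i. i < n \<Longrightarrow> ((\<lambda>x. z i (of_real x) / (\<kappa> * of_real (exp (x / n)))) \<longlongrightarrow> w i) at_top"
proof -
  have \<kappa>0: "\<kappa> \<noteq> 0" using \<kappa> v_nz n_pos by (auto simp: power_0_left)
  define h where "h = (\<lambda>x. \<kappa> * of_real (exp (x / n)))"
  have h0: "h x \<noteq> 0" for x using \<kappa>0 by (simp add: h_def)
  have hn: "lead_coeff P * h x ^ n = v * of_real (exp x)" for x
  proof -
    have "exp (x / n) ^ n = exp x" using n_pos by (simp flip: exp_of_nat_mult)
    then have "h x ^ n = \<kappa> ^ n * of_real (exp x)"
      by (simp add: h_def power_mult_distrib flip: of_real_power)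
    then show ?thesis using \<kappa> by (simp add: mult.assoc flip: \<kappa>)
  qed
  have small: "((\<lambda>x. c / (v * of_real (exp x))) \<longlongrightarrow> 0) at_top" for c :: complex
  proof -
    have "((\<lambda>x. of_real (exp (- x)) :: complex) \<longlongrightarrow> of_real 0) at_top"
      by (intro tendsto_of_real filterlim_compose[OF exp_at_bot filterlim_uminus_at_bot_at_top])
    from tendsto_mult[OF tendsto_const this]
    have "((\<lambda>x. c / v * of_real (exp (- x))) \<longlongrightarrow> c / v * of_real 0) at_top" .
    then show ?thesis by (simp add: exp_minus field_simps)
  qed
  define F :: "complex poly" where "F = monom 1 n - 1"
  have F: "poly F y = y ^ n - 1" for y by (simp add: F_def poly_monom)
  have F0: "F \<noteq> 0" using F[of 0] F[of 2] n_pos by (auto simp: power_0_left)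
  have "\<exists>w. poly F w = 0 \<and> ((\<lambda>x. z i (of_real x) / h x) \<longlongrightarrow> w) at_top" if i: "i < n" for i
  proof (rule tendsto_root_of_poly_tendsto_0[OF F0 trivial_limit_at_top_linorder])
    have zne: "\<forall>\<^sub>F x in at_top. z i (of_real x) \<noteq> 0"
      using filterlim_at_infinity_imp_eventually_ne[OF branch_at_top[OF i]] .
    have "((\<lambda>x. poly P (z i (of_real x)) / z i (of_real x) ^ n) \<longlongrightarrow> lead_coeff P) at_top"
      using monom_ratio_lim[OF branch_at_top[OF i], of P] deg by simp
    then have "((\<lambda>x. lead_coeff P / (poly P (z i (of_real x)) / z i (of_real x) ^ n) * (t0 / (v * of_real (exp x)) + 1) - 1)
       \<longlongrightarrow> lead_coeff P / lead_coeff P * (0 + 1) - 1) at_top"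
      using lead_nz by (intro tendsto_intros small) auto
    then have lim: "((\<lambda>x. lead_coeff P / (poly P (z i (of_real x)) / z i (of_real x) ^ n) * (t0 / (v * of_real (exp x)) + 1) - 1)
       \<longlongrightarrow> 0) at_top" using lead_nz by simp
    have pne: "\<forall>\<^sub>F x in at_top. poly P (z i (of_real x)) \<noteq> 0"
      using filterlim_at_infinity_imp_eventually_ne[OF filterlim_compose[OF filterlim_poly_at_infinity[OF deg_pos] branch_at_top[OF i]]] .
    have "\<forall>\<^sub>F x in at_top. lead_coeff P / (poly P (z i (of_real x)) / z i (of_real x) ^ n) * (t0 / (v * of_real (exp x)) + 1) - 1
       = poly F (z i (of_real x) / h x)"
      using pne
    proof eventually_elim
      case (elim x)
      have e: "poly P (z i (of_real x)) = t0 + v * of_real (exp x)"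
        using root[OF i of_real_in_ray_domain[OF \<delta>_pos], of x] by (simp add: exp_of_real)
      define E where "E = v * of_real (exp x)"
      have E: "E \<noteq> 0" "E = lead_coeff P * h x ^ n" using v_nz hn[of x] by (simp_all add: E_def)
      have "t0 + E \<noteq> 0" using elim e by (simp add: E_def)
      moreover have "c / (T / Z) * (t0 / E + 1) - 1 = Z / H - 1"
        if "t0 + E = T" "T \<noteq> 0" "E = c * H" for c T Z H :: complex
        using that E(1) by (simp add: field_simps)
      ultimately show ?case
        unfolding F power_divide e E_def[symmetric] using E(2) by blast
    qed
    then show "((\<lambda>x. poly F (z i (of_real x) / h x)) \<longlongrightarrow> 0) at_top"
      by (rule Lim_transform_eventually[OF lim])
    fix Q :: "real \<Rightarrow> bool" assume "eventually Q at_top"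
    then obtain k where k: "\<And>x. x \<ge> k \<Longrightarrow> Q x" unfolding eventually_at_top_linorder by blast
    have cz: "continuous_on UNIV (\<lambda>x. z i (of_real x))"
      by (rule continuous_on_compose2[OF cont[OF i]]) (auto intro!: continuous_intros of_real_in_ray_domain[OF \<delta>_pos])
    show "\<exists>S. connected S \<and> continuous_on S (\<lambda>x. z i (of_real x) / h x) \<and> (\<forall>x\<in>S. Q x) \<and> (\<forall>\<^sub>F x in at_top. x \<in> S)"
      by (rule exI[of _ "{k..}"])
         (use k h0 n_pos in \<open>auto intro!: continuous_intros continuous_on_subset[OF cz] simp: h_def eventually_ge_at_top\<close>)
  qed blast
  then obtain w where w: "\<And>i. i < n \<Longrightarrow> poly F (w i) = 0"
    "\<And>i. i < n \<Longrightarrow> ((\<lambda>x. z i (of_real x) / h x) \<longlongrightarrow> w i) at_top" by metis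
  have wn: "w i ^ n = 1" if "i < n" for i using w(1)[OF that] by (simp add: F)
  \<comment> \<open>Every root of unity \<open>y\<close> is reached: the factorisation at
    \<open>h x * y\<close>, divided by its leading term, tends to 0, so the product of all
    \<open>y - w i\<close> is 0. Injectivity then follows by counting.\<close>
  have "{y. y ^ n = 1} \<subseteq> w ` {..<n}"
  proof safe
    fix y :: complex assume y: "y ^ n = 1"
    then have y0: "y \<noteq> 0" using n_pos by (auto simp: power_0_left)
    have inf: "filterlim (\<lambda>x. h x * y) at_infinity at_top"
    proof (rule filterlim_norm_at_top_imp_at_infinity)
      have "filterlim (\<lambda>x. exp (x / n)) at_top at_top"
      proof (rule filterlim_compose[OF exp_at_top])
        have "filterlim (\<lambda>x. 1 / n * x) at_top at_top"
          using n_pos by (intro filterlim_tendsto_pos_mult_at_top[OF tendsto_const _ filterlim_ident]) auto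
        then show "filterlim (\<lambda>x. x / n) at_top at_top" by simp
      qed
      then have "filterlim (\<lambda>x. (norm \<kappa> * norm y) * exp (x / n)) at_top at_top"
        using \<kappa>0 y0 by (intro filterlim_tendsto_pos_mult_at_top[OF tendsto_const]) auto
      then show "filterlim (\<lambda>x. norm (h x * y)) at_top at_top"
        by (simp add: h_def norm_mult mult_ac)
    qed
    have "((\<lambda>x. poly P (h x * y) / (h x * y) ^ n / lead_coeff P - (t0 / (v * of_real (exp x)) + 1))
       \<longlongrightarrow> lead_coeff P / lead_coeff P - (0 + 1)) at_top"
      using monom_ratio_lim[OF inf, of P] deg lead_nz by (intro tendsto_intros small) auto
    moreover have "poly P (h x * y) / (h x * y) ^ n / lead_coeff P - (t0 / (v * of_real (exp x)) + 1)
       = (\<Prod>i<n. y - z i (of_real x) / h x)" for x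
    proof -
      define E where "E = v * of_real (exp x)"
      have E: "E \<noteq> 0" "E = lead_coeff P * h x ^ n" using v_nz hn[of x] by (simp_all add: E_def)
      have "poly P (h x * y) - (t0 + E) = lead_coeff P * (\<Prod>i<n. h x * y - z i (of_real x))"
        using factor[OF of_real_in_ray_domain[OF \<delta>_pos], of "h x * y" x] by (simp add: E_def exp_of_real)
      also have "(\<Prod>i<n. h x * y - z i (of_real x)) = (\<Prod>i<n. h x * (y - z i (of_real x) / h x))"
        using h0 by (intro prod.cong) (auto simp: field_simps)
      also have "\<dots> = h x ^ n * (\<Prod>i<n. y - z i (of_real x) / h x)" by (simp add: prod.distrib)
      finally have *: "poly P (h x * y) - (t0 + E) = E * (\<Prod>i<n. y - z i (of_real x) / h x)"
        unfolding E(2) by (simp add: mult.assoc)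
      have eq1: "poly P (h x * y) / (h x * y) ^ n / lead_coeff P = poly P (h x * y) / E"
        using y unfolding E(2) by (simp add: power_mult_distrib mult.commute)
      then have "poly P (h x * y) / (h x * y) ^ n / lead_coeff P - (t0 / E + 1) = (poly P (h x * y) - (t0 + E)) / E"
        unfolding eq1 using E(1) by (simp add: diff_divide_distrib add_divide_distrib)
      then show ?thesis unfolding E_def[symmetric] * using E(1) by simp
    qed
    ultimately have "((\<lambda>x. \<Prod>i<n. y - z i (of_real x) / h x) \<longlongrightarrow> 0) at_top" using lead_nz by simp
    moreover have "((\<lambda>x. \<Prod>i<n. y - z i (of_real x) / h x) \<longlongrightarrow> (\<Prod>i<n. y - w i)) at_top"
      by (intro tendsto_intros w) auto
    ultimately have "(\<Prod>i<n. y - w i) = 0" by (rule tendsto_unique[OF trivial_limit_at_top_linorder, rotated])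
    then show "y \<in> w ` {..<n}" by (auto simp: prod_zero_iff)
  qed
  then have "w ` {..<n} = {y. y ^ n = 1}" using wn by auto
  then have "card (w ` {..<n}) = card {..<n}" using card_roots_unity_eq[OF n_pos] by simp
  then have "inj_on w {..<n}" by (intro eq_card_imp_inj_on) auto
  then show ?thesis using that[of w] wn w(2) by (simp add: h_def)
qed

text \<open>To leading order the residue is a constant times the power \<open>m - n\<close> of the
  branch, and the branch is asymptotic to \<open>w * h x\<close>. Rescaling leaves
  \<open>w ^ m / w ^ n\<close>, which is \<open>w ^ m\<close>. The powers of \<open>h x\<close> stay
  separate because \<open>m\<close> may be smaller than \<open>n\<close>.\<close>

lemma residue_lim:
  fixes Q :: "complex poly"
  assumes m: "degree Q = m" "m > 0" and i: "i < n" and \<kappa>0: "\<kappa> \<noteq> 0" and w: "w ^ n = 1"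
    and lim: "((\<lambda>x. z i (of_real x) / (\<kappa> * of_real (exp (x / n)))) \<longlongrightarrow> w) at_top"
  defines "h \<equiv> \<lambda>x. \<kappa> * of_real (exp (x / n))"
  shows "((\<lambda>x. poly (pderiv Q) (z i (of_real x)) / poly (pderiv P) (z i (of_real x)) * h x ^ n / h x ^ m)
    \<longlongrightarrow> (of_nat m * lead_coeff Q) / (of_nat n * lead_coeff P) * w ^ m) at_top"
proof -
  have h0: "h x \<noteq> 0" for x using \<kappa>0 by (simp add: h_def)
  have w0: "w \<noteq> 0" using w n_pos by (auto simp: power_0_left)
  have ratio: "((\<lambda>x. poly (pderiv p) (z i (of_real x)) / h x ^ (degree p - 1)) \<longlongrightarrow> of_nat (degree p) * lead_coeff p * w ^ (degree p - 1)) at_top"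
    if "degree p > 0" for p :: "complex poly"
  proof -
    have dp: "degree (pderiv p) = degree p - 1" "lead_coeff (pderiv p) = of_nat (degree p) * lead_coeff p"
      using that by (simp_all add: degree_pderiv coeff_pderiv)
    have "((\<lambda>x. poly (pderiv p) (z i (of_real x)) / z i (of_real x) ^ (degree p - 1) * (z i (of_real x) / h x) ^ (degree p - 1))
       \<longlongrightarrow> of_nat (degree p) * lead_coeff p * w ^ (degree p - 1)) at_top"
    proof (intro tendsto_mult[of _ "of_nat (degree p) * lead_coeff p"] tendsto_power)
      show "((\<lambda>x. poly (pderiv p) (z i (of_real x)) / z i (of_real x) ^ (degree p - 1)) \<longlongrightarrow> of_nat (degree p) * lead_coeff p) at_top"
        unfolding dp(2)[symmetric] using monom_ratio_lim[OF branch_at_top[OF i], of "pderiv p"] by (simp only: dp(1))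
    qed (use lim in \<open>simp add: h_def\<close>)
    moreover have "\<forall>\<^sub>F x in at_top. z i (of_real x) \<noteq> 0"
      using filterlim_at_infinity_imp_eventually_ne[OF branch_at_top[OF i]] .
    then have "\<forall>\<^sub>F x in at_top. poly (pderiv p) (z i (of_real x)) / z i (of_real x) ^ (degree p - 1) * (z i (of_real x) / h x) ^ (degree p - 1)
       = poly (pderiv p) (z i (of_real x)) / h x ^ (degree p - 1)"
      by eventually_elim (simp add: power_divide)
    ultimately show ?thesis by (rule Lim_transform_eventually)
  qed
  have "((\<lambda>x. (poly (pderiv Q) (z i (of_real x)) / h x ^ (m - 1)) / (poly (pderiv P) (z i (of_real x)) / h x ^ (n - 1)))
     \<longlongrightarrow> (of_nat m * lead_coeff Q * w ^ (m - 1)) / (of_nat n * lead_coeff P * w ^ (n - 1))) at_top"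
    using ratio[of Q] ratio[of P] m deg n_pos w0 lead_nz by (intro tendsto_divide) auto
  moreover have "(poly (pderiv Q) (z i (of_real x)) / h x ^ (m - 1)) / (poly (pderiv P) (z i (of_real x)) / h x ^ (n - 1)) =
     poly (pderiv Q) (z i (of_real x)) / poly (pderiv P) (z i (of_real x)) * h x ^ n / h x ^ m" for x
  proof -
    have "h x ^ n = h x * h x ^ (n - 1)" "h x ^ m = h x * h x ^ (m - 1)"
      using n_pos m by (simp_all add: power_eq_if)
    then show ?thesis using h0 by (simp add: field_simps)
  qed
  moreover have "(of_nat m * lead_coeff Q * w ^ (m - 1)) / (of_nat n * lead_coeff P * w ^ (n - 1)) =
     (of_nat m * lead_coeff Q) / (of_nat n * lead_coeff P) * w ^ m"
  proof -
    have "w * w ^ (n - 1) = 1" "w ^ m = w * w ^ (m - 1)" using n_pos m w by (simp_all flip: power_eq_if add: power_eq_if)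
    then have "w ^ (m - 1) / w ^ (n - 1) = w ^ m"
      using w0 by (simp add: field_simps)
    moreover have "(of_nat m * lead_coeff Q * w ^ (m - 1)) / (of_nat n * lead_coeff P * w ^ (n - 1)) =
      (of_nat m * lead_coeff Q) / (of_nat n * lead_coeff P) * (w ^ (m - 1) / w ^ (n - 1))" by simp
    ultimately show ?thesis by simp
  qed
  ultimately show ?thesis by simp
qed

end

section \<open>Curves from the end points to infinity\<close>

text \<open>The rescaled residue relation has a limit along the ray, namely the same equation for
  the \<open>w i ^ m\<close>. Clearing denominators makes it an integer relation, which transfers to
  the \<open>w i\<close>.\<close>

lemma (in ray_branches) direction_relation:
  fixes Q :: "complex poly" and a b \<kappa> :: complex and r w :: "nat \<Rightarrow> complex"
  assumes m: "degree Q = m" "m > 0" "coprime m n"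
    and a: "poly P a = t0" and b: "\<And>u. u \<in> W \<Longrightarrow> poly P b \<noteq> t0 + v * exp u" and ab: "a \<noteq> b"
    and mom: "\<And>i::nat. contour_integral (linepath a b) (\<lambda>z. poly P z ^ i * poly (pderiv Q) z) = 0"
    and r: "\<And>i. i < n \<Longrightarrow> (z i \<longlongrightarrow> r i) far_left"
      "\<And>x. poly P x - t0 = lead_coeff P * (\<Prod>i<n. x - r i)"
    and \<kappa>: "\<kappa> \<noteq> 0" and w: "\<And>i. i < n \<Longrightarrow> w i ^ n = 1"
    and lim: "\<And>i. i < n \<Longrightarrow> ((\<lambda>x. z i (of_real x) / (\<kappa> * of_real (exp (x / n)))) \<longlongrightarrow> w i) at_top"
    and A_def: "A = {i. i < n \<and> r i = a}" and B_def: "B = {i. i < n \<and> r i = b}"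
  shows "(\<Sum>i\<in>A. w i) / card A = (\<Sum>i\<in>B. w i) / card B"
proof -
  have fin: "finite A" "finite B" and AB: "A \<inter> B = {}" "A \<subseteq> {..<n}" "B \<subseteq> {..<n}"
    using ab by (auto simp: A_def B_def)
  define h where "h = (\<lambda>x. \<kappa> * of_real (exp (x / n)))"
  define R where "R = (\<lambda>i x. poly (pderiv Q) (z i (of_real x)) / poly (pderiv P) (z i (of_real x)) * h x ^ n / h x ^ m)"
  define c where "c = (of_nat m * lead_coeff Q) / (of_nat n * lead_coeff P)"
  have c0: "c \<noteq> 0" using m(1,2) n_pos lead_nz by (auto simp: c_def)
  have R_lim: "((\<lambda>x. (\<Sum>i\<in>S. R i x) / card S) \<longlongrightarrow> (\<Sum>i\<in>S. c * w i ^ m) / card S) at_top" if "S \<subseteq> {..<n}" for S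
  proof -
    have "((\<lambda>x. \<Sum>i\<in>S. R i x) \<longlongrightarrow> (\<Sum>i\<in>S. c * w i ^ m)) at_top"
    proof (rule tendsto_sum)
      fix i assume "i \<in> S"
      then have i: "i < n" using that by auto
      show "(R i \<longlongrightarrow> c * w i ^ m) at_top"
        unfolding R_def h_def c_def by (rule residue_lim[OF m(1,2) i \<kappa> w[OF i] lim[OF i]])
    qed
    from tendsto_mult[OF this tendsto_const[of "inverse (of_nat (card S))"]]
    show ?thesis unfolding divide_inverse .
  qed
  have "(\<Sum>i\<in>A. R i x) / card A = (\<Sum>i\<in>B. R i x) / card B" for x
  proof -
    have R: "(\<Sum>i\<in>S. R i x) / card S = (\<Sum>i\<in>S. poly (pderiv Q) (z i (of_real x)) / poly (pderiv P) (z i (of_real x))) / card S * (h x ^ n / h x ^ m)" for S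
      unfolding R_def sum_divide_distrib sum_distrib_right by (intro sum.cong refl) (simp add: divide_inverse mult_ac)
    show ?thesis unfolding R
      using residue_relation[OF a b ab mom r A_def B_def of_real_in_ray_domain[OF \<delta>_pos]] by simp
  qed
  then have "((\<lambda>x. (\<Sum>i\<in>A. R i x) / card A) \<longlongrightarrow> (\<Sum>i\<in>B. c * w i ^ m) / card B) at_top"
    using R_lim[OF AB(3)] by simp
  then have "(\<Sum>i\<in>A. c * w i ^ m) / card A = (\<Sum>i\<in>B. c * w i ^ m) / card B"
    using R_lim[OF AB(2)] by (metis tendsto_unique trivial_limit_at_top_linorder)
  then have eq: "(\<Sum>i\<in>A. w i ^ m) / card A = (\<Sum>i\<in>B. w i ^ m) / card B"
  proof -
    have "(\<Sum>i\<in>S. c * w i ^ m) / card S = c * ((\<Sum>i\<in>S. w i ^ m) / card S)" for S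
      by (simp flip: sum_distrib_left)
    then show ?thesis using c0 \<open>(\<Sum>i\<in>A. c * w i ^ m) / card A = (\<Sum>i\<in>B. c * w i ^ m) / card B\<close>
      by (metis mult_cancel_left)
  qed
  \<comment> \<open>Cross-multiplication by the cardinalities clears denominators. An empty set has
    average 0, and the value 1 then keeps the other sum from being multiplied by 0.\<close>
  define p where "p = (if B = {} then 1 else int (card B))"
  define p' where "p' = (if A = {} then 1 else int (card A))"
  have *: "(\<Sum>i\<in>A. x i) / card A = (\<Sum>i\<in>B. x i) / card B \<longleftrightarrow>
     (\<Sum>i\<in>A \<union> B. of_int (if i \<in> A then p else - p') * x i) = 0"
    for x :: "nat \<Rightarrow> complex"
  proof -
    have "(\<Sum>i\<in>A \<union> B. of_int (if i \<in> A then p else - p') * x i) =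
       (\<Sum>i\<in>A. of_int p * x i) + (\<Sum>i\<in>B. - (of_int p' * x i))"
      unfolding sum.union_disjoint[OF fin AB(1)] using AB(1)
      by (intro arg_cong2[of _ _ _ _ "(+)"] sum.cong) auto
    also have "\<dots> = of_int p * (\<Sum>i\<in>A. x i) - of_int p' * (\<Sum>i\<in>B. x i)"
      by (simp add: sum_distrib_left sum_negf)
    finally show ?thesis using fin
      by (cases "A = {}"; cases "B = {}") (auto simp: p_def p'_def field_simps)
  qed
  show ?thesis unfolding *
    by (rule roots_unity_relation_transfer[OF n_pos m(3)])
       (use fin AB w eq[unfolded *] in auto)
qed

lemma ray_branches_exist:
  fixes P :: "complex poly"
  assumes "degree P = n" "n > 0" "v \<noteq> 0" "finite E" "poly P ` {z. poly (pderiv P) z = 0} \<subseteq> E"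
    and gen: "\<And>e s. e \<in> E \<Longrightarrow> s > 0 \<Longrightarrow> e \<noteq> t0 + of_real s * v"
  obtains K \<delta> z where "ray_branches P n t0 v K \<delta> z"
    "\<And>u e. u \<in> ray_domain K \<delta> \<Longrightarrow> e \<in> E \<Longrightarrow> e \<noteq> t0 + v * exp u"
proof -
  \<comment> \<open>The exceptional values in the coordinate \<open>exp u\<close>. The value
    \<open>t0\<close> is dropped because \<open>exp u\<close> is never 0; by \<open>gen\<close> no
    element of \<open>X\<close> is a positive real.\<close>
  define X where "X = (\<lambda>e. (e - t0) / v) ` (E - {t0})"
  have finX: "finite X" using assms(4) by (simp add: X_def)
  have X: "x \<noteq> 0" "Arg x \<noteq> 0" if x: "x \<in> X" for x
  proof -
    obtain e where e: "e \<in> E" "e \<noteq> t0" "x = (e - t0) / v" using x by (auto simp: X_def)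
    show "x \<noteq> 0" using e assms(3) by simp
    show "Arg x \<noteq> 0"
    proof
      assume "Arg x = 0"
      then have "x = of_real (norm x)" using Arg_eq[OF \<open>x \<noteq> 0\<close>] by simp
      moreover have "e = t0 + x * v" using e(3) assms(3) by simp
      ultimately have "e = t0 + of_real (norm x) * v" by metis
      then show False using gen[OF e(1), of "norm x"] \<open>x \<noteq> 0\<close> by simp
    qed
  qed
  \<comment> \<open>The smallest absolute argument and the smallest modulus in \<open>X\<close>, so
    that neither the strip nor the half-plane reaches \<open>X\<close>. The bound \<open>pi\<close>
    makes \<open>Im u\<close> the principal argument of \<open>exp u\<close> on the strip; the added
    elements also keep both minima defined when \<open>X\<close> is empty.\<close>
  define \<delta> where "\<delta> = Min ({pi} \<union> (\<lambda>x. \<bar>Arg x\<bar>) ` X)"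
  define \<rho> where "\<rho> = Min ({1} \<union> norm ` X)"
  have \<delta>: "\<delta> > 0" "\<delta> \<le> pi" "\<And>x. x \<in> X \<Longrightarrow> \<delta> \<le> \<bar>Arg x\<bar>"
    unfolding \<delta>_def using finX X by (auto intro!: Min_le)
  have \<rho>: "\<rho> > 0" "\<And>x. x \<in> X \<Longrightarrow> \<rho> \<le> norm x"
    unfolding \<rho>_def using finX X by (auto intro!: Min_le)
  define K where "K = - ln \<rho>"
  have notX: "exp u \<notin> X" if u: "u \<in> ray_domain K \<delta>" for u
  proof
    assume eX: "exp u \<in> X"
    consider "Re u < - K" | "\<bar>Im u\<bar> < \<delta>" using u by (auto simp: ray_domain_def)
    then show False
    proof cases
      case 1
      then have "exp (Re u) < \<rho>" using \<rho>(1) by (metis K_def exp_less_cancel_iff exp_ln minus_minus)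
      then show False using \<rho>(2)[OF eX] by simp
    next
      case 2
      then have "Arg (exp u) = Im u" using \<delta>(2) by (intro Arg_exp) auto
      then show False using \<delta>(3)[OF eX] 2 by simp
    qed
  qed
  have notE: "e \<noteq> t0 + v * exp u" if "u \<in> ray_domain K \<delta>" "e \<in> E" for u e
  proof
    assume e: "e = t0 + v * exp u"
    then have "e \<noteq> t0" "exp u = (e - t0) / v" using assms(3) by auto
    then have "exp u \<in> X" using that(2) by (auto simp: X_def)
    then show False using notX that(1) by blast
  qed
  have reg: "t0 + v * exp u \<in> regular_values P" if "u \<in> ray_domain K \<delta>" for u
    using notE[OF that] assms(5) by (auto simp: regular_values_def)
  have ne: "ray_domain K \<delta> \<noteq> {}" using of_real_in_ray_domain[OF \<delta>(1), of 0 K] by blast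
  obtain z where z: "\<And>i. i < n \<Longrightarrow> z i holomorphic_on ray_domain K \<delta>"
    "\<And>i u. i < n \<Longrightarrow> u \<in> ray_domain K \<delta> \<Longrightarrow> poly P (z i u) = t0 + v * exp u"
    "\<And>u. u \<in> ray_domain K \<delta> \<Longrightarrow> inj_on (\<lambda>i. z i u) {..<n}"
    by (rule root_branches_exist[OF assms(1,2) open_ray_domain simply_connected_ray_domain[OF \<delta>(1), of K] ne, of "\<lambda>u. t0 + v * exp u"])
       (use reg in \<open>auto intro!: holomorphic_intros\<close>)
  have "ray_branches P n t0 v K \<delta> z"
    by standard (use assms(1-3) \<delta>(1) z reg in auto)
  then show ?thesis using that notE by blast
qed

lemma sgn_of_ratio_lim:
  fixes f :: "real \<Rightarrow> complex" and g :: "real \<Rightarrow> real"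
  assumes "((\<lambda>x. f x / (\<kappa> * of_real (g x))) \<longlongrightarrow> w) F" "\<And>x. g x > 0" "\<kappa> \<noteq> 0" "norm w = 1"
  shows "((\<lambda>x. sgn (f x)) \<longlongrightarrow> sgn \<kappa> * w) F"
proof -
  have w: "w \<noteq> 0" "sgn w = w" using assms(4) by (auto simp: sgn_eq)
  have "((\<lambda>x. sgn \<kappa> * sgn (f x / (\<kappa> * of_real (g x)))) \<longlongrightarrow> sgn \<kappa> * sgn w) F"
    using assms(1) w(1) by (intro tendsto_intros)
  moreover have "sgn \<kappa> * sgn (f x / (\<kappa> * of_real (g x))) = sgn (f x)" for x
  proof -
    have "f x = \<kappa> * of_real (g x) * (f x / (\<kappa> * of_real (g x)))"
      using assms(2)[of x] assms(3) by simp
    then have "sgn (f x) = sgn \<kappa> * sgn (of_real (g x)) * sgn (f x / (\<kappa> * of_real (g x)))"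
      by (metis sgn_mult)
    then show ?thesis using assms(2)[of x] by (simp add: sgn_of_real)
  qed
  ultimately show ?thesis using w(2) by simp
qed

lemma norm_root_unity:
  fixes z :: complex
  assumes "z ^ n = 1" "n > 0"
  shows "norm z = 1"
  using assms by (metis norm_one norm_power norm_ge_zero power_eq_1_iff not_gr_zero)

text \<open>The substitution \<open>s = exp x\<close> turns the branches into curves over the closed
  ray, with the limits \<open>r i\<close> as starting points. The result is free of the locale so
  that two rays with different initial values can be combined.\<close>

lemma endpoint_curves:
  fixes P Q :: "complex poly" and a b \<kappa> v :: complex
  assumes P: "degree P = n" "n > 0" and Q: "degree Q = m" "m > 0" "coprime m n" and ab: "a \<noteq> b"
    and mom: "\<And>i::nat. contour_integral (linepath a b) (\<lambda>z. poly P z ^ i * poly (pderiv Q) z) = 0"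
    and v: "v \<noteq> 0" "lead_coeff P * \<kappa> ^ n = v"
    and gen: "\<And>e s. e \<in> insert (poly P b) (poly P ` {z. poly (pderiv P) z = 0}) \<Longrightarrow> s > 0 \<Longrightarrow> e \<noteq> poly P a + of_real s * v"
  obtains f w where
    "\<And>i. i < n \<Longrightarrow> continuous_on {0..} (f i)"
    "\<And>i s. i < n \<Longrightarrow> s \<ge> 0 \<Longrightarrow> poly P (f i s) = poly P a + of_real s * v"
    "\<And>i j s. i < n \<Longrightarrow> j < n \<Longrightarrow> s > 0 \<Longrightarrow> f i s = f j s \<Longrightarrow> i = j"
    "\<And>i. i < n \<Longrightarrow> filterlim (f i) at_infinity at_top"
    "\<And>i. i < n \<Longrightarrow> ((\<lambda>s. sgn (f i s)) \<longlongrightarrow> sgn \<kappa> * w i) at_top"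
    "\<And>i. i < n \<Longrightarrow> w i ^ n = 1" "inj_on w {..<n}"
    "\<And>c. poly P c = poly P a \<Longrightarrow> {i. i < n \<and> f i 0 = c} \<noteq> {}"
    "(\<Sum>i | i < n \<and> f i 0 = a. w i) / card {i. i < n \<and> f i 0 = a} =
     (\<Sum>i | i < n \<and> f i 0 = b. w i) / card {i. i < n \<and> f i 0 = b}"
proof -
  have "pderiv P \<noteq> 0" using P by (simp add: pderiv_eq_0_iff)
  then have fin: "finite (insert (poly P b) (poly P ` {z. poly (pderiv P) z = 0}))"
    by (simp add: poly_roots_finite)
  obtain K \<delta> z where rb: "ray_branches P n (poly P a) v K \<delta> z"
    and notE: "\<And>u e. u \<in> ray_domain K \<delta> \<Longrightarrow> e \<in> insert (poly P b) (poly P ` {z. poly (pderiv P) z = 0}) \<Longrightarrow> e \<noteq> poly P a + v * exp u"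
    using ray_branches_exist[OF P v(1) fin subset_insertI gen] by blast
  interpret ray_branches P n "poly P a" v K \<delta> z by (rule rb)
  have \<kappa>0: "\<kappa> \<noteq> 0" using v P(2) by (auto simp: power_0_left)
  obtain r where r: "\<And>i. i < n \<Longrightarrow> (z i \<longlongrightarrow> r i) far_left"
    "\<And>x. poly P x - poly P a = lead_coeff P * (\<Prod>i<n. x - r i)"
    using left_limits by blast
  obtain w where w: "\<And>i. i < n \<Longrightarrow> w i ^ n = 1" "inj_on w {..<n}"
    "\<And>i. i < n \<Longrightarrow> ((\<lambda>x. z i (of_real x) / (\<kappa> * of_real (exp (x / n)))) \<longlongrightarrow> w i) at_top"
    using direction_limits[OF v(2)] by blast
  have w1: "norm (w i) = 1" if "i < n" for i
    using norm_root_unity[OF w(1)[OF that] P(2)] .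
  have rP: "poly P (r i) = poly P a" if "i < n" for i
  proof -
    have "(\<Prod>j<n. r i - r j) = 0" using that by (intro prod_zero) auto
    then have "poly P (r i) - poly P a = 0" using r(2)[of "r i"] by (simp only: mult_zero_right)
    then show ?thesis by simp
  qed
  define f where "f = (\<lambda>i s. if s = 0 then r i else z i (of_real (ln s)))"
  have inW: "complex_of_real x \<in> ray_domain K \<delta>" for x by (rule of_real_in_ray_domain[OF \<delta>_pos])
  have f_eq: "\<forall>\<^sub>F s in at_top. z i (of_real (ln s)) = f i s" for i
    using eventually_gt_at_top[of 0] by eventually_elim (simp add: f_def)
  show ?thesis
  proof (rule that[of f w])
    fix i assume i: "i < n"
    show "continuous_on {0..} (f i)"
    proof (rule continuous_on_eq_continuous_within[THEN iffD2], rule ballI)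
      fix s :: real assume s: "s \<in> {0..}"
      show "continuous (at s within {0..}) (f i)"
      proof (cases "s = 0")
        case True
        have "filterlim (\<lambda>s. complex_of_real (ln s)) far_left (at_right 0)"
          by (simp add: filterlim_filtercomap_iff o_def ln_at_0)
        then have "((\<lambda>s. z i (of_real (ln s))) \<longlongrightarrow> r i) (at_right 0)"
          by (rule filterlim_compose[OF r(1)[OF i]])
        moreover have "\<forall>\<^sub>F s in at_right 0. z i (of_real (ln s)) = f i s"
          by (simp add: eventually_at_right_less eventually_at_filter f_def)
        ultimately have "(f i \<longlongrightarrow> r i) (at_right 0)" by (rule Lim_transform_eventually)
        moreover have "at 0 within {0..} = at_right (0 :: real)"
          by (rule at_within_Ici_at_right)
        ultimately show ?thesis unfolding True continuous_within by (simp add: f_def)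
      next
        case False
        then have s0: "s > 0" using s by simp
        have "continuous_on {0<..} (\<lambda>s. z i (of_real (ln s)))"
          by (rule continuous_on_compose2[OF cont[OF i]]) (auto intro!: continuous_intros inW)
        then have "continuous_on {0<..} (f i)" by (rule continuous_on_eq) (auto simp: f_def)
        then show ?thesis using s0 by (simp add: continuous_on_eq_continuous_at continuous_at_imp_continuous_within)
      qed
    qed
    show "filterlim (f i) at_infinity at_top"
      using filterlim_compose[OF branch_at_top[OF i] ln_at_top]
      by (rule filterlim_cong[THEN iffD1, OF refl refl f_eq])
    have "((\<lambda>x. sgn (z i (of_real x))) \<longlongrightarrow> sgn \<kappa> * w i) at_top"
      by (rule sgn_of_ratio_lim[OF w(3)[OF i] _ \<kappa>0 w1[OF i]]) simp
    from filterlim_compose[OF this ln_at_top]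
    have "((\<lambda>s. sgn (z i (of_real (ln s)))) \<longlongrightarrow> sgn \<kappa> * w i) at_top" .
    moreover have "\<forall>\<^sub>F s in at_top. sgn (z i (of_real (ln s))) = sgn (f i s)"
      using f_eq[of i] by eventually_elim simp
    ultimately show "((\<lambda>s. sgn (f i s)) \<longlongrightarrow> sgn \<kappa> * w i) at_top" by (rule Lim_transform_eventually)
    show "w i ^ n = 1" using w(1) i .
  next
    fix i and s :: real assume i: "i < n" and s: "s \<ge> 0"
    show "poly P (f i s) = poly P a + of_real s * v"
      using s rP[OF i] root[OF i inW, of "ln s"] by (auto simp: f_def exp_of_real mult.commute)
  next
    fix i j and s :: real assume "i < n" "j < n" "s > 0" "f i s = f j s"
    then show "i = j" using inj[OF inW, of "ln s"] by (auto simp: f_def inj_on_def)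
  next
    show "inj_on w {..<n}" by (rule w(2))
  next
    fix c assume "poly P c = poly P a"
    then have "(\<Prod>i<n. c - r i) = 0" using r(2)[of c] lead_nz by simp
    then show "{i. i < n \<and> f i 0 = c} \<noteq> {}" by (auto simp: prod_zero_iff f_def)
  next
    have "(\<Sum>i | i < n \<and> r i = a. w i) / card {i. i < n \<and> r i = a} =
     (\<Sum>i | i < n \<and> r i = b. w i) / card {i. i < n \<and> r i = b}"
      using notE by (intro direction_relation[OF Q _ _ ab mom r \<kappa>0 w(1,3) refl refl]) auto
    then show "(\<Sum>i | i < n \<and> f i 0 = a. w i) / card {i. i < n \<and> f i 0 = a} =
     (\<Sum>i | i < n \<and> f i 0 = b. w i) / card {i. i < n \<and> f i 0 = b}" by (simp add: f_def)
  qed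
qed

text \<open>Only finitely many slopes are forbidden. Fixing the component along \<open>d\<close> to
  be 1 keeps the direction in an open half-plane, which later makes two rays in opposite half-planes
  disjoint.\<close>

lemma generic_direction:
  fixes E :: "complex set"
  assumes "finite E" "d \<noteq> 0"
  obtains x :: real where "\<And>e s. e \<in> E \<Longrightarrow> s > 0 \<Longrightarrow> e \<noteq> t + of_real s * (d * Complex 1 x)"
proof -
  have "finite ((\<lambda>e. Im ((e - t) / d) / Re ((e - t) / d)) ` E)" using assms(1) by simp
  then obtain x where x: "x \<notin> (\<lambda>e. Im ((e - t) / d) / Re ((e - t) / d)) ` E"
    using ex_new_if_finite[OF infinite_UNIV_char_0] by blast
  have "e \<noteq> t + of_real s * (d * Complex 1 x)" if "e \<in> E" "s > 0" for e s
  proof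
    assume "e = t + of_real s * (d * Complex 1 x)"
    then have "(e - t) / d = of_real s * Complex 1 x" using assms(2) by simp
    then have "Im ((e - t) / d) / Re ((e - t) / d) = x" using that(2) by simp
    then show False using x that(1) by blast
  qed
  then show ?thesis using that by blast
qed

lemma lead_root_exists:
  assumes "degree P = n" "n > 0" "v \<noteq> 0"
  obtains \<kappa> :: complex where "lead_coeff P * \<kappa> ^ n = v"
proof -
  have lc: "lead_coeff P \<noteq> 0" using assms by auto
  define \<kappa> where "\<kappa> = exp (Ln (v / lead_coeff P) / n)"
  have "\<kappa> ^ n = exp (Ln (v / lead_coeff P))"
    using assms(2) by (simp add: \<kappa>_def flip: exp_of_nat_mult)
  then have "lead_coeff P * \<kappa> ^ n = v" using lc assms(3) by simp
  then show ?thesis using that by blast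
qed

lemma separated_endpoint_curves:
  fixes f g :: "nat \<Rightarrow> real \<Rightarrow> complex" and u u' :: "nat \<Rightarrow> complex"
  assumes cont: "\<And>i. i \<in> A \<Longrightarrow> continuous_on {0..} (f i)" "\<And>j. j \<in> B \<Longrightarrow> continuous_on {0..} (g j)"
    and inf: "\<And>i. i \<in> A \<Longrightarrow> filterlim (f i) at_infinity at_top" "\<And>j. j \<in> B \<Longrightarrow> filterlim (g j) at_infinity at_top"
    and dir: "\<And>i. i \<in> A \<Longrightarrow> ((\<lambda>s. sgn (f i s)) \<longlongrightarrow> u i) at_top" "\<And>j. j \<in> B \<Longrightarrow> ((\<lambda>s. sgn (g j s)) \<longlongrightarrow> u' j) at_top"
    and start: "\<And>i. i \<in> A \<Longrightarrow> f i 0 = a" "\<And>j. j \<in> B \<Longrightarrow> g j 0 = b"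
    and disj: "\<And>i j s s'. i \<in> A \<Longrightarrow> j \<in> B \<Longrightarrow> s \<ge> 0 \<Longrightarrow> s' \<ge> 0 \<Longrightarrow> f i s \<noteq> g j s'"
    and fin: "finite A" "A \<noteq> {}" "finite B" "B \<noteq> {}"
    and unit: "\<And>i. i \<in> A \<Longrightarrow> norm (u i) = 1" "\<And>j. j \<in> B \<Longrightarrow> norm (u' j) = 1"
    and dirs: "u ` A \<inter> u' ` B = {}"
  shows "(\<Sum>i\<in>A. u i) / card A \<noteq> (\<Sum>j\<in>B. u' j) / card B"
proof
  assume eq: "(\<Sum>i\<in>A. u i) / card A = (\<Sum>j\<in>B. u' j) / card B"
  obtain i1 i2 j1 j2 \<alpha>1 \<alpha>2 \<beta>1 \<beta>2 where *: "i1 \<in> A" "i2 \<in> A" "j1 \<in> B" "j2 \<in> B"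
    "u i1 = cis \<alpha>1" "u i2 = cis \<alpha>2" "u' j1 = cis \<beta>1" "u' j2 = cis \<beta>2"
    "\<beta>1 < \<alpha>1" "\<alpha>1 < \<beta>2" "\<beta>2 < \<alpha>2" "\<alpha>2 < \<beta>1 + 2 * pi"
    using circle_sums_interlace[OF fin unit dirs eq] by metis
  show False
  proof (rule no_interlaced_curves)
    show "(f i1 ` {0..} \<union> f i2 ` {0..}) \<inter> (g j1 ` {0..} \<union> g j2 ` {0..}) = {}"
      using disj *(1-4) by fastforce
    show "((\<lambda>s. sgn (f i1 s)) \<longlongrightarrow> cis \<alpha>1) at_top" "((\<lambda>s. sgn (f i2 s)) \<longlongrightarrow> cis \<alpha>2) at_top"
      "((\<lambda>s. sgn (g j1 s)) \<longlongrightarrow> cis \<beta>1) at_top" "((\<lambda>s. sgn (g j2 s)) \<longlongrightarrow> cis \<beta>2) at_top"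
      using dir *(1-8) by metis+
  qed (use cont inf start * in auto)
qed

lemma moments_not_all_zero_coprime:
  fixes P Q :: "complex poly" and a b :: complex
  assumes P: "degree P = n" "n > 0" and Q: "degree Q = m" "m > 0" "coprime m n" and ab: "a \<noteq> b"
    and mom: "\<And>i::nat. contour_integral (linepath a b) (\<lambda>z. poly P z ^ i * poly (pderiv Q) z) = 0"
  shows False
proof -
  define E where "E = insert (poly P a) (insert (poly P b) (poly P ` {z. poly (pderiv P) z = 0}))"
  have "pderiv P \<noteq> 0" using P by (simp add: pderiv_eq_0_iff)
  then have finE: "finite E" by (simp add: E_def poly_roots_finite)
  show False
  proof (cases "poly P a = poly P b")
    case True
    obtain x where x: "\<And>e s. e \<in> E \<Longrightarrow> s > 0 \<Longrightarrow> e \<noteq> poly P a + of_real s * (1 * Complex 1 x)"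
      using generic_direction[OF finE, of 1 "poly P a"] by auto
    define v where "v = Complex 1 x"
    have v: "v \<noteq> 0" by (simp add: v_def complex_eq_iff)
    obtain \<kappa> where \<kappa>: "lead_coeff P * \<kappa> ^ n = v" using lead_root_exists[OF P v] by blast
    have \<kappa>0: "\<kappa> \<noteq> 0" using \<kappa> v P(2) by (auto simp: power_0_left)
    have gen: "e \<noteq> poly P a + of_real s * v"
      if "e \<in> insert (poly P b) (poly P ` {z. poly (pderiv P) z = 0})" "s > 0" for e s
      using x[of e s] that by (auto simp: E_def v_def)
    obtain f w where fw:
      "\<And>i. i < n \<Longrightarrow> continuous_on {0..} (f i)"
      "\<And>i s. i < n \<Longrightarrow> s \<ge> 0 \<Longrightarrow> poly P (f i s) = poly P a + of_real s * v"
      "\<And>i j s. i < n \<Longrightarrow> j < n \<Longrightarrow> s > 0 \<Longrightarrow> f i s = f j s \<Longrightarrow> i = j"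
      "\<And>i. i < n \<Longrightarrow> filterlim (f i) at_infinity at_top"
      "\<And>i. i < n \<Longrightarrow> ((\<lambda>s. sgn (f i s)) \<longlongrightarrow> sgn \<kappa> * w i) at_top"
      "\<And>i. i < n \<Longrightarrow> w i ^ n = 1" "inj_on w {..<n}"
      "\<And>c. poly P c = poly P a \<Longrightarrow> {i. i < n \<and> f i 0 = c} \<noteq> {}"
      "(\<Sum>i | i < n \<and> f i 0 = a. w i) / card {i. i < n \<and> f i 0 = a} =
       (\<Sum>i | i < n \<and> f i 0 = b. w i) / card {i. i < n \<and> f i 0 = b}"
      using endpoint_curves[OF P Q ab mom v \<kappa> gen] by blast
    define A where "A = {i. i < n \<and> f i 0 = a}"
    define B where "B = {i. i < n \<and> f i 0 = b}"
    have "(\<Sum>i\<in>A. sgn \<kappa> * w i) / card A \<noteq> (\<Sum>i\<in>B. sgn \<kappa> * w i) / card B"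
    proof (rule separated_endpoint_curves[where f = f and g = f and a = a and b = b])
      \<comment> \<open>A common point has one image under \<open>P\<close>, so
        \<open>s = s'\<close>. At positive parameters distinct branches never meet, and at parameter
        0 the curves start at different points.\<close>
      show "f i s \<noteq> f j s'" if "i \<in> A" "j \<in> B" "s \<ge> 0" "s' \<ge> 0" for i j s s'
      proof
        assume e: "f i s = f j s'"
        then have "s = s'" using fw(2)[of i s] fw(2)[of j s'] that v by (auto simp: A_def B_def)
        moreover have "s \<noteq> 0" using e that ab \<open>s = s'\<close> by (auto simp: A_def B_def)
        ultimately have "i = j" using fw(3)[of i j s] e that by (auto simp: A_def B_def)
        then show False using that ab by (auto simp: A_def B_def)
      qed
      show "norm (sgn \<kappa> * w i) = 1" if "i \<in> A" for i
        using that norm_root_unity[OF fw(6) P(2)] \<kappa>0 by (auto simp: A_def norm_mult norm_sgn)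
      show "norm (sgn \<kappa> * w i) = 1" if "i \<in> B" for i
        using that norm_root_unity[OF fw(6) P(2)] \<kappa>0 by (auto simp: B_def norm_mult norm_sgn)
      show "(\<lambda>i. sgn \<kappa> * w i) ` A \<inter> (\<lambda>i. sgn \<kappa> * w i) ` B = {}"
        using fw(7) ab \<kappa>0 by (force simp: A_def B_def inj_on_def sgn_zero_iff)
      show "A \<noteq> {}" "B \<noteq> {}" using fw(8) True by (auto simp: A_def B_def)
    qed (use fw in \<open>auto simp: A_def B_def\<close>)
    moreover have "(\<Sum>i\<in>S. sgn \<kappa> * w i) / card S = sgn \<kappa> * ((\<Sum>i\<in>S. w i) / card S)" for S
      by (simp flip: sum_distrib_left)
    ultimately show False using fw(9) by (simp add: A_def B_def)
  next
    case False
    \<comment> \<open>The rays from \<open>P a\<close> and \<open>P b\<close> get a positive and a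
      negative component along \<open>d\<close>, so they lead away from each other.\<close>
    define d where "d = poly P a - poly P b"
    have d: "d \<noteq> 0" "- d \<noteq> 0" using False by (auto simp: d_def)
    obtain x where x: "\<And>e s. e \<in> E \<Longrightarrow> s > 0 \<Longrightarrow> e \<noteq> poly P a + of_real s * (d * Complex 1 x)"
      using generic_direction[OF finE d(1), of "poly P a"] by auto
    obtain y where y: "\<And>e s. e \<in> E \<Longrightarrow> s > 0 \<Longrightarrow> e \<noteq> poly P b + of_real s * (- d * Complex 1 y)"
      using generic_direction[OF finE d(2), of "poly P b"] by auto
    define v where "v = d * Complex 1 x"
    define v' where "v' = - d * Complex 1 y"
    have v: "v \<noteq> 0" "v' \<noteq> 0" using d Complex_eq_0[of 1] by (auto simp: v_def v'_def)
    obtain \<kappa> where \<kappa>: "lead_coeff P * \<kappa> ^ n = v" using lead_root_exists[OF P v(1)] by blast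
    obtain \<kappa>' where \<kappa>': "lead_coeff P * \<kappa>' ^ n = v'" using lead_root_exists[OF P v(2)] by blast
    have \<kappa>0: "\<kappa> \<noteq> 0" "\<kappa>' \<noteq> 0" using \<kappa> \<kappa>' v P(2) by (auto simp: power_0_left)
    have gen: "e \<noteq> poly P a + of_real s * v"
      if "e \<in> insert (poly P b) (poly P ` {z. poly (pderiv P) z = 0})" "s > 0" for e s
      using x[of e s] that by (auto simp: E_def v_def)
    have gen': "e \<noteq> poly P b + of_real s * v'"
      if "e \<in> insert (poly P a) (poly P ` {z. poly (pderiv P) z = 0})" "s > 0" for e s
      using y[of e s] that by (auto simp: E_def v'_def)
    have mom': "contour_integral (linepath b a) (\<lambda>z. poly P z ^ i * poly (pderiv Q) z) = 0" for i
    proof -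
      have "contour_integral (linepath b a) (\<lambda>z. poly P z ^ i * poly (pderiv Q) z) =
        - contour_integral (linepath a b) (\<lambda>z. poly P z ^ i * poly (pderiv Q) z)"
        by (rule contour_integral_reverse_linepath) (intro continuous_intros)
      then show ?thesis using mom by simp
    qed
    obtain f w where fw:
      "\<And>i. i < n \<Longrightarrow> continuous_on {0..} (f i)"
      "\<And>i s. i < n \<Longrightarrow> s \<ge> 0 \<Longrightarrow> poly P (f i s) = poly P a + of_real s * v"
      "\<And>i j s. i < n \<Longrightarrow> j < n \<Longrightarrow> s > 0 \<Longrightarrow> f i s = f j s \<Longrightarrow> i = j"
      "\<And>i. i < n \<Longrightarrow> filterlim (f i) at_infinity at_top"
      "\<And>i. i < n \<Longrightarrow> ((\<lambda>s. sgn (f i s)) \<longlongrightarrow> sgn \<kappa> * w i) at_top"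
      "\<And>i. i < n \<Longrightarrow> w i ^ n = 1" "inj_on w {..<n}"
      "\<And>c. poly P c = poly P a \<Longrightarrow> {i. i < n \<and> f i 0 = c} \<noteq> {}"
      "(\<Sum>i | i < n \<and> f i 0 = a. w i) / card {i. i < n \<and> f i 0 = a} =
       (\<Sum>i | i < n \<and> f i 0 = b. w i) / card {i. i < n \<and> f i 0 = b}"
      using endpoint_curves[OF P Q ab mom v(1) \<kappa> gen] by blast
    obtain g w' where gw:
      "\<And>i. i < n \<Longrightarrow> continuous_on {0..} (g i)"
      "\<And>i s. i < n \<Longrightarrow> s \<ge> 0 \<Longrightarrow> poly P (g i s) = poly P b + of_real s * v'"
      "\<And>i j s. i < n \<Longrightarrow> j < n \<Longrightarrow> s > 0 \<Longrightarrow> g i s = g j s \<Longrightarrow> i = j"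
      "\<And>i. i < n \<Longrightarrow> filterlim (g i) at_infinity at_top"
      "\<And>i. i < n \<Longrightarrow> ((\<lambda>s. sgn (g i s)) \<longlongrightarrow> sgn \<kappa>' * w' i) at_top"
      "\<And>i. i < n \<Longrightarrow> w' i ^ n = 1" "inj_on w' {..<n}"
      "\<And>c. poly P c = poly P b \<Longrightarrow> {i. i < n \<and> g i 0 = c} \<noteq> {}"
      "(\<Sum>i | i < n \<and> g i 0 = b. w' i) / card {i. i < n \<and> g i 0 = b} =
       (\<Sum>i | i < n \<and> g i 0 = a. w' i) / card {i. i < n \<and> g i 0 = a}"
      using endpoint_curves[OF P Q ab[symmetric] mom' v(2) \<kappa>' gen'] by blast
    define A where "A = {i. i < n \<and> f i 0 = a}"
    define B where "B = {i. i < n \<and> g i 0 = b}"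
    have A0: "(\<Sum>i\<in>A. w i) = 0"
    proof -
      \<comment> \<open>The curves start over \<open>P a\<close>, so the average on the right is
        over the empty set.\<close>
      have "{i. i < n \<and> f i 0 = b} = {}" using fw(2)[of _ 0] False by force
      then have "(\<Sum>i\<in>A. w i) / card A = 0" using fw(9) unfolding A_def by simp
      moreover have "finite A" "A \<noteq> {}" using fw(8)[of a] by (simp_all add: A_def)
      ultimately show ?thesis by simp
    qed
    have B0: "(\<Sum>i\<in>B. w' i) = 0"
    proof -
      have "{i. i < n \<and> g i 0 = a} = {}" using gw(2)[of _ 0] False by force
      then have "(\<Sum>i\<in>B. w' i) / card B = 0" using gw(9) unfolding B_def by simp
      moreover have "finite B" "B \<noteq> {}" using gw(8)[of b] by (simp_all add: B_def)
      ultimately show ?thesis by simp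
    qed
    have "(\<Sum>i\<in>A. sgn \<kappa> * w i) / card A \<noteq> (\<Sum>i\<in>B. sgn \<kappa>' * w' i) / card B"
    proof (rule separated_endpoint_curves[where f = f and g = g and a = a and b = b])
      show "f i s \<noteq> g j s'" if "i \<in> A" "j \<in> B" "s \<ge> 0" "s' \<ge> 0" for i j s s'
      proof
        assume e: "f i s = g j s'"
        then have "poly P a + of_real s * v = poly P b + of_real s' * v'"
          using fw(2)[of i s] gw(2)[of j s'] that by (auto simp: A_def B_def)
        then have "d * (1 + of_real s * Complex 1 x + of_real s' * Complex 1 y) = 0"
          by (simp add: d_def v_def v'_def algebra_simps)
        then have "Re (1 + of_real s * Complex 1 x + of_real s' * Complex 1 y) = 0"
          using d(1) by simp
        then show False using that by simp
      qed
      show "norm (sgn \<kappa> * w i) = 1" if "i \<in> A" for i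
        using that norm_root_unity[OF fw(6) P(2)] \<kappa>0 by (auto simp: A_def norm_mult norm_sgn)
      show "norm (sgn \<kappa>' * w' i) = 1" if "i \<in> B" for i
        using that norm_root_unity[OF gw(6) P(2)] \<kappa>0 by (auto simp: B_def norm_mult norm_sgn)
      \<comment> \<open>A common direction would make \<open>\<kappa> ^ n\<close> and
        \<open>\<kappa>' ^ n\<close>, hence \<open>v\<close> and \<open>v'\<close>, positive
        multiples of each other, although their components along \<open>d\<close> have opposite
        signs.\<close>
      show "(\<lambda>i. sgn \<kappa> * w i) ` A \<inter> (\<lambda>i. sgn \<kappa>' * w' i) ` B = {}"
      proof (rule ccontr)
        assume "\<not> ?thesis"
        then obtain i j where ij: "i < n" "j < n" "sgn \<kappa> * w i = sgn \<kappa>' * w' j"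
          by (auto simp: A_def B_def)
        have "(sgn \<kappa> * w i) ^ n = (sgn \<kappa>' * w' j) ^ n" using ij(3) by simp
        then have "sgn \<kappa> ^ n = sgn \<kappa>' ^ n" unfolding power_mult_distrib fw(6)[OF ij(1)] gw(6)[OF ij(2)] by simp
        then have "of_real (norm \<kappa>' ^ n) * \<kappa> ^ n = of_real (norm \<kappa> ^ n) * \<kappa>' ^ n"
          using \<kappa>0 by (simp add: sgn_eq power_divide field_simps)
        then have "of_real (norm \<kappa>' ^ n) * v = of_real (norm \<kappa> ^ n) * v'"
          unfolding \<kappa>[symmetric] \<kappa>'[symmetric] by (metis mult.left_commute)
        then have "d * (of_real (norm \<kappa>' ^ n) * Complex 1 x + of_real (norm \<kappa> ^ n) * Complex 1 y) = 0"
          by (simp add: v_def v'_def algebra_simps)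
        then have "Re (of_real (norm \<kappa>' ^ n) * Complex 1 x + of_real (norm \<kappa> ^ n) * Complex 1 y) = 0"
          using d(1) by simp
        then have "norm \<kappa>' ^ n + norm \<kappa> ^ n = 0" by simp
        moreover have "norm \<kappa>' ^ n > 0" "norm \<kappa> ^ n > 0" using \<kappa>0 by auto
        ultimately show False by linarith
      qed
      show "A \<noteq> {}" "B \<noteq> {}" using fw(8) gw(8) by (auto simp: A_def B_def)
    qed (use fw gw in \<open>auto simp: A_def B_def\<close>)
    then show False using A0 B0 by (simp flip: sum_distrib_left)
  qed
qed

theorem corollary4p3:
  fixes P q Q :: "complex poly" and a b :: complex and m n :: nat
  assumes "q \<noteq> 0"
    and "pderiv Q = q"
    and "degree P = n"
    and "degree Q = m"
    and "a \<noteq> b"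
    and "\<And>i::nat. contour_integral (linepath a b) (\<lambda>z. poly P z ^ i * poly q z) = 0"
  shows "gcd m n > 1"
proof (rule ccontr)
  assume "\<not> gcd m n > 1"
  moreover have m: "m > 0" using assms(1,2,4) pderiv_eq_0_iff[of Q] by auto
  then have "gcd m n > 0" by simp
  ultimately have gcd: "gcd m n = 1" by linarith
  show False
  proof (cases "n = 0")
    case True
    \<comment> \<open>For constant \<open>P\<close>, \<open>gcd m 0 = m\<close> makes
      \<open>q\<close> a constant, and the zeroth moment is that constant times
      \<open>b - a\<close>.\<close>
    then have "m = 1" using gcd by simp
    then obtain c where c: "q = [:c:]" using assms(2,4) degree_pderiv[of Q]
      by (metis diff_self_eq_0 degree_eq_zeroE)
    then have "contour_integral (linepath a b) (\<lambda>z. c) = 0" using assms(6)[of 0] by simp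
    then have "c * (b - a) = 0" by simp
    then show False using c assms(1,5) by simp
  next
    case False
    then show False
      using moments_not_all_zero_coprime[OF assms(3) _ assms(4) m _ assms(5)] gcd assms(6) assms(2)
      by (auto simp: coprime_iff_gcd_eq_1)
  qed
qed

end
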